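(* For any $p_{\theta_1},p_{\theta_2}\in\mathcal{N}$, $$d_{\mathrm{AIRM}}(\mathcal{F}(\theta_1),\mathcal{F}(\theta_2))\le d_{\mathcal{F}}(\theta_1,\theta_2),$$ with equality if and only if the AIRM geodesic connecting $\mathcal{F}(\theta_1)$ to $\mathcal{F}(\theta_2)$ lies entirely within $\mathcal{M}=\mathcal{F}(\mathcal{N})$.
   Context: Let $(X,\mathcal{X},\mu)$ be a $\sigma$-finite measure space and let $\mathcal{M}_\mu$ be the set of measurable $p:X\to\mathbb{R}$ with $p>0$ $\mu$-a.e. and $\int_X p\,d\mu=1$. For $p\in\mathcal{M}_\mu$ write $\mathbb{E}_p[u]=\int_X u\,p\,d\mu$ (entrywise for matrices). Fix a reference density $p\in\mathcal{M}_\mu$. Let $B_p$ be the Banach space of ($\mu$-a.e. classes of) measurable $u:X\to\mathbb{R}$ such that $\mathbb{E}_p[\cosh(\alpha u)-1]<\infty$ for some $\alpha>0$ and $\mathbb{E}_p[u]=0$, with norm $\|u\|_p=\inf\{r>0:\mathbb{E}_p[\cosh(u/r)-1]\le 1\}$. For $u\in B_p$ let $K_p(u)=\log\mathbb{E}_p[e^u]\in[0,+\infty]$, $\mathrm{Dom}(K_p)=\{u\in B_p:K_p(u)<\infty\}$, with interior $\mathrm{Dom}(K_p)^\circ$ in $B_p$. Fix $d\ge 1$ and $u_1,\ldots,u_d\in B_p$ linearly independent in $L^2(p\cdot\mu)$ (standing assumption). Let $\Theta=\{\theta\in\mathbb{R}^d:\sum_j\theta_ju_j\in\mathrm{Dom}(K_p)^\circ\}$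 (open), $\psi(\theta)=K_p(\sum_j\theta_ju_j)$, $p_\theta=e^{\sum_j\theta_ju_j-\psi(\theta)}p$, $\mathcal{N}=\{p_\theta:\theta\in\Theta\}$. Let $V(x)=(u_1(x),\ldots,u_d(x),1)^\top$ and $\mathcal{F}:\mathcal{N}\to\mathrm{SPD}(d+1)$, $\mathcal{F}(p_\theta)=S(\theta)=\mathbb{E}_{p_\theta}[VV^\top]$; one writes $\mathcal{F}(\theta)$ for $\mathcal{F}(p_\theta)$. $\mathrm{SPD}(m)$ is the set of real symmetric positive definite $m\times m$ matrices. The affine-invariant Riemannian metric (AIRM) is $\langle\Xi,\Omega\rangle_S=\frac12\mathrm{tr}(S^{-1}\Xi S^{-1}\Omega)$; its unique geodesic from $S_0$ to $S_1$ is $\gamma(t)=S_0^{1/2}(S_0^{-1/2}S_1S_0^{-1/2})^tS_0^{1/2}$, $t\in[0,1]$, and its Riemannian distance is $d_{\mathrm{AIRM}}(S_0,S_1)=\frac{1}{\sqrt2}\|\log(S_0^{-1/2}S_1S_0^{-1/2})\|_F$. The pullback metric on $\Theta$ is $g^{\mathcal{F}}_{jk}(\theta)=\frac12\mathrm{tr}\left(S^{-1}\frac{\partial S}{\partial\theta_j}S^{-1}\frac{\partial S}{\partial\theta_k}\right)$, and $d_{\mathcal{F}}(\theta_1,\theta_2)=d_{\mathcal{F}}(p_{\theta_1},p_{\theta_2})=\inf_\gamma\int_0^1\sqrt{g^{\mathcal{F}}_{\gamma(t)}(\dot\gamma(t),\dot\gamma(t))}\,dt$, the infimum over smooth paths $\gamma:[0,1]\to\Theta$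 with $\gamma(0)=\theta_1$, $\gamma(1)=\theta_2$. *)

theory Defs
  imports "HOL-Analysis.Analysis"
begin

section \<open>Densities and the exponential Orlicz space at a reference density\<close>

definition densities :: "'a measure \<Rightarrow> ('a \<Rightarrow> real) set" where
  "densities M = {p. p \<in> borel_measurable M \<and> (AE x in M. p x > 0) \<and> has_bochner_integral M p 1}"

definition expect :: "'a measure \<Rightarrow> ('a \<Rightarrow> real) \<Rightarrow> ('a \<Rightarrow> real) \<Rightarrow> real" where
  "expect M p f = (\<integral>x. f x * p x \<partial>M)"

text \<open>Expectation of a nonnegative function, with the value \<open>\<infinity>\<close> allowed (the Bochner integral
  above is \<open>0\<close> on functions that are not integrable).\<close>

definition nn_expect :: "'a measure \<Rightarrow> ('a \<Rightarrow> real) \<Rightarrow> ('a \<Rightarrow> real) \<Rightarrow> ennreal" where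
  "nn_expect M p f = (\<integral>\<^sup>+x. ennreal (f x * p x) \<partial>M)"

text \<open>Elements of \<open>B\<^sub>p\<close> are represented by functions instead of a.e. classes; every notion below
  is invariant under a.e. modification, and two functions are the same point of \<open>B\<^sub>p\<close> iff their
  distance is \<open>0\<close>.\<close>

definition B_space :: "'a measure \<Rightarrow> ('a \<Rightarrow> real) \<Rightarrow> ('a \<Rightarrow> real) set" where
  "B_space M p = {u. u \<in> borel_measurable M
      \<and> (\<exists>\<alpha>>0. nn_expect M p (\<lambda>x. cosh (\<alpha> * u x) - 1) < \<infinity>)
      \<and> expect M p u = 0}"

definition B_norm :: "'a measure \<Rightarrow> ('a \<Rightarrow> real) \<Rightarrow> ('a \<Rightarrow> real) \<Rightarrow> real" where
  "B_norm M p u = Inf {r. r > 0 \<and> nn_expect M p (\<lambda>x. cosh (u x / r) - 1) \<le> 1}"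

text \<open>\<open>K\<^sub>p(u) = log E\<^sub>p[e\<^sup>u] \<in> [0,\<infinity>]\<close>.\<close>

definition K_fun :: "'a measure \<Rightarrow> ('a \<Rightarrow> real) \<Rightarrow> ('a \<Rightarrow> real) \<Rightarrow> ereal" where
  "K_fun M p u =
    (let E = nn_expect M p (\<lambda>x. exp (u x)) in if E < \<infinity> then ereal (ln (enn2real E)) else \<infinity>)"

definition K_dom :: "'a measure \<Rightarrow> ('a \<Rightarrow> real) \<Rightarrow> ('a \<Rightarrow> real) set" where
  "K_dom M p = {u \<in> B_space M p. K_fun M p u < \<infinity>}"

definition K_dom_interior :: "'a measure \<Rightarrow> ('a \<Rightarrow> real) \<Rightarrow> ('a \<Rightarrow> real) set" where
  "K_dom_interior M p = {u \<in> B_space M p. \<exists>\<epsilon>>0. \<forall>v\<in>B_space M p.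
      B_norm M p (\<lambda>x. v x - u x) < \<epsilon> \<longrightarrow> v \<in> K_dom M p}"

section \<open>The finite-dimensional exponential family\<close>

text \<open>\<open>\<real>\<^sup>d\<close> is \<open>real ^ 'd\<close>, so \<open>d = CARD('d) \<ge> 1\<close>.\<close>

definition lincomb :: "('d::finite \<Rightarrow> 'a \<Rightarrow> real) \<Rightarrow> real ^ 'd \<Rightarrow> 'a \<Rightarrow> real" where
  "lincomb u \<theta> x = (\<Sum>j\<in>UNIV. \<theta> $ j * u j x)"

text \<open>Linear independence of the classes of \<open>u\<^sub>j\<close> in \<open>L\<^sup>2(p\<cdot>\<mu>)\<close>: being the zero vector there
  means vanishing \<open>p\<cdot>\<mu>\<close>-almost everywhere.\<close>

definition lin_indep_L2 :: "'a measure \<Rightarrow> ('a \<Rightarrow> real) \<Rightarrow> ('d::finite \<Rightarrow> 'a \<Rightarrow> real) \<Rightarrow> bool" where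
  "lin_indep_L2 M p u \<longleftrightarrow>
    (\<forall>c::real ^ 'd. (AE x in density M (\<lambda>x. ennreal (p x)). lincomb u c x = 0) \<longrightarrow> c = 0)"

definition Theta :: "'a measure \<Rightarrow> ('a \<Rightarrow> real) \<Rightarrow> ('d::finite \<Rightarrow> 'a \<Rightarrow> real) \<Rightarrow> (real ^ 'd) set" where
  "Theta M p u = {\<theta>. lincomb u \<theta> \<in> K_dom_interior M p}"

definition psi :: "'a measure \<Rightarrow> ('a \<Rightarrow> real) \<Rightarrow> ('d::finite \<Rightarrow> 'a \<Rightarrow> real) \<Rightarrow> real ^ 'd \<Rightarrow> real" where
  "psi M p u \<theta> = real_of_ereal (K_fun M p (lincomb u \<theta>))"

definition p_family ::
  "'a measure \<Rightarrow> ('a \<Rightarrow> real) \<Rightarrow> ('d::finite \<Rightarrow> 'a \<Rightarrow> real) \<Rightarrow> real ^ 'd \<Rightarrow> 'a \<Rightarrow> real" where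
  "p_family M p u \<theta> x = exp (lincomb u \<theta> x - psi M p u \<theta>) * p x"

definition N_family ::
  "'a measure \<Rightarrow> ('a \<Rightarrow> real) \<Rightarrow> ('d::finite \<Rightarrow> 'a \<Rightarrow> real) \<Rightarrow> ('a \<Rightarrow> real) set" where
  "N_family M p u = p_family M p u ` Theta M p u"

text \<open>The \<open>d + 1\<close> coordinates of \<open>V = (u\<^sub>1, \<dots>, u\<^sub>d, 1)\<close> are indexed by \<open>'d option\<close>, with \<open>None\<close>
  the last one.\<close>

definition V_vec :: "('d::finite \<Rightarrow> 'a \<Rightarrow> real) \<Rightarrow> 'a \<Rightarrow> real ^ ('d option)" where
  "V_vec u x = (\<chi> i. case i of None \<Rightarrow> 1 | Some j \<Rightarrow> u j x)"

definition F_map ::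
  "'a measure \<Rightarrow> ('d::finite \<Rightarrow> 'a \<Rightarrow> real) \<Rightarrow> ('a \<Rightarrow> real) \<Rightarrow> real ^ ('d option) ^ ('d option)" where
  "F_map M u q = (\<chi> i j. expect M q (\<lambda>x. V_vec u x $ i * V_vec u x $ j))"

definition S_mat ::
  "'a measure \<Rightarrow> ('a \<Rightarrow> real) \<Rightarrow> ('d::finite \<Rightarrow> 'a \<Rightarrow> real) \<Rightarrow> real ^ 'd
    \<Rightarrow> real ^ ('d option) ^ ('d option)" where
  "S_mat M p u \<theta> = F_map M u (p_family M p u \<theta>)"

section \<open>Affine-invariant geometry of positive definite matrices\<close>

definition diag_mat :: "real ^ 'n \<Rightarrow> real ^ 'n ^ 'n" where
  "diag_mat D = (\<chi> i j. if i = j then D $ i else 0)"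

text \<open>Functional calculus: \<open>f(Q diag(\<lambda>) Q\<^sup>T) = Q diag(f(\<lambda>)) Q\<^sup>T\<close> for orthogonal \<open>Q\<close>.\<close>

definition spectral_fun :: "(real \<Rightarrow> real) \<Rightarrow> real ^ 'n ^ 'n \<Rightarrow> real ^ 'n ^ 'n::finite" where
  "spectral_fun f A = (THE B. \<exists>Q D. orthogonal_matrix Q
      \<and> A = Q ** diag_mat D ** transpose Q
      \<and> B = Q ** diag_mat (\<chi> i. f (D $ i)) ** transpose Q)"

lemma spectral_fun_diag:
  fixes Q :: "real ^ 'n ^ 'n::finite"
  assumes Q: "orthogonal_matrix Q"
  shows "spectral_fun f (Q ** diag_mat D ** transpose Q)
    = Q ** diag_mat (\<chi> i. f (D $ i)) ** transpose Q"
  unfolding spectral_fun_def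
proof (rule the_equality)
  show "\<exists>Q' D'. orthogonal_matrix Q' \<and>
      Q ** diag_mat D ** transpose Q = Q' ** diag_mat D' ** transpose Q' \<and>
      Q ** diag_mat (\<chi> i. f (D $ i)) ** transpose Q
        = Q' ** diag_mat (\<chi> i. f (D' $ i)) ** transpose Q'"
    using Q by blast
next
  fix B assume "\<exists>Q' D'. orthogonal_matrix Q' \<and>
      Q ** diag_mat D ** transpose Q = Q' ** diag_mat D' ** transpose Q' \<and>
      B = Q' ** diag_mat (\<chi> i. f (D' $ i)) ** transpose Q'"
  then obtain P E where P: "orthogonal_matrix P"
    and eq: "Q ** diag_mat D ** transpose Q = P ** diag_mat E ** transpose P"
    and B: "B = P ** diag_mat (\<chi> i. f (E $ i)) ** transpose P" by blast
  have QQ: "transpose Q ** Q = mat 1" "Q ** transpose Q = mat 1"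
    and PP: "transpose P ** P = mat 1" "P ** transpose P = mat 1"
    using P Q by (auto simp: orthogonal_matrix_def)
  have left: "(diag_mat G ** A) $ i $ j = G $ i * A $ i $ j"
    for G :: "real ^ 'n" and A :: "real ^ 'n ^ 'n" and i j
    by (simp add: diag_mat_def matrix_matrix_mult_def if_distrib[of "\<lambda>x. x * _"] sum.delta
        cong: if_cong)
  have right: "(A ** diag_mat G) $ i $ j = A $ i $ j * G $ j"
    for G :: "real ^ 'n" and A :: "real ^ 'n ^ 'n" and i j
    by (simp add: diag_mat_def matrix_matrix_mult_def if_distrib[of "\<lambda>x. _ * x"] sum.delta
        cong: if_cong)
  define W where "W = transpose P ** Q"
  have "W ** diag_mat D = transpose P ** (Q ** diag_mat D ** transpose Q) ** Q"
    using QQ by (simp add: W_def matrix_mul_assoc[symmetric])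
  also have "\<dots> = (transpose P ** P) ** diag_mat E ** W"
    unfolding eq by (simp add: W_def matrix_mul_assoc)
  finally have "W ** diag_mat D = diag_mat E ** W" using PP by simp
  then have *: "W $ i $ j * D $ j = E $ i * W $ i $ j" for i j
    by (metis left right)
  have "W $ i $ j * f (D $ j) = f (E $ i) * W $ i $ j" for i j
    using *[of i j] by (cases "W $ i $ j = 0") auto
  then have WW: "W ** diag_mat (\<chi> i. f (D $ i)) = diag_mat (\<chi> i. f (E $ i)) ** W"
    by (simp add: vec_eq_iff left right)
  have "B = P ** (diag_mat (\<chi> i. f (E $ i)) ** W) ** transpose Q"
    unfolding B W_def using QQ by (simp add: matrix_mul_assoc[symmetric])
  also have "\<dots> = (P ** transpose P) ** Q ** diag_mat (\<chi> i. f (D $ i)) ** transpose Q"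
    unfolding WW[symmetric] by (simp add: W_def matrix_mul_assoc)
  finally show "B = Q ** diag_mat (\<chi> i. f (D $ i)) ** transpose Q"
    using PP by simp
qed

definition mat_powr :: "real ^ 'n ^ 'n \<Rightarrow> real \<Rightarrow> real ^ 'n ^ 'n::finite" where
  "mat_powr A t = spectral_fun (\<lambda>x. x powr t) A"

definition mat_log :: "real ^ 'n ^ 'n \<Rightarrow> real ^ 'n ^ 'n::finite" where
  "mat_log A = spectral_fun ln A"

definition airm :: "real ^ 'n ^ 'n \<Rightarrow> real ^ 'n ^ 'n \<Rightarrow> real ^ 'n ^ 'n::finite \<Rightarrow> real" where
  "airm S X Y = 1 / 2 * trace (matrix_inv S ** X ** matrix_inv S ** Y)"

definition airm_geodesic ::
  "real ^ 'n ^ 'n \<Rightarrow> real ^ 'n ^ 'n \<Rightarrow> real \<Rightarrow> real ^ 'n ^ 'n::finite" where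
  "airm_geodesic S0 S1 t =
    mat_powr S0 (1 / 2)
    ** mat_powr (mat_powr S0 (- 1 / 2) ** S1 ** mat_powr S0 (- 1 / 2)) t
    ** mat_powr S0 (1 / 2)"

text \<open>The library norm on \<open>real ^ 'n ^ 'n\<close> is the Frobenius norm.\<close>

definition d_AIRM :: "real ^ 'n ^ 'n \<Rightarrow> real ^ 'n ^ 'n::finite \<Rightarrow> real" where
  "d_AIRM S0 S1 =
    1 / sqrt 2 * norm (mat_log (mat_powr S0 (- 1 / 2) ** S1 ** mat_powr S0 (- 1 / 2)))"

section \<open>The pullback metric and its distance\<close>

definition partial_S ::
  "'a measure \<Rightarrow> ('a \<Rightarrow> real) \<Rightarrow> ('d::finite \<Rightarrow> 'a \<Rightarrow> real) \<Rightarrow> 'd \<Rightarrow> real ^ 'd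
    \<Rightarrow> real ^ ('d option) ^ ('d option)" where
  "partial_S M p u j \<theta> = vector_derivative (\<lambda>t. S_mat M p u (\<theta> + t *\<^sub>R axis j 1)) (at 0)"

definition g_F ::
  "'a measure \<Rightarrow> ('a \<Rightarrow> real) \<Rightarrow> ('d::finite \<Rightarrow> 'a \<Rightarrow> real) \<Rightarrow> real ^ 'd \<Rightarrow> 'd \<Rightarrow> 'd \<Rightarrow> real" where
  "g_F M p u \<theta> j k = airm (S_mat M p u \<theta>) (partial_S M p u j \<theta>) (partial_S M p u k \<theta>)"

text \<open>\<open>C\<^sup>\<infinity>\<close> on the closed interval, with one-sided derivatives at the endpoints; \<open>D n\<close> is the
  \<open>n\<close>-th derivative.\<close>

definition smooth_path :: "(real \<Rightarrow> real ^ 'd::finite) \<Rightarrow> bool" where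
  "smooth_path \<gamma> \<longleftrightarrow> (\<exists>D. D 0 = \<gamma> \<and>
    (\<forall>n. \<forall>t\<in>{0..1}. (D n has_vector_derivative D (Suc n) t) (at t within {0..1})))"

definition speed_F ::
  "'a measure \<Rightarrow> ('a \<Rightarrow> real) \<Rightarrow> ('d::finite \<Rightarrow> 'a \<Rightarrow> real) \<Rightarrow> (real \<Rightarrow> real ^ 'd) \<Rightarrow> real \<Rightarrow> real" where
  "speed_F M p u \<gamma> t =
    (let v = vector_derivative \<gamma> (at t within {0..1})
     in sqrt (\<Sum>j\<in>UNIV. \<Sum>k\<in>UNIV. g_F M p u (\<gamma> t) j k * v $ j * v $ k))"

definition d_F ::
  "'a measure \<Rightarrow> ('a \<Rightarrow> real) \<Rightarrow> ('d::finite \<Rightarrow> 'a \<Rightarrow> real) \<Rightarrow> real ^ 'd \<Rightarrow> real ^ 'd \<Rightarrow> real" where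
  "d_F M p u \<theta>1 \<theta>2 = Inf {integral {0..1} (speed_F M p u \<gamma>) | \<gamma>.
      smooth_path \<gamma> \<and> \<gamma> ` {0..1} \<subseteq> Theta M p u \<and> \<gamma> 0 = \<theta>1 \<and> \<gamma> 1 = \<theta>2}"

end

theory Submission
  imports Defs
begin

text \<open>
  The last diagonal entry of \<open>S(\<theta>) = E[V V\<^sup>T]\<close> is \<open>1\<close> and its last column holds the expectations
  \<open>E[u\<^sub>j]\<close>, which determine \<open>\<theta>\<close> (\<open>expectation_injective\<close>).  A congruence brings two positive definite
  matrices into the form \<open>S\<^sub>0 = L L\<^sup>T\<close>, \<open>S\<^sub>1 = L diag(exp \<kappa>) L\<^sup>T\<close>, and then the geodesic is
  \<open>L diag(exp(t \<kappa>)) L\<^sup>T\<close> and the distance is \<open>\<bar>\<kappa>\<bar> / \<surd>2\<close> (\<open>airm_normal_form\<close>).  If \<open>l\<close> is the last row of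
  \<open>L\<close>, then the last diagonal entry of the geodesic is \<open>\<Sum> exp(t \<kappa>\<^sub>i) l\<^sub>i\<^sup>2\<close>.  This is strictly convex in
  \<open>t\<close> unless \<open>\<kappa>\<close> vanishes on the support of \<open>l\<close>, in which case the last column of the geodesic is
  constant, too.  So a geodesic that stays in the model joins points with the same expectations, that
  is, with the same parameter.  For equal parameters both distances are \<open>0\<close>, so the equality
  statement says that \<open>d\<^sub>F\<close> is strictly greater than \<open>d\<^sub>A\<^sub>I\<^sub>R\<^sub>M\<close> whenever the two parameters differ.

  Since \<open>d\<^sub>F\<close> is an infimum that need not be attained, strictness needs a gain that is uniform over all
  paths.  It comes from a calibration (\<open>airm_length_ge_calibration\<close>).  Along a path \<open>c\<close> take the Cholesky
  factor \<open>L\<inverse> c L\<^sup>-\<^sup>T = R\<^sup>T R\<close>.  The function \<open>2 \<Sum> \<kappa>\<^sub>i ln R\<^sub>i\<^sub>i\<close> increases by \<open>\<bar>\<kappa>\<bar>\<^sup>2\<close> from end to end and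
  its derivative is at most \<open>\<bar>\<kappa>\<bar> \<surd>2\<close> times the speed, because passing to the diagonal of a triangular
  factor does not increase length; this is the inequality.  A path in the slice \<open>c\<^sub>k\<^sub>k = 1\<close> has a velocity
  that is, in these coordinates, orthogonal to a matrix of norm \<open>1\<close> that has
  inner product \<open>\<phi> = \<Sum> \<kappa>\<^sub>i (R l)\<^sub>i\<^sup>2\<close> with the calibrating direction
  \<open>diag \<kappa>\<close>, so a positive multiple of \<open>\<phi>\<^sup>3\<close> may be added to the function without losing the bound on its
  derivative.  The ends of the path fix \<open>\<phi>\<close> at the ends, with a negative value at \<open>0\<close> and a positive one at
  \<open>1\<close> (\<open>endpoint_slopes\<close>), which is the gain.

  For the family itself it remains to see that \<open>S\<close> is continuously differentiable on the parameter set, so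
  that the speed is that of the image path (\<open>moment_has_derivative\<close>), and that the parameter set is convex,
  so that paths exist (\<open>convex_Theta\<close>).
\<close>

section \<open>Diagonalisation and the normal form of two positive definite matrices\<close>

definition spd :: "real ^ 'n ^ 'n \<Rightarrow> bool" where
  "spd A \<longleftrightarrow> transpose A = A \<and> (\<forall>v. v \<noteq> 0 \<longrightarrow> 0 < v \<bullet> (A *v v))"

lemma diag_mat_nth: "diag_mat D $ i $ j = (if i = j then D $ i else 0)"
  by (simp add: diag_mat_def)

lemma matrix_mult_nth: "(A ** B) $ i $ j = (\<Sum>k\<in>UNIV. A $ i $ k * B $ k $ j)"
  by (simp add: matrix_matrix_mult_def)

lemma matrix_diag_mat_nth: "(A ** diag_mat D) $ i $ j = A $ i $ j * D $ j"
  by (simp add: matrix_mult_nth diag_mat_nth if_distrib[of "\<lambda>x. _ * x"] sum.delta cong: if_cong)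

lemma diag_mat_vector_nth: "(diag_mat D *v x) $ i = D $ i * x $ i"
  by (simp add: matrix_vector_mult_def diag_mat_nth if_distrib[of "\<lambda>x. x * _"] sum.delta
      cong: if_cong)

lemma diag_mat_mult: "diag_mat D ** diag_mat E = diag_mat (\<chi> i. D $ i * E $ i)"
  by (simp add: vec_eq_iff matrix_diag_mat_nth) (simp add: diag_mat_nth)

lemma diag_mat_one: "diag_mat (\<chi> i. 1) = mat 1"
  by (simp add: vec_eq_iff diag_mat_nth mat_def)

lemma transpose_diag_mat [simp]: "transpose (diag_mat D) = diag_mat D"
  by (simp add: vec_eq_iff transpose_def diag_mat_nth)

lemma inner_matrix_transpose:
  fixes A :: "real ^ 'n ^ 'm"
  shows "x \<bullet> (A *v y) = (transpose A *v x) \<bullet> y"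
  by (simp add: dot_lmul_matrix)

lemma quadratic_congruence:
  fixes A :: "real ^ 'n ^ 'n" and P :: "real ^ 'm ^ 'n"
  shows "v \<bullet> ((transpose P ** A ** P) *v v) = (P *v v) \<bullet> (A *v (P *v v))"
proof -
  have "(transpose P ** A ** P) *v v = transpose P *v (A *v (P *v v))"
    by (simp add: matrix_vector_mul_assoc matrix_mul_assoc)
  then show ?thesis using inner_matrix_transpose[of v "transpose P" "A *v (P *v v)"] by simp
qed

lemma symmetric_inner:
  fixes A :: "real ^ 'n ^ 'n"
  assumes "transpose A = A"
  shows "x \<bullet> (A *v y) = (A *v x) \<bullet> y"
  using inner_matrix_transpose[of x A y] assms by simp

lemma invertible_matrix_inv [simp]:
  fixes A :: "real ^ 'n ^ 'n"
  assumes "invertible A"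
  shows "A ** matrix_inv A = mat 1" "matrix_inv A ** A = mat 1"
proof -
  have "A ** matrix_inv A = mat 1 \<and> matrix_inv A ** A = mat 1"
    unfolding matrix_inv_def by (rule someI_ex) (use assms in \<open>simp add: invertible_def\<close>)
  then show "A ** matrix_inv A = mat 1" "matrix_inv A ** A = mat 1" by auto
qed

text \<open>A symmetric matrix has an eigenvector in every nonzero invariant subspace: a maximiser of the
  quadratic form on the unit sphere of the subspace is one, by the first-order condition.\<close>

lemma symmetric_eigenvector_in_subspace:
  fixes A :: "real ^ 'n ^ 'n"
  assumes sym: "transpose A = A" and V: "subspace V" and inv: "\<And>x. x \<in> V \<Longrightarrow> A *v x \<in> V"
    and z: "z \<in> V" "z \<noteq> 0"
  obtains v \<mu> where "v \<in> V" "norm v = 1" "A *v v = \<mu> *\<^sub>R v"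
proof -
  let ?S = "V \<inter> sphere 0 1"
  have "compact ?S"
    using closed_subspace[OF V] by (simp add: closed_Int_compact)
  moreover have "(1 / norm z) *\<^sub>R z \<in> ?S"
    using z V by (simp add: subspace_scale)
  moreover have "continuous_on ?S (\<lambda>x. x \<bullet> (A *v x))"
    by (intro continuous_intros linear_continuous_on matrix_vector_mul_bounded_linear)
  ultimately obtain v where v: "v \<in> ?S" and max: "\<And>x. x \<in> ?S \<Longrightarrow> x \<bullet> (A *v x) \<le> v \<bullet> (A *v v)"
    using continuous_attains_sup[of ?S "\<lambda>x. x \<bullet> (A *v x)"] by blast
  define \<mu> where "\<mu> = v \<bullet> (A *v v)"
  have vv: "v \<bullet> v = 1" using v by (simp add: dot_square_norm)
  have max': "x \<bullet> (A *v x) \<le> \<mu> * (x \<bullet> x)" if "x \<in> V" for x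
  proof (cases "x = 0")
    case False
    then have "(1 / norm x) *\<^sub>R x \<in> ?S"
      using that V by (simp add: subspace_scale)
    from max[OF this] have "(1 / norm x) ^ 2 * (x \<bullet> (A *v x)) \<le> \<mu>"
      by (simp add: \<mu>_def matrix_vector_mult_scaleR power2_eq_square)
    then have "(x \<bullet> (A *v x)) \<le> \<mu> * (norm x)\<^sup>2"
      using False by (simp add: field_simps)
    then show ?thesis by (simp add: dot_square_norm)
  qed simp
  define w where "w = A *v v - \<mu> *\<^sub>R v"
  have wV: "w \<in> V" using v V inv unfolding w_def by (simp add: subspace_diff subspace_scale)
  have vw: "v \<bullet> w = 0" by (simp add: w_def inner_diff_right vv \<mu>_def)
  have wAv: "w \<bullet> (A *v v) = w \<bullet> w"
    using vw by (simp add: w_def inner_diff_right inner_commute) 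
  have "v \<bullet> (A *v w) = w \<bullet> w"
    using symmetric_inner[OF sym, of v w] wAv by (simp add: inner_commute)
  define K where "K = \<mu> * (w \<bullet> w) - w \<bullet> (A *v w)"
  have key: "2 * s * (w \<bullet> w) \<le> s\<^sup>2 * K" for s
  proof -
    have "v + s *\<^sub>R w \<in> V" using v wV V by (simp add: subspace_add subspace_scale)
    from max'[OF this] show ?thesis
      using \<open>v \<bullet> (A *v w) = w \<bullet> w\<close> wAv vw vv
      by (simp add: matrix_vector_right_distrib matrix_vector_mult_scaleR inner_add_left
          inner_add_right inner_commute[of w v] \<mu>_def[symmetric] K_def algebra_simps power2_eq_square)
  qed
  have "w \<bullet> w \<le> 0"
  proof (rule ccontr)
    assume "\<not> w \<bullet> w \<le> 0"
    then have p: "w \<bullet> w > 0" by linarith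
    \<comment> \<open>the quadratic term cannot compensate the linear one at this small step\<close>
    define s where "s = (w \<bullet> w) / (\<bar>K\<bar> + 1)"
    have s: "s > 0" using p by (simp add: s_def)
    have "2 * (w \<bullet> w) \<le> s * K" using key[of s] s by (simp add: power2_eq_square)
    also have "\<dots> \<le> s * (\<bar>K\<bar> + 1)" using s by (intro mult_left_mono) auto
    also have "\<dots> = w \<bullet> w" by (simp add: s_def)
    finally show False using p by simp
  qed
  then have "w = 0" using inner_gt_zero_iff[of w] by linarith
  then have "A *v v = \<mu> *\<^sub>R v" by (simp add: w_def)
  then show ?thesis using that v by auto
qed

text \<open>The orthogonal complement of a set of eigenvectors is invariant and contains a further one.\<close>

theorem symmetric_matrix_diagonalizable:
  fixes A :: "real ^ 'n ^ 'n"
  assumes sym: "transpose A = A"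
  obtains Q D where "orthogonal_matrix Q" "A = Q ** diag_mat D ** transpose Q"
proof -
  have "\<exists>B. card B = n \<and> finite B \<and> pairwise orthogonal B \<and>
      (\<forall>v\<in>B. norm v = 1 \<and> (\<exists>\<mu>. A *v v = \<mu> *\<^sub>R v))" if "n \<le> CARD('n)" for n
    using that
  proof (induction n)
    case 0
    show ?case by (intro exI[of _ "{}"]) (auto simp: pairwise_def)
  next
    case (Suc n)
    then obtain B where B: "card B = n" "finite B" "pairwise orthogonal B"
      "\<forall>v\<in>B. norm v = 1 \<and> (\<exists>\<mu>. A *v v = \<mu> *\<^sub>R v)" by auto
    define V where "V = {x. \<forall>v\<in>B. v \<bullet> x = 0}"
    have V: "subspace V" by (auto simp: V_def subspace_def inner_add_right)
    have inv: "A *v x \<in> V" if "x \<in> V" for x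
      unfolding V_def
    proof (intro CollectI ballI)
      fix v assume v: "v \<in> B"
      obtain \<mu> where "A *v v = \<mu> *\<^sub>R v" using B(4) v by auto
      then show "v \<bullet> (A *v x) = 0"
        using that v by (simp add: symmetric_inner[OF sym] V_def)
    qed
    have "dim B \<le> n" using B dim_le_card'[of B] by simp
    then have "dim B < DIM(real ^ 'n)" using Suc.prems by simp
    from orthogonal_to_subspace_exists[OF this] obtain z
      where z: "z \<noteq> 0" "\<And>y. y \<in> span B \<Longrightarrow> orthogonal z y" by blast
    then have "z \<in> V" by (auto simp: V_def orthogonal_def inner_commute span_base)
    from symmetric_eigenvector_in_subspace[OF sym V inv this z(1)] obtain v \<mu>
      where v: "v \<in> V" "norm v = 1" "A *v v = \<mu> *\<^sub>R v" by blast
    have "v \<notin> B" using v by (auto simp: V_def)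
    have "pairwise orthogonal (insert v B)"
      using B(3) v(1) by (auto simp: pairwise_insert V_def orthogonal_def inner_commute)
    then show ?case
      using B v \<open>v \<notin> B\<close> by (intro exI[of _ "insert v B"]) auto
  qed
  from this[OF order_refl] obtain B :: "(real ^ 'n) set"
    where B: "card B = CARD('n)" "finite B" "pairwise orthogonal B"
      "\<forall>v\<in>B. norm v = 1 \<and> (\<exists>\<mu>. A *v v = \<mu> *\<^sub>R v)" by blast
  then obtain f where f: "bij_betw f (UNIV :: 'n set) B"
    using finite_same_card_bij[of "UNIV :: 'n set" B] by auto
  have fB: "f j \<in> B" for j using f by (auto simp: bij_betw_def)
  have "\<forall>j. \<exists>\<mu>. A *v f j = \<mu> *\<^sub>R f j" using B(4) fB by blast
  from choice[OF this] obtain D where D: "\<And>j. A *v f j = D j *\<^sub>R f j" by blast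
  define Q where "Q = (\<chi> i j. f j $ i)"
  have col: "column j Q = f j" for j by (simp add: column_def Q_def vec_eq_iff)
  have Q: "orthogonal_matrix Q"
    unfolding orthogonal_matrix_orthonormal_columns col
  proof (intro conjI allI impI)
    fix i j :: 'n assume "i \<noteq> j"
    then have "f i \<noteq> f j" using f by (auto simp: bij_betw_def inj_on_def)
    then show "orthogonal (f i) (f j)" using B(3) fB by (auto simp: pairwise_def)
  qed (use B(4) fB in auto)
  have "A ** Q = Q ** diag_mat (\<chi> i. D i)"
  proof -
    have "(A ** Q) $ i $ j = (A *v f j) $ i" for i j
      by (simp add: matrix_mult_nth matrix_vector_mult_def Q_def)
    then show ?thesis
      by (simp add: vec_eq_iff matrix_diag_mat_nth D) (simp add: Q_def)
  qed
  then have "A = Q ** diag_mat (\<chi> i. D i) ** transpose Q"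
    using Q by (metis matrix_mul_assoc matrix_mul_rid orthogonal_matrix_def)
  then show ?thesis using Q that by blast
qed

lemma norm_matrix_sq:
  fixes A :: "real ^ 'n ^ 'm"
  shows "(norm A)\<^sup>2 = (\<Sum>i\<in>UNIV. \<Sum>j\<in>UNIV. (A $ i $ j)\<^sup>2)"
  unfolding power2_norm_eq_inner by (simp add: inner_vec_def power2_eq_square)

lemma norm_sq_eq_trace:
  fixes A :: "real ^ 'n ^ 'm"
  shows "(norm A)\<^sup>2 = trace (A ** transpose A)"
  unfolding norm_matrix_sq
  by (simp add: trace_def matrix_mult_nth transpose_def power2_eq_square)

lemma norm_orthogonal_diag:
  fixes Q :: "real ^ 'n ^ 'n"
  assumes "orthogonal_matrix Q"
  shows "norm (Q ** diag_mat D ** transpose Q) = norm D"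
proof -
  have QQ: "transpose Q ** Q = mat 1" using assms by (simp add: orthogonal_matrix_def)
  have "(norm (Q ** diag_mat D ** transpose Q))\<^sup>2 =
      trace (Q ** (diag_mat D ** (transpose Q ** Q) ** diag_mat D) ** transpose Q)"
    by (simp add: norm_sq_eq_trace matrix_transpose_mul matrix_mul_assoc)
  also have "\<dots> = trace (transpose Q ** Q ** (diag_mat D ** diag_mat D))"
    by (subst trace_mul_sym) (simp add: QQ matrix_mul_assoc)
  also have "\<dots> = (norm D)\<^sup>2"
    by (simp add: QQ diag_mat_mult trace_def diag_mat_nth power2_norm_eq_inner inner_vec_def)
  finally show ?thesis by simp
qed

lemma spd_diagonalizable:
  fixes A :: "real ^ 'n ^ 'n"
  assumes "spd A"
  obtains Q D where "orthogonal_matrix Q" "A = Q ** diag_mat D ** transpose Q" "\<And>i. D $ i > 0"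
proof -
  obtain Q D where Q: "orthogonal_matrix Q" and A: "A = Q ** diag_mat D ** transpose Q"
    using symmetric_matrix_diagonalizable assms unfolding spd_def by metis
  have QQ: "transpose Q ** Q = mat 1" using Q by (simp add: orthogonal_matrix_def)
  have "D $ i > 0" for i
  proof -
    let ?v = "Q *v axis i 1"
    have v: "transpose Q *v ?v = axis i 1"
      by (simp add: matrix_vector_mul_assoc QQ)
    then have "?v \<noteq> 0" by (metis axis_eq_0_iff matrix_vector_mult_0_right zero_neq_one)
    then have "0 < ?v \<bullet> (A *v ?v)" using assms by (simp add: spd_def)
    also have "?v \<bullet> (A *v ?v) = axis i 1 \<bullet> (diag_mat D *v axis i 1)"
      using quadratic_congruence[of ?v "transpose Q" "diag_mat D"] v by (simp add: A)
    also have "\<dots> = D $ i"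
      by (simp add: inner_axis' diag_mat_vector_nth)
    finally show ?thesis .
  qed
  then show ?thesis using that Q A by blast
qed

lemma spd_congruence:
  fixes A :: "real ^ 'n ^ 'n" and P :: "real ^ 'n ^ 'n"
  assumes "spd A" "invertible P"
  shows "spd (transpose P ** A ** P)"
  unfolding spd_def
proof (intro conjI allI impI)
  show "transpose (transpose P ** A ** P) = transpose P ** A ** P"
    using assms(1) by (simp only: spd_def matrix_transpose_mul matrix_mul_assoc transpose_transpose)
next
  fix v :: "real ^ 'n" assume "v \<noteq> 0"
  have "matrix_inv P *v (P *v v) = v"
    using assms(2) by (simp add: matrix_vector_mul_assoc)
  then have "P *v v \<noteq> 0" using \<open>v \<noteq> 0\<close> by auto
  then show "0 < v \<bullet> ((transpose P ** A ** P) *v v)"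
    unfolding quadratic_congruence using assms(1) by (simp add: spd_def)
qed

text \<open>Two positive definite matrices are simultaneously diagonalised by a congruence.  In these
  coordinates the first is the identity, the geodesic to the second is a one-parameter group of
  diagonal matrices, and the distance is the Euclidean norm of its logarithmic velocity.\<close>

lemma airm_normal_form:
  fixes S0 S1 :: "real ^ 'n ^ 'n"
  assumes S0: "spd S0" and S1: "spd S1"
  obtains L :: "real ^ 'n ^ 'n" and \<kappa> :: "real ^ 'n" where "invertible L" "S0 = L ** transpose L"
    "S1 = L ** diag_mat (\<chi> i. exp (\<kappa> $ i)) ** transpose L"
    "d_AIRM S0 S1 = norm \<kappa> / sqrt 2"
    "\<And>t. airm_geodesic S0 S1 t = L ** diag_mat (\<chi> i. exp (t * \<kappa> $ i)) ** transpose L"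
proof -
  obtain Q D where Q: "orthogonal_matrix Q" and S0Q: "S0 = Q ** diag_mat D ** transpose Q"
    and D: "\<And>i. D $ i > 0" using spd_diagonalizable[OF S0] by metis
  have QQ: "transpose Q ** Q = mat 1" "Q ** transpose Q = mat 1"
    using Q by (auto simp: orthogonal_matrix_def)
  define H where "H = mat_powr S0 (1 / 2)"
  define K where "K = mat_powr S0 (- 1 / 2)"
  have H: "H = Q ** diag_mat (\<chi> i. D $ i powr (1 / 2)) ** transpose Q"
    unfolding H_def mat_powr_def S0Q by (rule spectral_fun_diag[OF Q])
  have K: "K = Q ** diag_mat (\<chi> i. D $ i powr (- 1 / 2)) ** transpose Q"
    unfolding K_def mat_powr_def S0Q by (rule spectral_fun_diag[OF Q])
  have prod: "(Q ** diag_mat E ** transpose Q) ** (Q ** diag_mat G ** transpose Q)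
      = Q ** diag_mat (\<chi> i. E $ i * G $ i) ** transpose Q" for E G
  proof -
    have "(Q ** diag_mat E ** transpose Q) ** (Q ** diag_mat G ** transpose Q)
        = Q ** (diag_mat E ** (transpose Q ** Q) ** diag_mat G) ** transpose Q"
      by (simp only: matrix_mul_assoc)
    then show ?thesis by (simp add: QQ diag_mat_mult)
  qed
  have symH: "transpose H = H" and symK: "transpose K = K"
    by (simp_all add: H K matrix_transpose_mul matrix_mul_assoc)
  have "D $ i powr (1 / 2) * D $ i powr (1 / 2) = D $ i" for i
    using D[of i] by (simp add: powr_half_sqrt)
  then have HH: "H ** H = S0"
    by (simp only: H S0Q prod vec_lambda_beta vec_lambda_eta)
  have "D $ i powr (1 / 2) * D $ i powr (- 1 / 2) = 1" for i
    using less_imp_neq[OF D[of i]] by (simp add: powr_add[symmetric])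
  then have HK: "H ** K = mat 1"
    by (simp only: H K prod vec_lambda_beta diag_mat_one matrix_mul_rid QQ)
  have KH: "K ** H = mat 1" using HK by (simp add: matrix_left_right_inverse)
  have invK: "invertible K" using HK KH by (auto simp: invertible_def)
  define T where "T = K ** S1 ** K"
  have "spd T" using spd_congruence[OF S1 invK] by (simp add: T_def symK)
  then obtain P \<mu> where P: "orthogonal_matrix P" and TP: "T = P ** diag_mat \<mu> ** transpose P"
    and \<mu>: "\<And>i. \<mu> $ i > 0" using spd_diagonalizable by metis
  have PP: "transpose P ** P = mat 1" "P ** transpose P = mat 1"
    using P by (auto simp: orthogonal_matrix_def)
  define \<kappa> where "\<kappa> = (\<chi> i. ln (\<mu> $ i))"
  have powr: "\<mu> $ i powr t = exp (t * \<kappa> $ i)" for i t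
    using \<mu>[of i] by (simp add: powr_def \<kappa>_def)
  have \<mu>_exp: "\<mu> = (\<chi> i. exp (\<kappa> $ i))" using \<mu> by (simp add: vec_eq_iff \<kappa>_def)
  define L where "L = H ** P"
  have tL: "transpose L = transpose P ** H" by (simp add: L_def matrix_transpose_mul symH)
  have "L ** (transpose P ** K) = H ** (P ** transpose P) ** K"
    by (simp only: L_def matrix_mul_assoc)
  then have "L ** (transpose P ** K) = mat 1" by (simp add: PP HK)
  then have inv: "invertible L" by (auto simp: invertible_right_inverse)
  have e0: "S0 = L ** transpose L"
  proof -
    have "L ** transpose L = H ** (P ** transpose P) ** H"
      unfolding tL unfolding L_def by (simp only: matrix_mul_assoc)
    then show ?thesis by (simp add: PP HH)
  qed
  have e1: "S1 = L ** diag_mat (\<chi> i. exp (\<kappa> $ i)) ** transpose L"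
  proof -
    have "L ** diag_mat \<mu> ** transpose L = H ** (P ** diag_mat \<mu> ** transpose P) ** H"
      unfolding tL unfolding L_def by (simp only: matrix_mul_assoc)
    also have "\<dots> = H ** (K ** S1 ** K) ** H" by (simp only: T_def TP[symmetric])
    also have "\<dots> = (H ** K) ** S1 ** (K ** H)" by (simp only: matrix_mul_assoc)
    finally show ?thesis by (simp add: HK KH \<mu>_exp)
  qed
  have dist: "d_AIRM S0 S1 = norm \<kappa> / sqrt 2"
  proof -
    have "mat_log T = P ** diag_mat \<kappa> ** transpose P"
      unfolding mat_log_def TP spectral_fun_diag[OF P] by (simp add: \<kappa>_def)
    then show ?thesis
      unfolding d_AIRM_def K_def[symmetric] T_def[symmetric]
      by (simp add: norm_orthogonal_diag[OF P])
  qed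
  have geo: "airm_geodesic S0 S1 t = L ** diag_mat (\<chi> i. exp (t * \<kappa> $ i)) ** transpose L" for t
  proof -
    have "mat_powr T t = P ** diag_mat (\<chi> i. exp (t * \<kappa> $ i)) ** transpose P"
      unfolding mat_powr_def TP spectral_fun_diag[OF P] by (simp add: powr)
    then have "airm_geodesic S0 S1 t
        = H ** (P ** diag_mat (\<chi> i. exp (t * \<kappa> $ i)) ** transpose P) ** H"
      by (simp only: airm_geodesic_def T_def[unfolded K_def, symmetric] H_def[symmetric])
    then show ?thesis
      unfolding tL unfolding L_def by (simp only: matrix_mul_assoc)
  qed
  show ?thesis using that[of L \<kappa>] inv e0 e1 dist geo by blast
qed

section \<open>Cholesky factors along a path\<close>

text \<open>A triangular factor on the index set \<open>A\<close>; the injective ranking \<open>r\<close> stands in for an order on the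
  index type.  Matrices are functions here because the induction shrinks \<open>A\<close>.\<close>

definition triangular_factor :: "('n \<Rightarrow> nat) \<Rightarrow> 'n set \<Rightarrow> real set \<Rightarrow> (real \<Rightarrow> 'n \<Rightarrow> 'n \<Rightarrow> real)
    \<Rightarrow> (real \<Rightarrow> 'n \<Rightarrow> 'n \<Rightarrow> real) \<Rightarrow> bool" where
  "triangular_factor r A T C R \<longleftrightarrow> (\<forall>t\<in>T. \<forall>i j. (\<lambda>t. R t i j) differentiable (at t within T)
      \<and> C t i j = (\<Sum>k\<in>A. R t k i * R t k j) \<and> (i \<in> A \<longrightarrow> 0 < R t i i)
      \<and> (R t i j \<noteq> 0 \<longrightarrow> i \<in> A \<and> j \<in> A \<and> r i \<le> r j))"

text \<open>Eliminating the least index subtracts a rank-one matrix and leaves a matrix that is positive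
  definite on the remaining indices, the Schur complement; its entries are rational in the old ones
  with a positive denominator.  Only a square root of the pivot is taken, so that
  differentiability in \<open>t\<close> survives.\<close>

lemma cholesky_on_set:
  fixes C :: "real \<Rightarrow> 'n \<Rightarrow> 'n \<Rightarrow> real" and r :: "'n \<Rightarrow> nat"
  assumes "finite A"
    and "\<And>t i j. t \<in> T \<Longrightarrow> C t i j = C t j i"
    and "\<And>t i j. t \<in> T \<Longrightarrow> i \<notin> A \<Longrightarrow> C t i j = 0"
    and "\<And>i j t. t \<in> T \<Longrightarrow> (\<lambda>t. C t i j) differentiable (at t within T)"
    and "\<And>t v. t \<in> T \<Longrightarrow> (\<exists>i\<in>A. v i \<noteq> 0) \<Longrightarrow> 0 < (\<Sum>i\<in>A. \<Sum>j\<in>A. v i * C t i j * v j)"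
    and "inj_on r A"
  shows "\<exists>R. triangular_factor r A T C R"
  using assms
proof (induction "card A" arbitrary: A C)
  case 0
  then show ?case by (intro exI[of _ "\<lambda>t i j. 0"]) (auto simp: triangular_factor_def)
next
  case (Suc n)
  note sym = Suc.prems(2) and zero = Suc.prems(3) and diff = Suc.prems(4) and pd = Suc.prems(5)
  have zero': "C t i j = 0" if "t \<in> T" "j \<notin> A" for t i j
    using sym[OF that(1), of i j] zero[OF that] by simp
  have "A \<noteq> {}" using Suc.hyps(2) by auto
  then have "Min (r ` A) \<in> r ` A" using Suc.prems(1) by (intro Min_in) auto
  then obtain k where k: "k \<in> A" "r k = Min (r ` A)" by auto
  have kmin: "r k \<le> r j" if "j \<in> A" for j
    using that Suc.prems(1) by (simp add: k(2))
  define B where "B = A - {k}"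
  have B: "finite B" "A = insert k B" "k \<notin> B" "n = card B"
    using Suc.prems(1) Suc.hyps(2) k(1) by (auto simp: B_def)
  have sumA: "(\<Sum>i\<in>A. f i) = f k + (\<Sum>i\<in>B. f i)" for f :: "'n \<Rightarrow> real"
    using B by simp
  have piv: "0 < C t k k" if "t \<in> T" for t
  proof -
    have "0 < (\<Sum>i\<in>A. \<Sum>j\<in>A. of_bool (i = k) * C t i j * of_bool (j = k))"
      using k by (intro pd[OF that]) auto
    also have "\<dots> = (\<Sum>i\<in>A. of_bool (i = k) * C t i k)"
    proof (intro sum.cong refl)
      fix i
      have "(\<Sum>j\<in>A. of_bool (i = k) * C t i j * of_bool (j = k))
          = (\<Sum>j\<in>A. if j = k then of_bool (i = k) * C t i k else 0)"
        by (intro sum.cong) auto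
      then show "(\<Sum>j\<in>A. of_bool (i = k) * C t i j * of_bool (j = k)) = of_bool (i = k) * C t i k"
        using Suc.prems(1) k(1) by simp
    qed
    also have "\<dots> = (\<Sum>i\<in>A. if i = k then C t k k else 0)" by (intro sum.cong) auto
    also have "\<dots> = C t k k" using Suc.prems(1) k(1) by simp
    finally show ?thesis .
  qed
  define C1 where "C1 t i j = C t i j - C t i k * C t k j / C t k k" for t i j
  have C1diff: "(\<lambda>t. C1 t i j) differentiable (at t within T)" if "t \<in> T" for t i j
    unfolding C1_def using piv[OF that] by (intro derivative_intros diff that) auto
  have C1pd: "0 < (\<Sum>i\<in>B. \<Sum>j\<in>B. v i * C1 t i j * v j)" if t: "t \<in> T" and v: "\<exists>i\<in>B. v i \<noteq> 0" for t v
  proof -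
    define b where "b = (\<Sum>j\<in>B. C t k j * v j)"
    \<comment> \<open>the value at \<open>k\<close> that minimises the form for given values on \<open>B\<close>\<close>
    define w where "w = v(k := - b / C t k k)"
    have wB: "w i = v i" if "i \<in> B" for i using that B(3) by (auto simp: w_def)
    have b': "(\<Sum>i\<in>B. v i * C t i k) = b"
      unfolding b_def using sym[OF t] by (intro sum.cong) (auto simp: mult.commute)
    have "0 < (\<Sum>i\<in>A. \<Sum>j\<in>A. w i * C t i j * w j)"
      using v wB B(2) by (intro pd[OF t]) auto
    also have "\<dots> = w k * C t k k * w k + w k * b
        + ((\<Sum>i\<in>B. v i * C t i k) * w k + (\<Sum>i\<in>B. \<Sum>j\<in>B. v i * C t i j * v j))"
    proof -
      have row: "(\<Sum>j\<in>A. w k * C t k j * w j) = w k * C t k k * w k + w k * b"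
        by (simp add: sumA wB b_def sum_distrib_left mult.assoc)
      have rest: "(\<Sum>j\<in>A. w i * C t i j * w j)
          = v i * C t i k * w k + (\<Sum>j\<in>B. v i * C t i j * v j)" if "i \<in> B" for i
        using that by (simp add: sumA wB)
      show ?thesis
        unfolding sumA[of "\<lambda>i. \<Sum>j\<in>A. w i * C t i j * w j"] row
        by (simp add: rest sum.distrib sum_distrib_right)
    qed
    also have "\<dots> = (\<Sum>i\<in>B. \<Sum>j\<in>B. v i * C t i j * v j) - b * b / C t k k"
      using piv[OF t] unfolding b' by (simp add: w_def field_simps)
    also have "b * b / C t k k = (\<Sum>i\<in>B. \<Sum>j\<in>B. v i * (C t i k * C t k j / C t k k) * v j)"
    proof -
      have "b * b / C t k k = (\<Sum>i\<in>B. v i * C t i k) * (\<Sum>j\<in>B. C t k j * v j) / C t k k"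
        unfolding b' b_def[symmetric] by simp
      then show ?thesis
        unfolding sum_product sum_divide_distrib by (simp add: algebra_simps)
    qed
    also have "(\<Sum>i\<in>B. \<Sum>j\<in>B. v i * C t i j * v j) - \<dots> = (\<Sum>i\<in>B. \<Sum>j\<in>B. v i * C1 t i j * v j)"
      unfolding sum_subtractf[symmetric] by (intro sum.cong refl) (simp add: C1_def algebra_simps)
    finally show ?thesis .
  qed
  have "\<exists>R. triangular_factor r B T C1 R"
  proof (rule Suc.hyps(1)[OF B(4) B(1)])
    fix t i j assume t: "t \<in> T"
    show "C1 t i j = C1 t j i"
      unfolding C1_def using sym[OF t] by (simp add: mult.commute)
    show "C1 t i j = 0" if "i \<notin> B"
      using that B(2) zero[OF t, of i] piv[OF t] by (cases "i = k") (auto simp: C1_def)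
  next
    show "inj_on r B" using Suc.prems(6) B(2) by (auto intro: inj_on_subset)
  qed (use C1diff C1pd in auto)
  then obtain R where RR: "triangular_factor r B T C1 R" by blast
  have R: "(\<lambda>t. R t i j) differentiable (at t within T)"
    "C1 t i j = (\<Sum>k\<in>B. R t k i * R t k j)"
    "i \<in> B \<Longrightarrow> 0 < R t i i"
    "R t i j \<noteq> 0 \<Longrightarrow> i \<in> B \<and> j \<in> B \<and> r i \<le> r j" if "t \<in> T" for t i j
    using RR that unfolding triangular_factor_def by blast+
  define R1 where "R1 t i j = (if i = k then C t k j / sqrt (C t k k) else R t i j)" for t i j
  have "(\<lambda>t. R1 t i j) differentiable (at t within T)" if t: "t \<in> T" for t i j
  proof (cases "i = k")
    case True
    obtain D where "((\<lambda>t. C t k k) has_real_derivative D) (at t within T)"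
      using diff[OF t] by (metis has_field_derivative_def differentiable_def real_differentiable_def)
    then have "((\<lambda>t. sqrt (C t k k)) has_real_derivative (D * (inverse (sqrt (C t k k)) / 2)))
        (at t within T)"
      using DERIV_chain2[where f = sqrt and g = "\<lambda>t. C t k k", OF DERIV_real_sqrt[OF piv[OF t]]]
      by (simp add: mult.commute)
    then have "(\<lambda>t. sqrt (C t k k)) differentiable (at t within T)"
      by (auto simp: real_differentiable_def)
    then show ?thesis
      unfolding R1_def using True piv[OF t] by (auto intro!: differentiable_divide diff t)
  qed (use R(1)[OF t] in \<open>simp add: R1_def\<close>)
  moreover have "C t i j = (\<Sum>l\<in>A. R1 t l i * R1 t l j)" if t: "t \<in> T" for t i j
  proof -
    have "(\<Sum>l\<in>B. R1 t l i * R1 t l j) = C1 t i j"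
      unfolding R(2)[OF t] using B(3) by (intro sum.cong) (auto simp: R1_def)
    then show ?thesis
      unfolding sumA using piv[OF t] sym[OF t, of i k] by (simp add: R1_def C1_def)
  qed
  moreover have "0 < R1 t i i" if "t \<in> T" "i \<in> A" for t i
    using that piv[of t] R(3)[of t i] B(2) by (auto simp: R1_def)
  moreover have "i \<in> A \<and> j \<in> A \<and> r i \<le> r j" if t: "t \<in> T" and "R1 t i j \<noteq> 0" for t i j
  proof (cases "i = k")
    case True
    then have "C t k j \<noteq> 0" using that by (auto simp: R1_def)
    then have "j \<in> A" using zero'[OF t] by auto
    then show ?thesis using True k kmin by auto
  next
    case False
    then show ?thesis using that R(4)[OF t, of i j] B(2) by (auto simp: R1_def)
  qed
  ultimately show ?case
    unfolding triangular_factor_def by (intro exI[of _ R1] ballI allI conjI impI) blast+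
qed

lemma quadratic_form_sum:
  fixes A :: "real ^ 'n ^ 'n"
  shows "v \<bullet> (A *v v) = (\<Sum>i\<in>UNIV. \<Sum>j\<in>UNIV. v $ i * A $ i $ j * v $ j)"
  by (simp add: inner_vec_def matrix_vector_mult_def sum_distrib_left mult.assoc)

lemma has_vector_derivative_entry:
  fixes f :: "real \<Rightarrow> real ^ 'n ^ 'm"
  assumes "(f has_vector_derivative f') (at t within S)"
  shows "((\<lambda>t. f t $ i $ j) has_real_derivative f' $ i $ j) (at t within S)"
  unfolding has_real_derivative_iff_has_vector_derivative
  by (intro bounded_linear.has_vector_derivative[OF bounded_linear_vec_nth] assms)

text \<open>The derivative has the zero pattern of the factor itself.\<close>

lemma differentiable_cholesky:
  fixes C :: "real \<Rightarrow> real ^ 'n ^ 'n" and r :: "'n \<Rightarrow> nat"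
  assumes r: "inj r" and C: "\<And>t. t \<in> {0..1} \<Longrightarrow> spd (C t)"
    and diff: "\<And>t. t \<in> {0..1} \<Longrightarrow> (C has_vector_derivative C' t) (at t within {0..1})"
  obtains R R' where
    "\<And>t i j. t \<in> {0..1} \<Longrightarrow> ((\<lambda>t. R t $ i $ j) has_real_derivative R' t $ i $ j) (at t within {0..1})"
    "\<And>t. t \<in> {0..1} \<Longrightarrow> C t = transpose (R t) ** R t"
    "\<And>t i. t \<in> {0..1} \<Longrightarrow> 0 < R t $ i $ i"
    "\<And>t i j. t \<in> {0..1} \<Longrightarrow> r j < r i \<Longrightarrow> R t $ i $ j = 0 \<and> R' t $ i $ j = 0"
proof -
  have "\<exists>R. triangular_factor r UNIV {0..1} (\<lambda>t i j. C t $ i $ j) R"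
  proof (rule cholesky_on_set)
    fix t :: real and i j assume t: "t \<in> {0..1}"
    show "C t $ i $ j = C t $ j $ i"
      using C[OF t] unfolding spd_def transpose_def by (metis vec_lambda_beta)
    show "(\<lambda>t. C t $ i $ j) differentiable (at t within {0..1})"
      using has_vector_derivative_entry[OF diff[OF t]] by (auto simp: real_differentiable_def)
  next
    fix t :: real and v :: "'n \<Rightarrow> real" assume t: "t \<in> {0..1}" and "\<exists>i\<in>UNIV. v i \<noteq> 0"
    then have "(\<chi> i. v i) \<noteq> 0" by (auto simp: vec_eq_iff)
    then show "0 < (\<Sum>i\<in>UNIV. \<Sum>j\<in>UNIV. v i * C t $ i $ j * v j)"
      using C[OF t] quadratic_form_sum[of "\<chi> i. v i" "C t"] unfolding spd_def by fastforce
  qed (use r in auto)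
  then obtain R where RR: "triangular_factor r UNIV {0..1} (\<lambda>t i j. C t $ i $ j) R" by blast
  have R: "(\<lambda>t. R t i j) differentiable (at t within {0..1})"
    "C t $ i $ j = (\<Sum>k\<in>UNIV. R t k i * R t k j)" "0 < R t i i"
    "R t i j \<noteq> 0 \<Longrightarrow> r i \<le> r j" if "t \<in> {0..1}" for t i j
    using RR that unfolding triangular_factor_def by blast+
  have "\<exists>D. ((\<lambda>t. R t i j) has_real_derivative D) (at t within {0..1}) \<and> (r j < r i \<longrightarrow> D = 0)"
    if t: "t \<in> {0..1}" for t i j
  proof (cases "r j < r i")
    case True
    have "((\<lambda>t. R t i j) has_real_derivative 0) (at t within {0..1})"
      by (rule has_field_derivative_transform_within[where d = 1 and f = "\<lambda>_. 0"])
        (use True R(4) t in \<open>force simp: not_le\<close>)+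
    then show ?thesis by blast
  next
    case False
    then show ?thesis using R(1)[OF t, of i j] by (auto simp: real_differentiable_def)
  qed
  then obtain D where D: "\<And>t i j. t \<in> {0..1} \<Longrightarrow>
      ((\<lambda>t. R t i j) has_real_derivative D t i j) (at t within {0..1}) \<and> (r j < r i \<longrightarrow> D t i j = 0)"
    by metis
  show ?thesis
  proof (rule that[of "\<lambda>t. \<chi> i j. R t i j" "\<lambda>t. \<chi> i j. D t i j"])
    fix t :: real assume t: "t \<in> {0..1}"
    show "C t = transpose (\<chi> i j. R t i j) ** (\<chi> i j. R t i j)"
      by (simp add: vec_eq_iff matrix_mult_nth transpose_def R(2)[OF t])
    show "0 < (\<chi> i j. R t i j) $ i $ i" for i using R(3)[OF t] by simp
    show "((\<lambda>t. (\<chi> i j. R t i j) $ i $ j) has_real_derivative (\<chi> i j. D t i j) $ i $ j)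
        (at t within {0..1})" for i j
      using D[OF t] by simp
    fix i j assume ij: "r j < r i"
    then have "R t i j = 0" using R(4)[OF t, of i j] by (meson not_le)
    then show "(\<chi> i j. R t i j) $ i $ j = 0 \<and> (\<chi> i j. D t i j) $ i $ j = 0"
      using D[OF t, of i j] ij by simp
  qed
qed

text \<open>Uniqueness of the Cholesky factor, for a diagonal matrix: row by row in the order of the
  ranking, orthogonality of the columns kills the entries off the diagonal.\<close>

lemma cholesky_of_diag:
  fixes R :: "real ^ 'n ^ 'n" and r :: "'n \<Rightarrow> nat"
  assumes r: "inj r" and tri: "\<And>i j. r j < r i \<Longrightarrow> R $ i $ j = 0" and pos: "\<And>i. 0 < R $ i $ i"
    and RR: "transpose R ** R = diag_mat D"
  shows "R = diag_mat (\<chi> i. sqrt (D $ i))"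
proof -
  have RR': "(\<Sum>k\<in>UNIV. R $ k $ i * R $ k $ j) = (if i = j then D $ i else 0)" for i j
    using arg_cong[OF RR, of "\<lambda>A. A $ i $ j"]
    by (simp add: matrix_mult_nth transpose_def diag_mat_nth)
  have off: "R $ i $ j = 0" if "i \<noteq> j" for i j
    using that
  proof (induction "r i" arbitrary: i j rule: less_induct)
    case less
    have "(\<Sum>k\<in>UNIV. R $ k $ i * R $ k $ j) = (\<Sum>k\<in>UNIV. if k = i then R $ i $ i * R $ i $ j else 0)"
    proof (intro sum.cong refl)
      fix k
      show "R $ k $ i * R $ k $ j = (if k = i then R $ i $ i * R $ i $ j else 0)"
      proof (cases "k = i")
        case False
        then consider "r k < r i" | "r i < r k"
          using r by (metis inj_eq linorder_neqE_nat)
        then show ?thesis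
          using False less(1)[of k i] tri[of i k] by cases auto
      qed simp
    qed
    then have "R $ i $ i * R $ i $ j = 0" using RR'[of i j] less.prems by simp
    then show ?case using pos[of i] by simp
  qed
  have "R $ i $ i = sqrt (D $ i)" for i
  proof -
    have "(\<Sum>k\<in>UNIV. R $ k $ i * R $ k $ i) = (\<Sum>k\<in>UNIV. if k = i then (R $ i $ i)\<^sup>2 else 0)"
      using off by (intro sum.cong refl) (auto simp: power2_eq_square)
    then have "(R $ i $ i)\<^sup>2 = D $ i" using RR'[of i i] by simp
    then show ?thesis using pos[of i] by (simp add: real_sqrt_unique)
  qed
  then show ?thesis using off by (simp add: vec_eq_iff diag_mat_nth)
qed

lemma spd_gram_invertible:
  fixes R :: "real ^ 'n ^ 'n"
  assumes "spd (transpose R ** R)"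
  shows "invertible R"
proof -
  have "x = 0" if "R *v x = 0" for x
  proof (rule ccontr)
    assume "x \<noteq> 0"
    then have "0 < x \<bullet> ((transpose R ** R) *v x)" using assms by (simp add: spd_def)
    then show False using that by (simp add: matrix_vector_mul_assoc[symmetric])
  qed
  then show ?thesis
    by (simp add: invertible_left_inverse matrix_left_invertible_ker)
qed

text \<open>In a column of the inverse, the entry of largest rank below the diagonal would survive in the product.\<close>

lemma triangular_inverse:
  fixes R W :: "real ^ 'n ^ 'n" and r :: "'n \<Rightarrow> nat"
  assumes r: "inj r" and tri: "\<And>i j. r j < r i \<Longrightarrow> R $ i $ j = 0" and pos: "\<And>i. 0 < R $ i $ i"
    and RW: "R ** W = mat 1" and ij: "r j < r i"
  shows "W $ i $ j = 0"
proof (rule ccontr)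
  assume "W $ i $ j \<noteq> 0"
  define A where "A = {k. r j < r k \<and> W $ k $ j \<noteq> 0}"
  have "i \<in> A" using ij \<open>W $ i $ j \<noteq> 0\<close> by (simp add: A_def)
  then have "Max (r ` A) \<in> r ` A" by (intro Max_in) auto
  then obtain k where k: "k \<in> A" "r k = Max (r ` A)" by auto
  have max: "r l \<le> r k" if "l \<in> A" for l using that by (simp add: k(2))
  have "(\<Sum>l\<in>UNIV. R $ k $ l * W $ l $ j) = (\<Sum>l\<in>UNIV. if l = k then R $ k $ k * W $ k $ j else 0)"
  proof (intro sum.cong refl)
    fix l
    show "R $ k $ l * W $ l $ j = (if l = k then R $ k $ k * W $ k $ j else 0)"
    proof (cases "l = k")
      case False
      then consider "r l < r k" | "r k < r l" using r by (metis inj_eq linorder_neqE_nat)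
      then show ?thesis
      proof cases
        case 2
        then have "l \<notin> A" using max by force
        then have "W $ l $ j = 0" using 2 k(1) by (auto simp: A_def)
        then show ?thesis using False by simp
      qed (use tri False in auto)
    qed simp
  qed
  then have "R $ k $ k * W $ k $ j = (mat 1 :: real ^ 'n ^ 'n) $ k $ j"
    unfolding RW[symmetric] matrix_mult_nth by simp
  moreover have "k \<noteq> j" using k(1) by (auto simp: A_def)
  ultimately show False using pos[of k] k(1) by (simp add: mat_def A_def)
qed

section \<open>A calibration for paths with a fixed diagonal entry\<close>

lemma norm_matrix_vector_le:
  fixes U :: "real ^ 'n ^ 'm"
  shows "norm (U *v a) \<le> norm U * norm a"
proof -
  have "(norm (U *v a))\<^sup>2 = (\<Sum>i\<in>UNIV. (U $ i \<bullet> a)\<^sup>2)"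
    unfolding power2_norm_eq_inner
    by (simp add: inner_vec_def[of "U *v a"] matrix_vector_mul_component power2_eq_square)
  also have "\<dots> \<le> (\<Sum>i\<in>UNIV. (norm (U $ i))\<^sup>2 * (norm a)\<^sup>2)"
    by (intro sum_mono) (metis Cauchy_Schwarz_ineq power2_norm_eq_inner)
  also have "\<dots> = (norm U * norm a)\<^sup>2"
    unfolding power_mult_distrib sum_distrib_right[symmetric]
    by (simp add: power2_norm_eq_inner inner_vec_def[of U])
  finally show ?thesis by (rule power2_le_imp_le) simp
qed

text \<open>In \<open>(U\<^sub>i\<^sub>j + U\<^sub>j\<^sub>i)\<^sup>2\<close> the mixed term vanishes off the diagonal and is a square on it.\<close>

lemma norm_triangular_le_symmetrization:
  fixes U :: "real ^ 'n ^ 'n" and r :: "'n \<Rightarrow> nat"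
  assumes r: "inj r" and tri: "\<And>i j. r j < r i \<Longrightarrow> U $ i $ j = 0"
  shows "norm U \<le> norm (U + transpose U)"
proof (rule power2_le_imp_le)
  have "0 \<le> U $ i $ j * U $ j $ i" for i j
  proof (cases "i = j")
    case False
    then have "r i \<noteq> r j" using r by (simp add: inj_eq)
    then show ?thesis using tri[of i j] tri[of j i] by (auto simp: neq_iff)
  qed simp
  then have "(U $ i $ j)\<^sup>2 + (U $ j $ i)\<^sup>2 \<le> ((U + transpose U) $ i $ j)\<^sup>2" for i j
    by (simp add: transpose_def power2_sum)
  then have "(\<Sum>i\<in>UNIV. \<Sum>j\<in>UNIV. (U $ i $ j)\<^sup>2 + (U $ j $ i)\<^sup>2) \<le> (norm (U + transpose U))\<^sup>2"
    unfolding norm_matrix_sq by (intro sum_mono)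
  moreover have "(norm U)\<^sup>2 \<le> (\<Sum>i\<in>UNIV. \<Sum>j\<in>UNIV. (U $ i $ j)\<^sup>2 + (U $ j $ i)\<^sup>2)"
    unfolding norm_matrix_sq by (intro sum_mono) simp
  ultimately show "(norm U)\<^sup>2 \<le> (norm (U + transpose U))\<^sup>2" by linarith
qed simp

text \<open>The derivative bound for the calibration.  Here \<open>U = R' R\<inverse>\<close> is the triangular logarithmic derivative
  of the Cholesky factor, \<open>X = U + U\<^sup>T\<close> is the velocity, and \<open>a = R l\<close> is a unit vector that moves by
  \<open>a' = U a\<close>.  The constraint \<open>a\<^sup>T U a = 0\<close> shortens the calibrating direction from \<open>\<bar>\<kappa>\<bar>\<close> to
  \<open>\<surd>(\<bar>\<kappa>\<bar>\<^sup>2 - \<phi>\<^sup>2)\<close>, which is at most \<open>\<bar>\<kappa>\<bar> - \<phi>\<^sup>2 / (2 \<bar>\<kappa>\<bar>)\<close>.  This leaves room for the second summand, the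
  derivative of \<open>\<phi>\<^sup>3 / (12 \<bar>\<kappa>\<bar>\<^sup>2)\<close>, since \<open>\<phi>\<close> changes at a rate of at most \<open>2 \<bar>\<kappa>\<bar> \<bar>X\<bar>\<close>.\<close>

lemma calibration_pointwise:
  fixes U :: "real ^ 'n ^ 'n" and r :: "'n \<Rightarrow> nat" and a \<kappa> :: "real ^ 'n"
  assumes r: "inj r" and tri: "\<And>i j. r j < r i \<Longrightarrow> U $ i $ j = 0"
    and a1: "a \<bullet> a = 1" and aUa: "a \<bullet> (U *v a) = 0" and \<kappa>: "\<kappa> \<noteq> 0"
    and \<phi>: "\<phi> = (\<Sum>i\<in>UNIV. \<kappa> $ i * (a $ i)\<^sup>2)"
  shows "2 * (\<Sum>i\<in>UNIV. \<kappa> $ i * U $ i $ i)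
      + \<phi>\<^sup>2 / (2 * (norm \<kappa>)\<^sup>2) * (\<Sum>i\<in>UNIV. \<kappa> $ i * a $ i * (U *v a) $ i)
    \<le> norm \<kappa> * norm (U + transpose U)"
proof -
  define n where "n = norm \<kappa>"
  define X where "X = U + transpose U"
  define A :: "real ^ 'n ^ 'n" where "A = (\<chi> i j. a $ i * a $ j)"
  define Y where "Y = diag_mat \<kappa> - \<phi> *\<^sub>R A"
  have n: "0 < n" using \<kappa> by (simp add: n_def)
  have inner_sum: "B \<bullet> E = (\<Sum>i\<in>UNIV. \<Sum>j\<in>UNIV. B $ i $ j * E $ i $ j)" for B E :: "real ^ 'n ^ 'n"
    by (simp add: inner_vec_def)
  have DB: "B \<bullet> diag_mat \<kappa> = (\<Sum>i\<in>UNIV. \<kappa> $ i * B $ i $ i)" for B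
    by (simp add: inner_sum diag_mat_nth if_distrib[of "\<lambda>x. _ * x"] sum.delta mult.commute cong: if_cong)
  have AB: "B \<bullet> A = a \<bullet> (B *v a)" for B
    by (simp add: inner_sum A_def quadratic_form_sum algebra_simps)
  have DD: "diag_mat \<kappa> \<bullet> diag_mat \<kappa> = n\<^sup>2"
    unfolding DB n_def power2_norm_eq_inner by (simp add: diag_mat_nth inner_vec_def)
  have DA: "A \<bullet> diag_mat \<kappa> = \<phi>"
    unfolding DB \<phi> by (simp add: A_def power2_eq_square)
  have AA: "A \<bullet> A = 1"
  proof -
    have "A \<bullet> A = (a \<bullet> a) * (a \<bullet> a)"
      unfolding inner_sum A_def inner_vec_def[of a a] sum_product by (simp add: algebra_simps)
    then show ?thesis by (simp add: a1)
  qed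
  have "\<bar>A \<bullet> diag_mat \<kappa>\<bar> \<le> norm A * norm (diag_mat \<kappa>)" by (rule Cauchy_Schwarz_ineq2)
  then have \<phi>n: "\<bar>\<phi>\<bar> \<le> n"
    using n by (simp add: DA norm_eq_sqrt_inner AA DD)
  then have \<phi>n2: "\<phi>\<^sup>2 \<le> n\<^sup>2" using n by (metis abs_le_square_iff abs_of_pos)
  have "(norm Y)\<^sup>2 = n\<^sup>2 - \<phi>\<^sup>2"
    unfolding power2_norm_eq_inner Y_def
    by (simp add: inner_diff_left inner_diff_right DD DA AA inner_commute[of "diag_mat \<kappa>" A]
        power2_eq_square)
  also have "\<dots> \<le> (n - \<phi>\<^sup>2 / (2 * n))\<^sup>2"
  proof -
    have "n * (\<phi>\<^sup>2 / (2 * n)) = \<phi>\<^sup>2 / 2" using n by simp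
    then show ?thesis by (simp add: power2_diff)
  qed
  finally have Y: "norm Y \<le> n - \<phi>\<^sup>2 / (2 * n)"
  proof (rule power2_le_imp_le)
    have "\<phi>\<^sup>2 / (2 * n) \<le> n\<^sup>2 / (2 * n)" using \<phi>n2 n by (intro divide_right_mono) auto
    also have "\<dots> \<le> n" using n by (simp add: power2_eq_square)
    finally show "0 \<le> n - \<phi>\<^sup>2 / (2 * n)" by simp
  qed
  \<comment> \<open>the constraint makes \<open>X\<close> orthogonal to \<open>A\<close>, so \<open>diag_mat \<kappa>\<close> may be replaced by its component
    orthogonal to \<open>A\<close>, which is shorter\<close>
  have "X \<bullet> Y = 2 * (\<Sum>i\<in>UNIV. \<kappa> $ i * U $ i $ i)"
  proof -
    have "a \<bullet> (transpose U *v a) = a \<bullet> (U *v a)"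
      by (simp add: inner_matrix_transpose inner_commute)
    then have "X \<bullet> A = 0"
      by (simp add: AB X_def matrix_vector_mult_add_rdistrib inner_add_right aUa)
    then show ?thesis
      unfolding Y_def inner_diff_right inner_scaleR_right DB
      by (simp add: X_def transpose_def sum_distrib_left algebra_simps)
  qed
  then have main: "2 * (\<Sum>i\<in>UNIV. \<kappa> $ i * U $ i $ i) \<le> norm X * (n - \<phi>\<^sup>2 / (2 * n))"
    using norm_cauchy_schwarz[of X Y] mult_left_mono[OF Y norm_ge_zero[of X]] by linarith
  have "(\<Sum>i\<in>UNIV. \<kappa> $ i * a $ i * (U *v a) $ i) \<le> n * norm X"
  proof -
    have na: "norm a = 1" using a1 by (simp add: norm_eq_sqrt_inner)
    have a_le: "(a $ i)\<^sup>2 \<le> 1" for i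
      using component_le_norm_cart[of a i] na by (simp add: abs_square_le_1)
    have "(norm (\<chi> i. \<kappa> $ i * a $ i))\<^sup>2 \<le> n\<^sup>2"
    proof -
      have "(\<kappa> $ i)\<^sup>2 * (a $ i)\<^sup>2 \<le> (\<kappa> $ i)\<^sup>2 * 1" for i
        using a_le by (intro mult_left_mono) auto
      then show ?thesis
        unfolding n_def power2_norm_eq_inner inner_vec_def
        by (intro sum_mono) (simp add: power2_eq_square algebra_simps)
    qed
    then have b: "norm (\<chi> i. \<kappa> $ i * a $ i) \<le> n"
      by (rule power2_le_imp_le) (use n in simp)
    have "norm (U *v a) \<le> norm X"
      using norm_matrix_vector_le[of U a] norm_triangular_le_symmetrization[OF r tri]
      by (simp add: na X_def)
    then have "norm (\<chi> i. \<kappa> $ i * a $ i) * norm (U *v a) \<le> n * norm X"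
      using b n by (intro mult_mono) auto
    moreover have "(\<Sum>i\<in>UNIV. \<kappa> $ i * a $ i * (U *v a) $ i) = (\<chi> i. \<kappa> $ i * a $ i) \<bullet> (U *v a)"
      by (simp add: inner_vec_def)
    ultimately show ?thesis
      using norm_cauchy_schwarz[of "\<chi> i. \<kappa> $ i * a $ i" "U *v a"] by linarith
  qed
  then have "\<phi>\<^sup>2 / (2 * n\<^sup>2) * (\<Sum>i\<in>UNIV. \<kappa> $ i * a $ i * (U *v a) $ i)
      \<le> \<phi>\<^sup>2 / (2 * n\<^sup>2) * (n * norm X)"
    by (intro mult_left_mono) auto
  also have "\<dots> = norm X * (\<phi>\<^sup>2 / (2 * n))"
    using n by (simp add: power2_eq_square)
  finally show ?thesis
    using main unfolding n_def[symmetric] X_def[symmetric] by (simp add: algebra_simps)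
qed

lemma bounded_linear_congruence: "bounded_linear (\<lambda>A :: real ^ 'n ^ 'n. P ** A ** Q)"
  for P Q :: "real ^ 'n ^ 'n"
  unfolding linear_conv_bounded_linear[symmetric]
  by (rule linearI)
    (simp_all add: vec_eq_iff matrix_mult_nth sum.distrib sum_distrib_left sum_distrib_right
      algebra_simps)

text \<open>Congruences are isometries of the metric, and at the identity it is half the Frobenius inner product.\<close>

lemma airm_congruence:
  fixes P X :: "real ^ 'n ^ 'n"
  assumes P: "invertible P" and X: "transpose X = X"
  shows "airm (transpose P ** P) (transpose P ** X ** P) (transpose P ** X ** P) = (norm X)\<^sup>2 / 2"
proof -
  let ?J = "matrix_inv P"
  have J: "P ** ?J = mat 1" "?J ** P = mat 1" using P by auto
  have tJ: "transpose ?J ** transpose P = mat 1" "transpose P ** transpose ?J = mat 1"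
    using J by (metis matrix_transpose_mul transpose_mat)+
  have inv: "matrix_inv (transpose P ** P) = ?J ** transpose ?J"
  proof -
    have "(?J ** transpose ?J) ** (transpose P ** P) = ?J ** (transpose ?J ** transpose P) ** P"
      by (simp only: matrix_mul_assoc)
    then have 1: "(?J ** transpose ?J) ** (transpose P ** P) = mat 1" by (simp add: tJ J)
    then have "invertible (transpose P ** P)" by (auto simp: invertible_left_inverse)
    then have "(transpose P ** P) ** matrix_inv (transpose P ** P) = mat 1" by simp
    then show ?thesis using 1 by (metis matrix_mul_assoc matrix_mul_lid matrix_mul_rid)
  qed
  have "matrix_inv (transpose P ** P) ** (transpose P ** X ** P)
      = ?J ** (transpose ?J ** transpose P) ** X ** P"
    unfolding inv by (simp only: matrix_mul_assoc)
  also have "\<dots> = ?J ** X ** P" by (simp add: tJ)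
  finally have e: "matrix_inv (transpose P ** P) ** (transpose P ** X ** P) = ?J ** X ** P" .
  have "trace (matrix_inv (transpose P ** P) ** (transpose P ** X ** P)
      ** matrix_inv (transpose P ** P) ** (transpose P ** X ** P))
      = trace ((?J ** X ** P) ** (?J ** X ** P))"
    by (simp only: e[symmetric] matrix_mul_assoc)
  also have "\<dots> = trace (?J ** (X ** (P ** ?J) ** X ** P))"
    by (simp only: matrix_mul_assoc)
  also have "\<dots> = trace ((X ** X ** P) ** ?J)"
    by (subst trace_mul_sym) (simp add: J)
  also have "\<dots> = trace (X ** X ** (P ** ?J))" by (simp only: matrix_mul_assoc)
  also have "\<dots> = (norm X)\<^sup>2" by (simp add: J norm_sq_eq_trace X)
  finally show ?thesis by (simp add: airm_def)
qed

text \<open>A lower bound for the length of any path in the slice \<open>c\<^sub>k\<^sub>k = 1\<close>.  Without the second summand it is the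
  distance of the end points; that summand depends on the end points only, so the bound passes to the
  infimum over all paths.  The proof integrates the derivative of the calibration \<open>B\<close> along the path.\<close>

theorem airm_length_ge_calibration:
  fixes c c' :: "real \<Rightarrow> real ^ 'n ^ 'n" and L :: "real ^ 'n ^ 'n" and \<kappa> :: "real ^ 'n"
  assumes diff: "\<And>t. t \<in> {0..1} \<Longrightarrow> (c has_vector_derivative c' t) (at t within {0..1})"
    and spd: "\<And>t. t \<in> {0..1} \<Longrightarrow> spd (c t)"
    and slice: "\<And>t. t \<in> {0..1} \<Longrightarrow> c t $ k $ k = 1"
    and cont: "continuous_on {0..1} (\<lambda>t. airm (c t) (c' t) (c' t))"
    and L: "invertible L" and c0: "c 0 = L ** transpose L"
    and c1: "c 1 = L ** diag_mat (\<chi> i. exp (\<kappa> $ i)) ** transpose L"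
    and \<kappa>: "\<kappa> \<noteq> 0"
  shows "(norm \<kappa> + ((\<Sum>i\<in>UNIV. \<kappa> $ i * exp (\<kappa> $ i) * (L $ k $ i)\<^sup>2) ^ 3
      - (\<Sum>i\<in>UNIV. \<kappa> $ i * (L $ k $ i)\<^sup>2) ^ 3) / (12 * norm \<kappa> ^ 3)) / sqrt 2
    \<le> integral {0..1} (\<lambda>t. sqrt (airm (c t) (c' t) (c' t)))"
proof -
  obtain r :: "'n \<Rightarrow> nat" where r: "inj r"
    using finite_imp_inj_to_nat_seg[of "UNIV :: 'n set"] by auto
  define n where "n = norm \<kappa>"
  have n: "0 < n" using \<kappa> by (simp add: n_def)
  define J where "J = matrix_inv L"
  have J: "J ** L = mat 1" "L ** J = mat 1" using L by (auto simp: J_def)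
  have tJ: "transpose L ** transpose J = mat 1" "transpose J ** transpose L = mat 1"
    using J by (metis matrix_transpose_mul transpose_mat)+
  have "invertible (transpose J)" using tJ by (auto simp: invertible_def)
  \<comment> \<open>the path in the coordinates in which it runs from the identity to a diagonal matrix\<close>
  define C where "C t = J ** c t ** transpose J" for t
  define C' where "C' t = J ** c' t ** transpose J" for t
  have roundtrip: "L ** (J ** A ** transpose J) ** transpose L = A" for A
  proof -
    have "L ** (J ** A ** transpose J) ** transpose L = (L ** J) ** A ** (transpose J ** transpose L)"
      by (simp only: matrix_mul_assoc)
    then show ?thesis by (simp add: J tJ)
  qed
  have reverse: "J ** (L ** A ** transpose L) ** transpose J = A" for A
  proof -
    have "J ** (L ** A ** transpose L) ** transpose J = (J ** L) ** A ** (transpose L ** transpose J)"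
      by (simp only: matrix_mul_assoc)
    then show ?thesis by (simp add: J tJ)
  qed
  have Cspd: "spd (C t)" if "t \<in> {0..1}" for t
    using spd_congruence[OF spd[OF that] \<open>invertible (transpose J)\<close>] by (simp add: C_def)
  have Cdiff: "(C has_vector_derivative C' t) (at t within {0..1})" if "t \<in> {0..1}" for t
    unfolding C_def[abs_def] C'_def
    by (rule bounded_linear.has_vector_derivative[OF bounded_linear_congruence diff[OF that]])
  obtain R R' where
    Rd: "\<And>t i j. t \<in> {0..1} \<Longrightarrow> ((\<lambda>t. R t $ i $ j) has_real_derivative R' t $ i $ j) (at t within {0..1})"
    and CR: "\<And>t. t \<in> {0..1} \<Longrightarrow> C t = transpose (R t) ** R t"
    and Rpos: "\<And>t i. t \<in> {0..1} \<Longrightarrow> 0 < R t $ i $ i"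
    and Rtri: "\<And>t i j. t \<in> {0..1} \<Longrightarrow> r j < r i \<Longrightarrow> R t $ i $ j = 0 \<and> R' t $ i $ j = 0"
    using differentiable_cholesky[OF r Cspd Cdiff] by blast
  have Rinv: "invertible (R t)" if "t \<in> {0..1}" for t
    using Cspd[OF that] spd_gram_invertible by (simp add: CR[OF that])
  define U where "U t = R' t ** matrix_inv (R t)" for t
  have R'U: "R' t = U t ** R t" if "t \<in> {0..1}" for t
    using Rinv[OF that] by (simp add: U_def matrix_mul_assoc[symmetric])
  have Utri: "U t $ i $ j = 0" if t: "t \<in> {0..1}" and ij: "r j < r i" for t i j
    unfolding U_def matrix_mult_nth
  proof (intro sum.neutral ballI)
    fix l
    have "r l < r i \<or> r j < r l" using ij by linarith
    then show "R' t $ i $ l * matrix_inv (R t) $ l $ j = 0"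
      using Rtri[OF t, of l i] triangular_inverse[OF r, of "R t" "matrix_inv (R t)" j l]
        Rtri[OF t] Rpos[OF t] Rinv[OF t] by auto
  qed
  have Udiag: "R' t $ i $ i = U t $ i $ i * R t $ i $ i" if t: "t \<in> {0..1}" for t i
  proof -
    have "(\<Sum>l\<in>UNIV. U t $ i $ l * R t $ l $ i)
        = (\<Sum>l\<in>UNIV. if l = i then U t $ i $ i * R t $ i $ i else 0)"
    proof (intro sum.cong refl)
      fix l
      show "U t $ i $ l * R t $ l $ i = (if l = i then U t $ i $ i * R t $ i $ i else 0)"
      proof (cases "l = i")
        case False
        then have "r l < r i \<or> r i < r l" using r by (metis inj_eq linorder_neqE_nat)
        then show ?thesis using False Utri[OF t, of l i] Rtri[OF t, of i l] by auto
      qed simp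
    qed
    then show ?thesis unfolding R'U[OF t] matrix_mult_nth by simp
  qed
  \<comment> \<open>the velocity, transported to the identity by the Cholesky factor\<close>
  define X where "X t = U t + transpose (U t)" for t
  have Xsym: "transpose (X t) = X t" for t
    by (simp add: X_def vec_eq_iff transpose_def)
  have C'X: "C' t = transpose (R t) ** X t ** R t" if t: "t \<in> {0..1}" for t
  proof -
    have "C' t = transpose (R' t) ** R t + transpose (R t) ** R' t"
    proof -
      have "C' t $ i $ j = (\<Sum>l\<in>UNIV. R' t $ l $ i * R t $ l $ j + R t $ l $ i * R' t $ l $ j)" for i j
      proof -
        have "((\<lambda>t. \<Sum>l\<in>UNIV. R t $ l $ i * R t $ l $ j) has_real_derivative
            (\<Sum>l\<in>UNIV. R' t $ l $ i * R t $ l $ j + R t $ l $ i * R' t $ l $ j)) (at t within {0..1})"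
          by (auto intro!: derivative_eq_intros Rd t sum.cong)
        then have "((\<lambda>t. C t $ i $ j) has_real_derivative
            (\<Sum>l\<in>UNIV. R' t $ l $ i * R t $ l $ j + R t $ l $ i * R' t $ l $ j)) (at t within {0..1})"
          by (rule has_field_derivative_transform_within[where d = 1])
            (use t CR in \<open>auto simp: matrix_mult_nth transpose_def\<close>)
        then show ?thesis
          using vector_derivative_unique_within_closed_interval[of 0 1 t "\<lambda>t. C t $ i $ j"]
            has_vector_derivative_entry[OF Cdiff[OF t], of i j] t
          by (auto simp: has_real_derivative_iff_has_vector_derivative)
      qed
      then show ?thesis
        by (simp add: vec_eq_iff matrix_mult_nth transpose_def sum.distrib)
    qed
    also have "\<dots> = transpose (R t) ** X t ** R t"
    proof -
      have "(A + B) ** D = A ** D + B ** D" for A B D :: "real ^ 'n ^ 'n"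
        by (simp add: vec_eq_iff matrix_mult_nth sum.distrib algebra_simps)
      then show ?thesis
        by (simp add: R'U[OF t] X_def matrix_transpose_mul matrix_mul_assoc matrix_add_ldistrib
            add.commute)
    qed
    finally show ?thesis .
  qed
  define P where "P t = R t ** transpose L" for t
  have tP: "transpose (P t) = L ** transpose (R t)" for t
    by (simp add: P_def matrix_transpose_mul)
  have cP: "c t = transpose (P t) ** P t" if "t \<in> {0..1}" for t
    using roundtrip[of "c t"] CR[OF that] unfolding C_def tP
    by (simp add: P_def matrix_mul_assoc)
  have c'P: "c' t = transpose (P t) ** X t ** P t" if "t \<in> {0..1}" for t
    using roundtrip[of "c' t"] C'X[OF that] unfolding C'_def tP
    by (simp add: P_def matrix_mul_assoc)
  have Pinv: "invertible (P t)" if "t \<in> {0..1}" for t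
    using spd[OF that] spd_gram_invertible by (simp add: cP[OF that])
  have speed: "airm (c t) (c' t) (c' t) = (norm (X t))\<^sup>2 / 2" if "t \<in> {0..1}" for t
    unfolding cP[OF that] c'P[OF that] by (rule airm_congruence[OF Pinv[OF that] Xsym])
  \<comment> \<open>row \<open>k\<close> of \<open>L\<close> in the moving frame; the slice condition says that it is a unit vector\<close>
  define a where "a t = R t *v (L $ k)" for t
  have Pa: "P t *v axis k 1 = a t" for t
  proof -
    have "transpose L *v axis k 1 = L $ k"
      by (simp add: vec_eq_iff matrix_vector_mult_def transpose_def axis_def
          if_distrib[of "\<lambda>x. _ * x"] cong: if_cong)
    then show ?thesis by (simp add: P_def a_def matrix_vector_mul_assoc[symmetric])
  qed
  have a1: "a t \<bullet> a t = 1" if t: "t \<in> {0..1}" for t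
  proof -
    have "a t \<bullet> a t = axis k 1 \<bullet> (c t *v axis k 1)"
      using quadratic_congruence[of "axis k 1" "P t" "mat 1"] by (simp add: cP[OF t] Pa)
    also have "\<dots> = c t $ k $ k"
      by (simp add: inner_axis inner_axis' matrix_vector_mul_component)
    finally show ?thesis using slice[OF t] by simp
  qed
  have ad: "((\<lambda>t. a t $ i) has_real_derivative (U t *v a t) $ i) (at t within {0..1})"
    if t: "t \<in> {0..1}" for t i
  proof -
    have "(U t *v a t) $ i = (R' t *v (L $ k)) $ i"
      by (simp add: a_def R'U[OF t] matrix_vector_mul_assoc)
    then have "(U t *v a t) $ i = (\<Sum>j\<in>UNIV. R' t $ i $ j * L $ k $ j)"
      by (simp add: matrix_vector_mult_def)
    then show ?thesis
      unfolding a_def[of t for t] matrix_vector_mult_def[of "R t" for t] vec_lambda_beta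
      by (auto intro!: derivative_eq_intros Rd t)
  qed
  have aUa: "a t \<bullet> (U t *v a t) = 0" if t: "t \<in> {0..1}" for t
  proof -
    have "((\<lambda>t. \<Sum>i\<in>UNIV. a t $ i * a t $ i) has_real_derivative
        (\<Sum>i\<in>UNIV. 2 * (a t $ i * (U t *v a t) $ i))) (at t within {0..1})"
      by (auto intro!: derivative_eq_intros ad t sum.cong)
    then have "((\<lambda>t. 1) has_real_derivative
        (\<Sum>i\<in>UNIV. 2 * (a t $ i * (U t *v a t) $ i))) (at t within {0..1})"
      by (rule has_field_derivative_transform_within[where d = 1])
        (use t a1 in \<open>auto simp: inner_vec_def\<close>)
    then have "(\<Sum>i\<in>UNIV. 2 * (a t $ i * (U t *v a t) $ i)) = 0"
      using vector_derivative_unique_within_closed_interval[of 0 1 t "\<lambda>t. 1 :: real"] t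
        has_vector_derivative_const[of "1 :: real" "at t within {0..1}"]
      by (auto simp: has_real_derivative_iff_has_vector_derivative)
    then show ?thesis by (simp add: inner_vec_def sum_distrib_left[symmetric])
  qed
  \<comment> \<open>the factor \<open>1/12\<close> makes \<open>B'\<close> the left side of \<open>calibration_pointwise\<close>\<close>
  define \<phi> where "\<phi> t = (\<Sum>i\<in>UNIV. \<kappa> $ i * (a t $ i)\<^sup>2)" for t
  define B where "B t = 2 * (\<Sum>i\<in>UNIV. \<kappa> $ i * ln (R t $ i $ i)) + \<phi> t ^ 3 / (12 * n\<^sup>2)" for t
  define B' where "B' t = 2 * (\<Sum>i\<in>UNIV. \<kappa> $ i * U t $ i $ i)
      + (\<phi> t)\<^sup>2 / (2 * n\<^sup>2) * (\<Sum>i\<in>UNIV. \<kappa> $ i * a t $ i * (U t *v a t) $ i)" for t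
  have Bd: "(B has_real_derivative B' t) (at t within {0..1})" if t: "t \<in> {0..1}" for t
  proof -
    have \<phi>d: "(\<phi> has_real_derivative 2 * (\<Sum>i\<in>UNIV. \<kappa> $ i * a t $ i * (U t *v a t) $ i))
        (at t within {0..1})"
      unfolding \<phi>_def
      by (auto intro!: derivative_eq_intros ad t sum.cong simp: sum_distrib_left)
    have lnd: "((\<lambda>t. ln (R t $ i $ i)) has_real_derivative U t $ i $ i) (at t within {0..1})" for i
      by (rule derivative_eq_intros Rd[OF t] Rpos[OF t] refl)+
        (use Udiag[OF t, of i] Rpos[OF t, of i] in \<open>simp add: field_simps\<close>)
    have sumd: "((\<lambda>t. \<Sum>i\<in>UNIV. \<kappa> $ i * ln (R t $ i $ i)) has_real_derivative
        (\<Sum>i\<in>UNIV. \<kappa> $ i * U t $ i $ i)) (at t within {0..1})"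
      by (intro DERIV_sum DERIV_cmult lnd)
    show ?thesis
      unfolding B_def B'_def
      by (rule DERIV_cong[OF DERIV_add[OF DERIV_cmult[OF sumd, of 2]
            DERIV_cdivide[OF DERIV_power[OF \<phi>d, of 3], of "12 * n\<^sup>2"]]])
        (use n in \<open>simp add: field_simps power2_eq_square\<close>)
  qed
  have B'le: "B' t \<le> n * sqrt 2 * sqrt (airm (c t) (c' t) (c' t))" if t: "t \<in> {0..1}" for t
  proof -
    have "B' t \<le> n * norm (X t)"
      unfolding B'_def X_def n_def
      by (rule calibration_pointwise[OF r Utri[OF t] a1[OF t] aUa[OF t] \<kappa>]) (auto simp: \<phi>_def)
    also have "norm (X t) = sqrt 2 * sqrt (airm (c t) (c' t) (c' t))"
      unfolding speed[OF t] by (simp add: real_sqrt_divide)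
    finally show ?thesis by (simp add: mult.assoc)
  qed
  have "(B' has_integral (B 1 - B 0)) {0..1}"
    using Bd by (intro fundamental_theorem_of_calculus)
      (auto simp: has_real_derivative_iff_has_vector_derivative)
  moreover have "(\<lambda>t. sqrt (airm (c t) (c' t) (c' t))) integrable_on {0..1}"
    by (intro integrable_continuous_real continuous_on_real_sqrt cont)
  then have "((\<lambda>t. n * sqrt 2 * sqrt (airm (c t) (c' t) (c' t))) has_integral
      n * sqrt 2 * integral {0..1} (\<lambda>t. sqrt (airm (c t) (c' t) (c' t)))) {0..1}"
    by (intro has_integral_mult_right integrable_integral)
  ultimately have le: "B 1 - B 0
      \<le> n * sqrt 2 * integral {0..1} (\<lambda>t. sqrt (airm (c t) (c' t) (c' t)))"
    using B'le by (rule has_integral_le)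
  have R0: "R 0 = diag_mat (\<chi> i. sqrt ((\<chi> i. (1 :: real)) $ i))"
  proof (rule cholesky_of_diag[OF r])
    have "C 0 = mat 1" using reverse[of "mat 1"] by (simp add: C_def c0)
    then show "transpose (R 0) ** R 0 = diag_mat (\<chi> i. 1)"
      using CR[of 0] by (simp add: diag_mat_one)
  qed (use Rtri Rpos in auto)
  have R1: "R 1 = diag_mat (\<chi> i. sqrt ((\<chi> i. exp (\<kappa> $ i)) $ i))"
  proof (rule cholesky_of_diag[OF r])
    show "transpose (R 1) ** R 1 = diag_mat (\<chi> i. exp (\<kappa> $ i))"
      using CR[of 1] reverse by (simp add: C_def c1)
  qed (use Rtri Rpos in auto)
  have B0: "B 0 = (\<Sum>i\<in>UNIV. \<kappa> $ i * (L $ k $ i)\<^sup>2) ^ 3 / (12 * n\<^sup>2)"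
    by (simp add: B_def \<phi>_def a_def R0 diag_mat_vector_nth) (simp add: diag_mat_nth)
  have B1: "B 1 = n\<^sup>2 + (\<Sum>i\<in>UNIV. \<kappa> $ i * exp (\<kappa> $ i) * (L $ k $ i)\<^sup>2) ^ 3 / (12 * n\<^sup>2)"
  proof -
    have "ln (sqrt (exp (\<kappa> $ i))) = \<kappa> $ i / 2" for i by (simp add: ln_sqrt)
    then have "(\<Sum>i\<in>UNIV. \<kappa> $ i * ln (sqrt (exp (\<kappa> $ i)))) = (\<Sum>i\<in>UNIV. \<kappa> $ i * (\<kappa> $ i / 2))"
      by (simp only:)
    also have "\<dots> = n\<^sup>2 / 2"
      by (simp add: n_def power2_norm_eq_inner inner_vec_def sum_divide_distrib[symmetric])
    finally show ?thesis
      by (simp add: B_def \<phi>_def a_def R1 diag_mat_vector_nth power_mult_distrib mult.assoc)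
        (simp add: diag_mat_nth)
  qed
  define \<delta> where "\<delta> = (\<Sum>i\<in>UNIV. \<kappa> $ i * exp (\<kappa> $ i) * (L $ k $ i)\<^sup>2) ^ 3
      - (\<Sum>i\<in>UNIV. \<kappa> $ i * (L $ k $ i)\<^sup>2) ^ 3"
  have "n * (n + \<delta> / (12 * n ^ 3)) = B 1 - B 0"
    using n by (simp add: B0 B1 \<delta>_def field_simps power2_eq_square power3_eq_cube)
  with le have "n * (n + \<delta> / (12 * n ^ 3))
      \<le> n * (sqrt 2 * integral {0..1} (\<lambda>t. sqrt (airm (c t) (c' t) (c' t))))" by (simp add: mult.assoc)
  then have "n + \<delta> / (12 * n ^ 3) \<le> sqrt 2 * integral {0..1} (\<lambda>t. sqrt (airm (c t) (c' t) (c' t)))"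
    using n by simp
  then show ?thesis
    unfolding \<delta>_def n_def by (simp add: pos_divide_le_eq mult.commute)
qed

section \<open>Continuity and bilinearity of the metric\<close>

text \<open>Inversion is continuous, since by Cramer's rule the entries of an inverse are quotients of
  polynomials.\<close>

lemma matrix_inv_cramer:
  fixes A :: "real ^ 'n ^ 'n"
  assumes "invertible A"
  shows "matrix_inv A $ k $ l = det (\<chi> i j. if j = k then axis l 1 $ i else A $ i $ j) / det A"
proof -
  have "A *v (matrix_inv A *v axis l 1) = axis l 1"
    using assms by (simp add: matrix_vector_mul_assoc)
  moreover have "det A \<noteq> 0" using assms by (simp add: invertible_det_nz)
  ultimately have "matrix_inv A *v axis l 1
      = (\<chi> k. det (\<chi> i j. if j = k then axis l 1 $ i else A $ i $ j) / det A)"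
    using cramer by blast
  then have "(matrix_inv A *v axis l 1) $ k
      = det (\<chi> i j. if j = k then axis l 1 $ i else A $ i $ j) / det A"
    by simp
  then show ?thesis by (simp add: matrix_vector_mul_component inner_axis)
qed

lemma continuous_on_det:
  fixes f :: "'b::topological_space \<Rightarrow> real ^ 'n ^ 'n"
  assumes "\<And>i j. continuous_on S (\<lambda>x. f x $ i $ j)"
  shows "continuous_on S (\<lambda>x. det (f x))"
  unfolding det_def by (intro continuous_intros assms)

lemma continuous_on_matrix_inv:
  fixes f :: "'b::topological_space \<Rightarrow> real ^ 'n ^ 'n"
  assumes f: "continuous_on S f" and inv: "\<And>x. x \<in> S \<Longrightarrow> invertible (f x)"
  shows "continuous_on S (\<lambda>x. matrix_inv (f x))"
proof -
  have c: "continuous_on S (\<lambda>x. f x $ i $ j)" for i j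
    by (intro continuous_on_component f)
  have "continuous_on S (\<lambda>x. \<chi> k l. det (\<chi> i j. if j = k then axis l 1 $ i else f x $ i $ j) / det (f x))"
  proof (intro continuous_on_vec_lambda continuous_on_divide continuous_on_det c ballI)
    fix k l i j
    show "continuous_on S (\<lambda>x. (\<chi> i j. if j = k then axis l 1 $ i else f x $ i $ j) $ i $ j)"
      using c by (cases "j = k") simp_all
  qed (use inv in \<open>simp add: invertible_det_nz\<close>)
  then show ?thesis
    by (rule continuous_on_eq) (simp add: vec_eq_iff matrix_inv_cramer inv)
qed

lemma continuous_on_matrix_mult:
  fixes f g :: "'b::topological_space \<Rightarrow> real ^ 'n ^ 'n"
  assumes "continuous_on S f" "continuous_on S g"
  shows "continuous_on S (\<lambda>x. f x ** g x)"
  unfolding matrix_matrix_mult_def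
  by (intro continuous_on_vec_lambda continuous_on_sum continuous_on_mult continuous_on_component assms)

lemma spd_invertible:
  fixes A :: "real ^ 'n ^ 'n"
  assumes "spd A"
  shows "invertible A"
proof -
  have "x = 0" if "A *v x = 0" for x
    using assms that unfolding spd_def by (metis inner_zero_right less_irrefl)
  then show ?thesis by (simp add: invertible_left_inverse matrix_left_invertible_ker)
qed

lemma continuous_on_airm:
  fixes c c' :: "'b::topological_space \<Rightarrow> real ^ 'n ^ 'n"
  assumes "continuous_on S c" "continuous_on S c'" "\<And>x. x \<in> S \<Longrightarrow> spd (c x)"
  shows "continuous_on S (\<lambda>x. airm (c x) (c' x) (c' x))"
proof -
  have "continuous_on S (\<lambda>x. matrix_inv (c x) ** c' x ** matrix_inv (c x) ** c' x)"
    by (intro continuous_on_matrix_mult continuous_on_matrix_inv assms spd_invertible)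
  then show ?thesis
    unfolding airm_def trace_def by (intro continuous_intros continuous_on_component)
qed

lemma linear_trace: "linear (trace :: real ^ 'n ^ 'n \<Rightarrow> real)"
  by (rule linearI) (simp_all add: trace_def sum.distrib sum_distrib_left)

lemma linear_airm_left: "linear (\<lambda>X. airm S X Y)"
  and linear_airm_right: "linear (\<lambda>Y. airm S X Y)" for S X Y :: "real ^ 'n ^ 'n"
proof -
  have l: "linear (\<lambda>A. 1 / 2 * trace (P ** A ** Q))" for P Q :: "real ^ 'n ^ 'n"
  proof -
    have lin: "linear (\<lambda>A. trace (P ** A ** Q))"
      using linear_compose[OF bounded_linear.linear[OF bounded_linear_congruence] linear_trace]
      by (simp add: o_def)
    show ?thesis
      by (rule linearI) (simp_all add: linear_add[OF lin] linear_scale[OF lin])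
  qed
  show "linear (\<lambda>X. airm S X Y)"
    using l[of "matrix_inv S" "matrix_inv S ** Y"] by (simp add: airm_def matrix_mul_assoc)
  show "linear (\<lambda>Y. airm S X Y)"
    using l[of "matrix_inv S ** X ** matrix_inv S" "mat 1"] by (simp add: airm_def)
qed

lemma airm_sum:
  fixes S :: "real ^ 'n ^ 'n" and v :: "'d::finite \<Rightarrow> real"
  shows "airm S (\<Sum>j\<in>UNIV. v j *\<^sub>R X j) (\<Sum>k\<in>UNIV. v k *\<^sub>R X k)
    = (\<Sum>j\<in>UNIV. \<Sum>k\<in>UNIV. airm S (X j) (X k) * v j * v k)"
proof -
  have left: "airm S (\<Sum>j\<in>UNIV. v j *\<^sub>R X j) Y = (\<Sum>j\<in>UNIV. v j * airm S (X j) Y)" for Y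
    by (simp add: linear_sum[OF linear_airm_left] linear_scale[OF linear_airm_left])
  have right: "airm S Y (\<Sum>k\<in>UNIV. v k *\<^sub>R X k) = (\<Sum>k\<in>UNIV. v k * airm S Y (X k))" for Y
    by (simp add: linear_sum[OF linear_airm_right] linear_scale[OF linear_airm_right])
  have "airm S (\<Sum>j\<in>UNIV. v j *\<^sub>R X j) (\<Sum>k\<in>UNIV. v k *\<^sub>R X k)
      = (\<Sum>j\<in>UNIV. v j * (\<Sum>k\<in>UNIV. v k * airm S (X j) (X k)))"
    by (subst left) (simp only: right)
  then show ?thesis by (simp add: sum_distrib_left algebra_simps)
qed

lemma airm_nonneg:
  fixes S X :: "real ^ 'n ^ 'n"
  assumes S: "spd S" and X: "transpose X = X"
  shows "0 \<le> airm S X X"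
proof -
  obtain L :: "real ^ 'n ^ 'n" where L: "invertible L" "S = L ** transpose L"
    using airm_normal_form[OF S S] by metis
  define J where "J = matrix_inv L"
  have J: "J ** L = mat 1" "L ** J = mat 1" using L(1) by (auto simp: J_def)
  have tJ: "transpose L ** transpose J = mat 1" "transpose J ** transpose L = mat 1"
    using J by (metis matrix_transpose_mul transpose_mat)+
  define Y where "Y = J ** X ** transpose J"
  have tY: "transpose Y = Y" by (simp add: Y_def matrix_transpose_mul matrix_mul_assoc X)
  have "L ** Y ** transpose L = (L ** J) ** X ** (transpose J ** transpose L)"
    unfolding Y_def by (simp only: matrix_mul_assoc)
  then have "X = transpose (transpose L) ** Y ** transpose L" by (simp add: J tJ)
  moreover have "S = transpose (transpose L) ** transpose L" using L(2) by simp
  moreover have "invertible (transpose L)" using tJ by (auto simp: invertible_def)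
  ultimately have "airm S X X = (norm Y)\<^sup>2 / 2" using airm_congruence[of "transpose L" Y] tY by metis
  then show ?thesis using zero_le_power2[of "norm Y"] by linarith
qed

section \<open>Convexity along geodesics\<close>

lemma congruence_diag_nth:
  fixes L :: "real ^ 'n ^ 'n"
  shows "(L ** diag_mat D ** transpose L) $ a $ b = (\<Sum>i\<in>UNIV. L $ a $ i * D $ i * L $ b $ i)"
  by (simp add: matrix_mult_nth[of "L ** diag_mat D"] matrix_diag_mat_nth transpose_def)

text \<open>The function \<open>\<Sum> exp (t * \<kappa> i) * l i\<^sup>2\<close> is convex in \<open>t\<close> with equal values at \<open>0\<close> and \<open>1\<close>,
  strictly so unless it is constant.  Hence its slopes at the ends have opposite signs.\<close>

lemma endpoint_slopes:
  fixes \<kappa> l :: "'n::finite \<Rightarrow> real"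
  assumes 0: "(\<Sum>i\<in>UNIV. (l i)\<^sup>2) = 1" and 1: "(\<Sum>i\<in>UNIV. exp (\<kappa> i) * (l i)\<^sup>2) = 1"
    and i: "\<kappa> i \<noteq> 0" "l i \<noteq> 0"
  shows "(\<Sum>i\<in>UNIV. \<kappa> i * (l i)\<^sup>2) < 0" "0 < (\<Sum>i\<in>UNIV. \<kappa> i * exp (\<kappa> i) * (l i)\<^sup>2)"
proof -
  have lt: "1 + y < exp y" if "y \<noteq> 0" for y :: real
  proof -
    have "exp y \<noteq> 1 + y"
    proof
      assume e: "exp y = 1 + y"
      then have "ln (exp y) = exp y - 1" unfolding ln_exp by linarith
      then have "exp y = 1" by (rule ln_eq_minus_one[OF exp_gt_zero])
      then show False using e \<open>y \<noteq> 0\<close> by linarith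
    qed
    then show ?thesis using exp_ge_add_one_self[of y] by linarith
  qed
  have flip: "exp y - 1 \<le> y * exp y" "y \<noteq> 0 \<Longrightarrow> exp y - 1 < y * exp y" for y :: real
  proof -
    have e: "exp y * exp (- y) = 1" by (simp add: exp_minus)
    have "exp y * (1 + - y) \<le> exp y * exp (- y)"
      by (intro mult_left_mono exp_ge_add_one_self) simp
    then show "exp y - 1 \<le> y * exp y" unfolding e by (simp add: algebra_simps)
    assume "y \<noteq> 0"
    then have "exp y * (1 + - y) < exp y * exp (- y)" by (intro mult_strict_left_mono lt) auto
    then show "exp y - 1 < y * exp y" unfolding e by (simp add: algebra_simps)
  qed
  have diff: "(\<Sum>i\<in>UNIV. (exp (\<kappa> i) - 1) * (l i)\<^sup>2) = 0"
    using 0 1 by (simp add: left_diff_distrib sum_subtractf)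
  have li: "0 < (l i)\<^sup>2" using i by simp
  have "(\<Sum>i\<in>UNIV. \<kappa> i * (l i)\<^sup>2) < (\<Sum>i\<in>UNIV. (exp (\<kappa> i) - 1) * (l i)\<^sup>2)"
  proof (rule sum_strict_mono_ex1)
    show "\<forall>j\<in>UNIV. \<kappa> j * (l j)\<^sup>2 \<le> (exp (\<kappa> j) - 1) * (l j)\<^sup>2"
    proof
      fix j
      have "\<kappa> j \<le> exp (\<kappa> j) - 1" using exp_ge_add_one_self[of "\<kappa> j"] by linarith
      then show "\<kappa> j * (l j)\<^sup>2 \<le> (exp (\<kappa> j) - 1) * (l j)\<^sup>2" by (intro mult_right_mono) auto
    qed
    have "\<kappa> i < exp (\<kappa> i) - 1" using lt[OF i(1)] by linarith
    then show "\<exists>j\<in>UNIV. \<kappa> j * (l j)\<^sup>2 < (exp (\<kappa> j) - 1) * (l j)\<^sup>2"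
      using mult_strict_right_mono[OF _ li] by blast
  qed simp
  then show "(\<Sum>i\<in>UNIV. \<kappa> i * (l i)\<^sup>2) < 0" unfolding diff .
  have "(\<Sum>i\<in>UNIV. (exp (\<kappa> i) - 1) * (l i)\<^sup>2) < (\<Sum>i\<in>UNIV. \<kappa> i * exp (\<kappa> i) * (l i)\<^sup>2)"
  proof (rule sum_strict_mono_ex1)
    show "\<forall>j\<in>UNIV. (exp (\<kappa> j) - 1) * (l j)\<^sup>2 \<le> \<kappa> j * exp (\<kappa> j) * (l j)\<^sup>2"
      using flip(1) by (intro ballI mult_right_mono) auto
    show "\<exists>j\<in>UNIV. (exp (\<kappa> j) - 1) * (l j)\<^sup>2 < \<kappa> j * exp (\<kappa> j) * (l j)\<^sup>2"
      using mult_strict_right_mono[OF flip(2)[OF i(1)] li] by blast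
  qed simp
  then show "0 < (\<Sum>i\<in>UNIV. \<kappa> i * exp (\<kappa> i) * (l i)\<^sup>2)" unfolding diff .
qed

section \<open>Elementary exponential estimates\<close>

lemma cosh_mono_abs: "\<bar>x\<bar> \<le> \<bar>y\<bar> \<Longrightarrow> cosh x \<le> cosh (y :: real)"
  using cosh_real_nonneg_le_iff[of "\<bar>x\<bar>" "\<bar>y\<bar>"] by simp

lemma exp_abs_le_cosh: "exp \<bar>y\<bar> \<le> 2 * cosh (y :: real)"
  by (cases "0 \<le> y") (simp_all add: cosh_def)

text \<open>Convexity of \<open>cosh\<close> between \<open>0\<close> and \<open>y\<close>.\<close>

lemma cosh_scale_le:
  fixes s y :: real
  assumes "0 \<le> s" "s \<le> 1"
  shows "cosh (s * y) - 1 \<le> s * (cosh y - 1)"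
proof -
  have "exp (s * z) \<le> s * exp z + (1 - s)" for z :: real
    using convex_onD[OF exp_convex, of s 0 z] assms by simp
  from this[of y] this[of "- y"] show ?thesis
    by (simp add: cosh_def field_simps)
qed

lemma le_exp_divide:
  fixes y :: real
  assumes "0 < \<delta>" "0 \<le> y"
  shows "y \<le> exp (\<delta> * y) / \<delta>"
proof -
  have "\<delta> * y \<le> exp (\<delta> * y)" using exp_ge_add_one_self[of "\<delta> * y"] by linarith
  then show ?thesis using assms by (simp add: field_simps)
qed

lemma exp_second_order_bound: "\<bar>exp y - 1 - y\<bar> \<le> y\<^sup>2 * exp \<bar>y\<bar>" for y :: real
  using Taylor_exp_field[of y 1] by (simp add: power2_eq_square algebra_simps)

section \<open>Exponential families with generators in the Orlicz space\<close>

locale orlicz_family =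
  fixes M :: "'a measure" and p :: "'a \<Rightarrow> real" and u :: "'d::finite \<Rightarrow> 'a \<Rightarrow> real"
  assumes p_density: "p \<in> densities M" and u_B: "\<And>j. u j \<in> B_space M p"
begin

lemma p_measurable [measurable]: "p \<in> borel_measurable M"
  and p_pos: "AE x in M. 0 < p x"
  and p_integrable: "integrable M p"
  and p_integral: "integral\<^sup>L M p = 1"
  using p_density by (auto simp: densities_def has_bochner_integral_iff)

lemma u_measurable [measurable]: "u j \<in> borel_measurable M"
  using u_B[of j] by (simp add: B_space_def)

lemma integrable_bound_p:
  assumes "integrable M (\<lambda>x. g x * p x)" "f \<in> borel_measurable M"
    and "\<And>x. \<bar>f x\<bar> \<le> g x"
  shows "integrable M (\<lambda>x. f x * p x)"
proof (rule Bochner_Integration.integrable_bound[OF assms(1)])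
  show "AE x in M. norm (f x * p x) \<le> norm (g x * p x)"
    using p_pos
  proof eventually_elim
    case (elim x)
    then show ?case using assms(3)[of x] by (simp add: abs_mult mult_right_mono)
  qed
qed (use assms(2) in measurable)

lemma nn_expect_finite_iff:
  assumes "f \<in> borel_measurable M" "\<And>x. 0 \<le> f x"
  shows "nn_expect M p f < \<infinity> \<longleftrightarrow> integrable M (\<lambda>x. f x * p x)"
    and "integrable M (\<lambda>x. f x * p x) \<Longrightarrow> nn_expect M p f = ennreal (\<integral>x. f x * p x \<partial>M)"
proof -
  have nn: "AE x in M. 0 \<le> f x * p x"
    using p_pos by eventually_elim (use assms(2) in \<open>simp add: less_imp_le\<close>)
  have meas: "(\<lambda>x. f x * p x) \<in> borel_measurable M" using assms(1) by measurable
  show eq: "nn_expect M p f = ennreal (\<integral>x. f x * p x \<partial>M)" if "integrable M (\<lambda>x. f x * p x)"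
    unfolding nn_expect_def by (rule nn_integral_eq_integral[OF that nn])
  show "nn_expect M p f < \<infinity> \<longleftrightarrow> integrable M (\<lambda>x. f x * p x)"
    using integrableI_nonneg[OF meas nn] eq by (auto simp: nn_expect_def)
qed

lemma B_space_iff:
  "v \<in> B_space M p \<longleftrightarrow> v \<in> borel_measurable M
    \<and> (\<exists>\<alpha>>0. integrable M (\<lambda>x. cosh (\<alpha> * v x) * p x)) \<and> expect M p v = 0"
proof -
  have "nn_expect M p (\<lambda>x. cosh (\<alpha> * v x) - 1) < \<infinity> \<longleftrightarrow> integrable M (\<lambda>x. cosh (\<alpha> * v x) * p x)"
    if [measurable]: "v \<in> borel_measurable M" for \<alpha>
  proof -
    have 1: "nn_expect M p (\<lambda>x. cosh (\<alpha> * v x) - 1) < \<infinity>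
        \<longleftrightarrow> integrable M (\<lambda>x. (cosh (\<alpha> * v x) - 1) * p x)"
      unfolding cosh_def by (rule nn_expect_finite_iff)
        (measurable, use cosh_real_ge_1 in \<open>simp add: cosh_def\<close>)
    have 2: "(\<lambda>x. cosh (\<alpha> * v x) * p x) = (\<lambda>x. (cosh (\<alpha> * v x) - 1) * p x + p x)"
      "(\<lambda>x. (cosh (\<alpha> * v x) - 1) * p x) = (\<lambda>x. cosh (\<alpha> * v x) * p x - p x)"
      by (auto simp: algebra_simps)
    show ?thesis
      unfolding 1
      using Bochner_Integration.integrable_add[OF _ p_integrable, of "\<lambda>x. (cosh (\<alpha> * v x) - 1) * p x"]
        Bochner_Integration.integrable_diff[OF _ p_integrable, of "\<lambda>x. cosh (\<alpha> * v x) * p x"]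
      unfolding 2[symmetric] by blast
  qed
  then show ?thesis by (auto simp: B_space_def)
qed

lemma B_space_integrable:
  assumes "v \<in> B_space M p"
  shows "integrable M (\<lambda>x. v x * p x)"
proof -
  obtain \<alpha> where \<alpha>: "0 < \<alpha>" "integrable M (\<lambda>x. cosh (\<alpha> * v x) * p x)"
    using assms by (auto simp: B_space_iff)
  have "integrable M (\<lambda>x. 2 / \<alpha> * (cosh (\<alpha> * v x) * p x))" using \<alpha>(2) by simp
  then have "integrable M (\<lambda>x. (2 / \<alpha> * cosh (\<alpha> * v x)) * p x)" by (simp only: mult.assoc)
  then show ?thesis
  proof (rule integrable_bound_p)
    fix x
    have "\<bar>v x\<bar> \<le> exp (\<alpha> * \<bar>v x\<bar>) / \<alpha>" using \<alpha>(1) by (intro le_exp_divide) auto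
    also have "\<dots> \<le> 2 * cosh (\<alpha> * v x) / \<alpha>"
      using exp_abs_le_cosh[of "\<alpha> * v x"] \<alpha>(1) by (simp add: abs_mult divide_right_mono)
    finally show "\<bar>v x\<bar> \<le> 2 / \<alpha> * cosh (\<alpha> * v x)" by simp
  qed (use assms in \<open>simp add: B_space_iff\<close>)
qed

lemma B_space_combination:
  assumes v: "v \<in> B_space M p" and w: "w \<in> B_space M p"
  shows "(\<lambda>x. a * v x + b * w x) \<in> B_space M p"
proof -
  obtain \<alpha> where \<alpha>: "0 < \<alpha>" "integrable M (\<lambda>x. cosh (\<alpha> * v x) * p x)"
    using v by (auto simp: B_space_iff)
  obtain \<beta> where \<beta>: "0 < \<beta>" "integrable M (\<lambda>x. cosh (\<beta> * w x) * p x)"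
    using w by (auto simp: B_space_iff)
  have [measurable]: "v \<in> borel_measurable M" "w \<in> borel_measurable M"
    using v w by (auto simp: B_space_iff)
  \<comment> \<open>the larger of the two summands is at least half the sum, whence the factor \<open>2\<close>\<close>
  define \<gamma> where "\<gamma> = min \<alpha> \<beta> / (2 * (\<bar>a\<bar> + \<bar>b\<bar> + 1))"
  have \<gamma>: "0 < \<gamma>" using \<alpha> \<beta> by (simp add: \<gamma>_def)
  have den: "0 < 2 * (\<bar>a\<bar> + \<bar>b\<bar> + 1)" by simp
  have "2 * (\<gamma> * \<bar>a\<bar>) \<le> min \<alpha> \<beta>" "2 * (\<gamma> * \<bar>b\<bar>) \<le> min \<alpha> \<beta>"
  proof -
    have "min \<alpha> \<beta> = \<gamma> * (2 * (\<bar>a\<bar> + \<bar>b\<bar> + 1))" using den by (simp add: \<gamma>_def)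
    moreover have "\<gamma> * (2 * \<bar>a\<bar>) \<le> \<gamma> * (2 * (\<bar>a\<bar> + \<bar>b\<bar> + 1))"
      "\<gamma> * (2 * \<bar>b\<bar>) \<le> \<gamma> * (2 * (\<bar>a\<bar> + \<bar>b\<bar> + 1))"
      using \<gamma> by (intro mult_left_mono; simp)+
    ultimately show "2 * (\<gamma> * \<bar>a\<bar>) \<le> min \<alpha> \<beta>" "2 * (\<gamma> * \<bar>b\<bar>) \<le> min \<alpha> \<beta>"
      by (simp_all add: mult.left_commute)
  qed
  then have ab: "2 * (\<gamma> * \<bar>a\<bar>) \<le> \<alpha>" "2 * (\<gamma> * \<bar>b\<bar>) \<le> \<beta>" by auto
  have "integrable M (\<lambda>x. cosh (\<alpha> * v x) * p x + cosh (\<beta> * w x) * p x)" using \<alpha> \<beta> by simp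
  then have "integrable M (\<lambda>x. (cosh (\<alpha> * v x) + cosh (\<beta> * w x)) * p x)"
    by (simp only: distrib_right)
  then have "integrable M (\<lambda>x. cosh (\<gamma> * (a * v x + b * w x)) * p x)"
  proof (rule integrable_bound_p)
    fix x
    have "\<bar>\<gamma> * (a * v x + b * w x)\<bar> \<le> \<gamma> * \<bar>a\<bar> * \<bar>v x\<bar> + \<gamma> * \<bar>b\<bar> * \<bar>w x\<bar>"
      using \<gamma> by (simp add: abs_mult distrib_left[symmetric] mult.assoc)
        (metis abs_mult abs_triangle_ineq)
    moreover have "2 * (\<gamma> * \<bar>a\<bar>) * \<bar>v x\<bar> \<le> \<alpha> * \<bar>v x\<bar>" "2 * (\<gamma> * \<bar>b\<bar>) * \<bar>w x\<bar> \<le> \<beta> * \<bar>w x\<bar>"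
      using ab by (intro mult_right_mono; simp)+
    ultimately have "\<bar>\<gamma> * (a * v x + b * w x)\<bar> \<le> \<alpha> * \<bar>v x\<bar> \<or> \<bar>\<gamma> * (a * v x + b * w x)\<bar> \<le> \<beta> * \<bar>w x\<bar>"
      by linarith
    then have "cosh (\<gamma> * (a * v x + b * w x)) \<le> cosh (\<alpha> * v x)
        \<or> cosh (\<gamma> * (a * v x + b * w x)) \<le> cosh (\<beta> * w x)"
      using \<alpha>(1) \<beta>(1) cosh_mono_abs[of "\<gamma> * (a * v x + b * w x)" "\<alpha> * v x"]
        cosh_mono_abs[of "\<gamma> * (a * v x + b * w x)" "\<beta> * w x"] by (auto simp: abs_mult)
    moreover have "1 \<le> cosh (\<alpha> * v x)" "1 \<le> cosh (\<beta> * w x)"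
      "1 \<le> cosh (\<gamma> * (a * v x + b * w x))" by (rule cosh_real_ge_1)+
    ultimately show "\<bar>cosh (\<gamma> * (a * v x + b * w x))\<bar> \<le> cosh (\<alpha> * v x) + cosh (\<beta> * w x)"
      by linarith
  qed (simp add: cosh_def)
  moreover have "expect M p (\<lambda>x. a * v x + b * w x) = a * expect M p v + b * expect M p w"
    using B_space_integrable[OF v] B_space_integrable[OF w]
    by (simp add: expect_def distrib_right mult.assoc)
  ultimately show ?thesis using v w \<gamma> by (auto simp: B_space_iff)
qed

lemma zero_in_B_space: "(\<lambda>x. 0) \<in> B_space M p"
  using p_integrable by (auto simp: B_space_iff expect_def intro!: exI[of _ 1])

lemma lincomb_in_B_space: "lincomb u \<theta> \<in> B_space M p"
proof -
  have "(\<lambda>x. \<Sum>j\<in>A. \<theta> $ j * u j x) \<in> B_space M p" if "finite A" for A :: "'d set"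
    using that
  proof induction
    case (insert j A)
    then show ?case
      using B_space_combination[OF u_B[of j] insert.IH, of "\<theta> $ j" 1] by simp
  qed (simp add: zero_in_B_space)
  then show ?thesis by (simp add: lincomb_def[abs_def])
qed

lemma lincomb_measurable [measurable]: "lincomb u \<theta> \<in> borel_measurable M"
  unfolding lincomb_def[abs_def] by measurable

lemma lincomb_add: "lincomb u (\<theta> + \<eta>) x = lincomb u \<theta> x + lincomb u \<eta> x"
  and lincomb_scaleR: "lincomb u (s *\<^sub>R \<theta>) x = s * lincomb u \<theta> x"
  by (simp_all add: lincomb_def sum.distrib sum_distrib_left algebra_simps)

text \<open>Scaling is continuous for the Orlicz norm.  So from an interior point of the domain of \<open>K\<^sub>p\<close> one stays in
  the domain for short steps in any fixed direction.\<close>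

lemma B_norm_scale_small:
  assumes v: "v \<in> B_space M p" and \<epsilon>: "0 < \<epsilon>"
  obtains c where "0 < c" "\<And>s. \<bar>s\<bar> \<le> c \<Longrightarrow> B_norm M p (\<lambda>x. s * v x) < \<epsilon>"
proof -
  obtain \<alpha> where \<alpha>: "0 < \<alpha>" and int: "integrable M (\<lambda>x. cosh (\<alpha> * v x) * p x)"
    using v by (auto simp: B_space_iff)
  have [measurable]: "v \<in> borel_measurable M" using v by (auto simp: B_space_iff)
  define A where "A = (\<integral>x. (cosh (\<alpha> * v x) - 1) * p x \<partial>M)"
  have intA: "integrable M (\<lambda>x. (cosh (\<alpha> * v x) - 1) * p x)"
    using int p_integrable by (simp add: left_diff_distrib)
  \<comment> \<open>by convexity, shrinking the argument by \<open>q\<close> shrinks \<open>cosh - 1\<close> at least by \<open>q\<close>\<close>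
  define q where "q = 1 / (\<bar>A\<bar> + 1)"
  have q: "0 < q" "q \<le> 1" "q * A \<le> 1" by (auto simp: q_def field_simps)
  define c where "c = q * \<alpha> * (\<epsilon> / 2)"
  have "B_norm M p (\<lambda>x. s * v x) < \<epsilon>" if s: "\<bar>s\<bar> \<le> c" for s
  proof -
    have le: "cosh (s * v x / (\<epsilon> / 2)) - 1 \<le> q * (cosh (\<alpha> * v x) - 1)" for x
    proof -
      have "\<bar>s\<bar> / (\<epsilon> / 2) \<le> q * \<alpha>" using s \<epsilon> by (simp add: c_def field_simps)
      then have "\<bar>s\<bar> / (\<epsilon> / 2) * \<bar>v x\<bar> \<le> q * \<alpha> * \<bar>v x\<bar>" by (intro mult_right_mono) auto
      moreover have "\<bar>s * v x / (\<epsilon> / 2)\<bar> = \<bar>s\<bar> / (\<epsilon> / 2) * \<bar>v x\<bar>"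
        "\<bar>q * (\<alpha> * v x)\<bar> = q * \<alpha> * \<bar>v x\<bar>"
        using q(1) \<alpha> \<epsilon> by (simp_all add: abs_mult)
      ultimately have "\<bar>s * v x / (\<epsilon> / 2)\<bar> \<le> \<bar>q * (\<alpha> * v x)\<bar>" by linarith
      then have "cosh (s * v x / (\<epsilon> / 2)) \<le> cosh (q * (\<alpha> * v x))" by (rule cosh_mono_abs)
      then show ?thesis using cosh_scale_le[of q "\<alpha> * v x"] q by linarith
    qed
    have intq: "integrable M (\<lambda>x. q * (cosh (\<alpha> * v x) - 1) * p x)"
      using intA by (simp add: mult.assoc)
    have "nn_expect M p (\<lambda>x. cosh (s * v x / (\<epsilon> / 2)) - 1)
        \<le> nn_expect M p (\<lambda>x. q * (cosh (\<alpha> * v x) - 1))"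
      unfolding nn_expect_def
    proof (rule nn_integral_mono_AE)
      show "AE x in M. ennreal ((cosh (s * v x / (\<epsilon> / 2)) - 1) * p x)
          \<le> ennreal (q * (cosh (\<alpha> * v x) - 1) * p x)"
        using p_pos by eventually_elim (intro ennreal_leI mult_right_mono le, simp)
    qed
    also have "\<dots> = ennreal (q * A)"
      using intq q(1) cosh_real_ge_1
      by (subst nn_expect_finite_iff(2)) (auto simp: A_def mult.assoc cosh_def)
    also have "\<dots> \<le> 1" using q(3) by (simp add: ennreal_le_1)
    finally have "\<epsilon> / 2 \<in> {r. 0 < r \<and> nn_expect M p (\<lambda>x. cosh (s * v x / r) - 1) \<le> 1}"
      using \<epsilon> by simp
    then have "B_norm M p (\<lambda>x. s * v x) \<le> \<epsilon> / 2"
      unfolding B_norm_def by (intro cInf_lower bdd_belowI[of _ 0]) auto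
    then show ?thesis using \<epsilon> by simp
  qed
  moreover have "0 < c" using q \<alpha> \<epsilon> by (simp add: c_def)
  ultimately show ?thesis using that by blast
qed

lemma K_fun_finite_iff:
  assumes "v \<in> borel_measurable M"
  shows "K_fun M p v < \<infinity> \<longleftrightarrow> integrable M (\<lambda>x. exp (v x) * p x)"
  using nn_expect_finite_iff(1)[of "\<lambda>x. exp (v x)"] assms
  by (auto simp: K_fun_def Let_def)

lemma K_dom_iff: "v \<in> K_dom M p \<longleftrightarrow> v \<in> B_space M p \<and> integrable M (\<lambda>x. exp (v x) * p x)"
  unfolding K_dom_def using K_fun_finite_iff[of v] by (auto simp: B_space_def)

text \<open>The domain of \<open>K\<^sub>p\<close> is convex because the exponential is, and so is its interior.\<close>

lemma convex_Theta: "convex (Theta M p u)"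
proof (rule convexI)
  fix \<theta> \<eta> and a b :: real
  assume \<theta>: "\<theta> \<in> Theta M p u" and \<eta>: "\<eta> \<in> Theta M p u" and ab: "0 \<le> a" "0 \<le> b" "a + b = 1"
  obtain \<epsilon> where \<epsilon>: "0 < \<epsilon>" "\<And>v. v \<in> B_space M p \<Longrightarrow> B_norm M p (\<lambda>x. v x - lincomb u \<theta> x) < \<epsilon> \<Longrightarrow> v \<in> K_dom M p"
    using \<theta> by (auto simp: Theta_def K_dom_interior_def)
  obtain \<epsilon>' where \<epsilon>': "0 < \<epsilon>'" "\<And>v. v \<in> B_space M p \<Longrightarrow> B_norm M p (\<lambda>x. v x - lincomb u \<eta> x) < \<epsilon>' \<Longrightarrow> v \<in> K_dom M p"
    using \<eta> by (auto simp: Theta_def K_dom_interior_def)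
  let ?\<zeta> = "a *\<^sub>R \<theta> + b *\<^sub>R \<eta>"
  have "v \<in> K_dom M p"
    if v: "v \<in> B_space M p" and nv: "B_norm M p (\<lambda>x. v x - lincomb u ?\<zeta> x) < min \<epsilon> \<epsilon>'" for v
  proof -
    \<comment> \<open>translate the ball around the convex combination to balls around the two endpoints\<close>
    define h where "h = (\<lambda>x. v x - lincomb u ?\<zeta> x)"
    have h: "h \<in> B_space M p"
      using B_space_combination[OF v lincomb_in_B_space[of ?\<zeta>], of 1 "- 1"] by (simp add: h_def)
    define v1 where "v1 = (\<lambda>x. lincomb u \<theta> x + h x)"
    define v2 where "v2 = (\<lambda>x. lincomb u \<eta> x + h x)"
    have B: "v1 \<in> B_space M p" "v2 \<in> B_space M p"
      using B_space_combination[OF lincomb_in_B_space h, of 1 _ 1] by (simp_all add: v1_def v2_def)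
    have "v1 \<in> K_dom M p" by (rule \<epsilon>(2)[OF B(1)]) (use nv in \<open>simp add: v1_def h_def\<close>)
    moreover have "v2 \<in> K_dom M p"
      by (rule \<epsilon>'(2)[OF B(2)]) (use nv in \<open>simp add: v2_def h_def\<close>)
    ultimately
    have i: "integrable M (\<lambda>x. exp (v1 x) * p x)" "integrable M (\<lambda>x. exp (v2 x) * p x)"
      by (auto simp: K_dom_iff)
    have v_eq: "v x = a * v1 x + b * v2 x" for x
    proof -
      have "a * v1 x + b * v2 x = lincomb u ?\<zeta> x + (a + b) * h x"
        by (simp add: v1_def v2_def lincomb_add lincomb_scaleR algebra_simps)
      then show ?thesis by (simp add: ab h_def)
    qed
    have "integrable M (\<lambda>x. a * (exp (v1 x) * p x) + b * (exp (v2 x) * p x))" using i by simp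
    then have "integrable M (\<lambda>x. (a * exp (v1 x) + b * exp (v2 x)) * p x)"
      by (simp only: distrib_right mult.assoc)
    then have "integrable M (\<lambda>x. exp (v x) * p x)"
    proof (rule integrable_bound_p)
      fix x
      have "exp (a * v1 x + b * v2 x) \<le> a * exp (v1 x) + b * exp (v2 x)"
        using convex_onD[OF exp_convex, of b "v1 x" "v2 x"] ab by (simp add: eq_diff_eq[symmetric])
      then show "\<bar>exp (v x)\<bar> \<le> a * exp (v1 x) + b * exp (v2 x)" by (simp add: v_eq)
    qed (use v in \<open>auto simp: B_space_iff\<close>)
    then show ?thesis using v by (simp add: K_dom_iff)
  qed
  then show "?\<zeta> \<in> Theta M p u"
    unfolding Theta_def K_dom_interior_def
    using lincomb_in_B_space \<epsilon>(1) \<epsilon>'(1) by (intro CollectI conjI exI[of _ "min \<epsilon> \<epsilon>'"]) auto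
qed

section \<open>Parameters with exponential moments\<close>

definition usum :: "'a \<Rightarrow> real" where "usum x = (\<Sum>j\<in>UNIV. \<bar>u j x\<bar>)"

text \<open>The parameters at which the density has an exponential moment to spare.  This set is open, and every
  function that grows slower than exponentially in the \<open>u\<^sub>j\<close> is integrable there, without reference to the
  Orlicz norm.\<close>

definition moment_domain :: "(real ^ 'd) set" where
  "moment_domain = {\<theta>. \<exists>c>0. integrable M (\<lambda>x. exp (lincomb u \<theta> x + c * usum x) * p x)}"

text \<open>A class of integrands that contains the \<open>u\<^sub>j\<close> and is closed under products, hence contains the
  integrands of all derivatives.\<close>

definition moderate :: "('a \<Rightarrow> real) \<Rightarrow> bool" where
  "moderate f \<longleftrightarrow> f \<in> borel_measurable M \<and> (\<forall>\<delta>>0. \<exists>A. \<forall>x. \<bar>f x\<bar> \<le> A * exp (\<delta> * usum x))"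

definition moment :: "('a \<Rightarrow> real) \<Rightarrow> real ^ 'd \<Rightarrow> real" where
  "moment f \<theta> = (\<integral>x. f x * exp (lincomb u \<theta> x) * p x \<partial>M)"

lemma usum_measurable [measurable]: "usum \<in> borel_measurable M"
  unfolding usum_def[abs_def] by measurable

lemma usum_nonneg: "0 \<le> usum x"
  by (simp add: usum_def sum_nonneg)

lemma abs_u_le_usum: "\<bar>u j x\<bar> \<le> usum x"
  unfolding usum_def by (rule member_le_sum) auto

lemma abs_lincomb_le: "\<bar>lincomb u h x\<bar> \<le> norm h * usum x"
proof -
  have "\<bar>lincomb u h x\<bar> \<le> (\<Sum>j\<in>UNIV. \<bar>h $ j * u j x\<bar>)"
    unfolding lincomb_def by (rule sum_abs)
  also have "\<dots> \<le> (\<Sum>j\<in>UNIV. norm h * \<bar>u j x\<bar>)"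
    by (intro sum_mono) (simp add: abs_mult mult_right_mono component_le_norm_cart)
  finally show ?thesis by (simp add: usum_def sum_distrib_left)
qed

lemma moderate_const: "moderate (\<lambda>x. a)"
  unfolding moderate_def
proof (intro conjI allI impI)
  fix \<delta> :: real assume "0 < \<delta>"
  then have "1 \<le> exp (\<delta> * usum x)" for x using usum_nonneg by simp
  then have "\<bar>a\<bar> * 1 \<le> \<bar>a\<bar> * exp (\<delta> * usum x)" for x by (intro mult_left_mono) auto
  then show "\<exists>A. \<forall>x. \<bar>a\<bar> \<le> A * exp (\<delta> * usum x)" by (intro exI[of _ "\<bar>a\<bar>"]) simp
qed simp

lemma moderate_usum: "moderate usum"
  unfolding moderate_def
proof (intro conjI allI impI)
  fix \<delta> :: real assume "0 < \<delta>"
  then show "\<exists>A. \<forall>x. \<bar>usum x\<bar> \<le> A * exp (\<delta> * usum x)"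
    using le_exp_divide[of \<delta>] usum_nonneg by (intro exI[of _ "1 / \<delta>"]) simp
qed simp

lemma moderate_dominated:
  assumes "moderate g" "f \<in> borel_measurable M" "\<And>x. \<bar>f x\<bar> \<le> \<bar>g x\<bar>"
  shows "moderate f"
  using assms unfolding moderate_def by (meson order_trans)

lemma moderate_u: "moderate (u j)"
  by (rule moderate_dominated[OF moderate_usum]) (use abs_u_le_usum usum_nonneg in auto)

lemma moderate_mult:
  assumes f: "moderate f" and g: "moderate g"
  shows "moderate (\<lambda>x. f x * g x)"
  unfolding moderate_def
proof (intro conjI allI impI)
  fix \<delta> :: real assume "0 < \<delta>"
  then have \<delta>: "0 < \<delta> / 2" by simp
  obtain A where A: "\<And>x. \<bar>f x\<bar> \<le> A * exp (\<delta> / 2 * usum x)" using f \<delta> unfolding moderate_def by blast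
  obtain B where B: "\<And>x. \<bar>g x\<bar> \<le> B * exp (\<delta> / 2 * usum x)" using g \<delta> unfolding moderate_def by blast
  have "\<bar>f x * g x\<bar> \<le> A * B * exp (\<delta> * usum x)" for x
  proof -
    have "\<bar>f x\<bar> * \<bar>g x\<bar> \<le> (A * exp (\<delta> / 2 * usum x)) * (B * exp (\<delta> / 2 * usum x))"
      using A[of x] B[of x] by (intro mult_mono) (auto intro: order_trans[OF abs_ge_zero])
    also have "\<dots> = A * B * (exp (\<delta> / 2 * usum x) * exp (\<delta> / 2 * usum x))" by simp
    finally show ?thesis by (simp add: abs_mult exp_add[symmetric])
  qed
  then show "\<exists>A. \<forall>x. \<bar>f x * g x\<bar> \<le> A * exp (\<delta> * usum x)" by blast
qed (use f g in \<open>auto simp: moderate_def\<close>)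

lemma moderate_abs: "moderate f \<Longrightarrow> moderate (\<lambda>x. \<bar>f x\<bar>)"
  by (rule moderate_dominated) (auto simp: moderate_def)

lemma integrable_moderate:
  assumes f: "moderate f" and c: "integrable M (\<lambda>x. exp (lincomb u \<theta> x + c * usum x) * p x)"
    and b: "b < c"
  shows "integrable M (\<lambda>x. f x * exp (lincomb u \<theta> x + b * usum x) * p x)"
proof -
  obtain A where A: "\<And>x. \<bar>f x\<bar> \<le> A * exp ((c - b) * usum x)"
    using f b unfolding moderate_def by (meson diff_gt_0_iff_gt)
  have "integrable M (\<lambda>x. (A * exp (lincomb u \<theta> x + c * usum x)) * p x)"
    using c by (simp add: mult.assoc)
  then show ?thesis
  proof (rule integrable_bound_p)
    fix x
    have "\<bar>f x * exp (lincomb u \<theta> x + b * usum x)\<bar>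
        \<le> A * exp ((c - b) * usum x) * exp (lincomb u \<theta> x + b * usum x)"
      using A[of x] by (simp add: abs_mult mult_right_mono)
    also have "\<dots> = A * exp (lincomb u \<theta> x + c * usum x)"
      by (simp add: mult.assoc exp_add[symmetric] algebra_simps)
    finally show "\<bar>f x * exp (lincomb u \<theta> x + b * usum x)\<bar> \<le> A * exp (lincomb u \<theta> x + c * usum x)" .
  qed (use f in \<open>auto simp: moderate_def\<close>)
qed

lemma integrable_moment:
  assumes "moderate f" "\<theta> \<in> moment_domain"
  shows "integrable M (\<lambda>x. f x * exp (lincomb u \<theta> x) * p x)"
proof -
  obtain c where "0 < c" "integrable M (\<lambda>x. exp (lincomb u \<theta> x + c * usum x) * p x)"
    using assms(2) by (auto simp: moment_domain_def)
  from integrable_moderate[OF assms(1) this(2), of 0] this(1) show ?thesis by simp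
qed

lemma moment_domain_neighborhood:
  assumes c: "integrable M (\<lambda>x. exp (lincomb u \<theta> x + c * usum x) * p x)" and h: "norm h < c"
  shows "\<theta> + h \<in> moment_domain"
proof -
  have "integrable M (\<lambda>x. exp (lincomb u (\<theta> + h) x + (c - norm h) * usum x) * p x)"
  proof (rule integrable_bound_p[OF c])
    fix x
    have "lincomb u (\<theta> + h) x + (c - norm h) * usum x \<le> lincomb u \<theta> x + c * usum x"
      using abs_lincomb_le[of h x] by (simp add: lincomb_add algebra_simps)
    then show "\<bar>exp (lincomb u (\<theta> + h) x + (c - norm h) * usum x)\<bar>
        \<le> exp (lincomb u \<theta> x + c * usum x)" by simp
  qed measurable
  then show ?thesis
    unfolding moment_domain_def using h by (intro CollectI exI[of _ "c - norm h"]) simp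
qed

lemma open_moment_domain: "open moment_domain"
  unfolding open_dist
proof
  fix \<theta> assume "\<theta> \<in> moment_domain"
  then obtain c where c: "0 < c" "integrable M (\<lambda>x. exp (lincomb u \<theta> x + c * usum x) * p x)"
    by (auto simp: moment_domain_def)
  have "y \<in> moment_domain" if "dist y \<theta> < c" for y
    using moment_domain_neighborhood[OF c(2), of "y - \<theta>"] that by (simp add: dist_norm)
  then show "\<exists>e>0. \<forall>y. dist y \<theta> < e \<longrightarrow> y \<in> moment_domain" using c(1) by blast
qed

text \<open>At an interior parameter, small steps along \<open>\<plusminus>u\<^sub>j\<close> keep the exponential integrable, and finitely many of
  these exponentials dominate \<open>exp(d \<Sum> \<bar>u\<^sub>j\<bar>)\<close>.\<close>

lemma Theta_subset_moment_domain: "Theta M p u \<subseteq> moment_domain"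
proof
  fix \<theta> assume "\<theta> \<in> Theta M p u"
  then obtain \<epsilon> where \<epsilon>: "0 < \<epsilon>" "\<And>v. v \<in> B_space M p \<Longrightarrow> B_norm M p (\<lambda>x. v x - lincomb u \<theta> x) < \<epsilon>
      \<Longrightarrow> v \<in> K_dom M p"
    by (auto simp: Theta_def K_dom_interior_def)
  have "\<forall>j. \<exists>c>0. \<forall>s. \<bar>s\<bar> \<le> c \<longrightarrow> B_norm M p (\<lambda>x. s * u j x) < \<epsilon>"
    using B_norm_scale_small[OF u_B \<epsilon>(1)] by metis
  from choice[OF this] obtain c where
    c: "\<And>j. 0 < c j" "\<And>j s. \<bar>s\<bar> \<le> c j \<Longrightarrow> B_norm M p (\<lambda>x. s * u j x) < \<epsilon>" by blast
  define b where "b = Min (range c)"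
  have b: "0 < b" "\<And>j. b \<le> c j" using c(1) by (auto simp: b_def)
  have int: "integrable M (\<lambda>x. exp (lincomb u \<theta> x + s * u j x) * p x)" if "\<bar>s\<bar> \<le> b" for s j
  proof -
    have "(\<lambda>x. lincomb u \<theta> x + s * u j x) \<in> K_dom M p"
    proof (rule \<epsilon>(2))
      show "(\<lambda>x. lincomb u \<theta> x + s * u j x) \<in> B_space M p"
        using B_space_combination[OF lincomb_in_B_space[of \<theta>] u_B[of j], of 1 s] by simp
      show "B_norm M p (\<lambda>x. lincomb u \<theta> x + s * u j x - lincomb u \<theta> x) < \<epsilon>"
        using c(2)[of s j] b(2)[of j] that by simp
    qed
    then show ?thesis by (simp add: K_dom_iff)
  qed
  define d where "d = b / real CARD('d)"
  have "integrable M (\<lambda>x. \<Sum>j\<in>UNIV. exp (lincomb u \<theta> x + b * u j x) * p x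
      + exp (lincomb u \<theta> x + (- b) * u j x) * p x)"
    using b(1) by (intro Bochner_Integration.integrable_sum Bochner_Integration.integrable_add int) auto
  then have "integrable M (\<lambda>x. (\<Sum>j\<in>UNIV. exp (lincomb u \<theta> x + b * u j x)
      + exp (lincomb u \<theta> x + (- b) * u j x)) * p x)"
    by (simp only: sum_distrib_right distrib_right)
  then have "integrable M (\<lambda>x. exp (lincomb u \<theta> x + d * usum x) * p x)"
  proof (rule integrable_bound_p)
    fix x
    \<comment> \<open>the largest of the \<open>\<bar>u j x\<bar>\<close> is at least their mean\<close>
    obtain k where k: "\<And>j. \<bar>u j x\<bar> \<le> \<bar>u k x\<bar>"
    proof -
      have "Max (range (\<lambda>j. \<bar>u j x\<bar>)) \<in> range (\<lambda>j. \<bar>u j x\<bar>)" by (intro Max_in) auto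
      then obtain k where "Max (range (\<lambda>j. \<bar>u j x\<bar>)) = \<bar>u k x\<bar>" by blast
      then have "\<bar>u j x\<bar> \<le> \<bar>u k x\<bar>" for j
        using Max_ge[of "range (\<lambda>j. \<bar>u j x\<bar>)" "\<bar>u j x\<bar>"] by simp
      then show ?thesis using that[of k] by blast
    qed
    have "usum x \<le> real CARD('d) * \<bar>u k x\<bar>"
      unfolding usum_def using sum_bounded_above[of UNIV "\<lambda>j. \<bar>u j x\<bar>" "\<bar>u k x\<bar>"] k by simp
    then have "d * usum x \<le> d * (real CARD('d) * \<bar>u k x\<bar>)"
      using b(1) by (intro mult_left_mono) (auto simp: d_def)
    also have "\<dots> = b * \<bar>u k x\<bar>" by (simp add: d_def)
    finally have "exp (lincomb u \<theta> x + d * usum x) \<le> exp (lincomb u \<theta> x + b * \<bar>u k x\<bar>)" by simp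
    also have "\<dots> \<le> exp (lincomb u \<theta> x + b * u k x) + exp (lincomb u \<theta> x + (- b) * u k x)"
    proof (cases "0 \<le> u k x")
      case True
      then show ?thesis using exp_ge_zero[of "lincomb u \<theta> x + (- b) * u k x"] by simp
    next
      case False
      then show ?thesis using exp_ge_zero[of "lincomb u \<theta> x + b * u k x"] by simp
    qed
    also have "\<dots> \<le> (\<Sum>j\<in>UNIV. exp (lincomb u \<theta> x + b * u j x) + exp (lincomb u \<theta> x + (- b) * u j x))"
      by (rule member_le_sum[where f = "\<lambda>j. exp (lincomb u \<theta> x + b * u j x)
            + exp (lincomb u \<theta> x + (- b) * u j x)"]) (simp_all add: add_nonneg_nonneg)
    finally show "\<bar>exp (lincomb u \<theta> x + d * usum x)\<bar> \<le> (\<Sum>j\<in>UNIV. exp (lincomb u \<theta> x + b * u j x)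
        + exp (lincomb u \<theta> x + (- b) * u j x))" by simp
  qed measurable
  then show "\<theta> \<in> moment_domain"
    unfolding moment_domain_def using b(1) by (intro CollectI exI[of _ d]) (simp add: d_def)
qed

section \<open>Derivatives of moments and of the second-moment matrix\<close>

text \<open>The remainder of first order is at most a constant times \<open>\<bar>h\<bar>\<^sup>2\<close>, because \<open>\<bar>e\<^sup>y - 1 - y\<bar> \<le> y\<^sup>2 e\<^sup>\<bar>\<^sup>y\<^sup>\<bar>\<close>
  and the spare exponential moment absorbs \<open>e\<^sup>\<bar>\<^sup>y\<^sup>\<bar>\<close>.  The derivative is again a combination of moments of moderate
  functions, so it is continuous.\<close>

lemma moment_has_derivative:
  assumes f: "moderate f" and \<theta>: "\<theta> \<in> moment_domain"
  shows "(moment f has_derivative (\<lambda>h. \<Sum>k\<in>UNIV. h $ k * moment (\<lambda>x. u k x * f x) \<theta>)) (at \<theta>)"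
proof -
  obtain c where c: "0 < c" and intc: "integrable M (\<lambda>x. exp (lincomb u \<theta> x + c * usum x) * p x)"
    using \<theta> by (auto simp: moment_domain_def)
  let ?w = "\<lambda>x. \<bar>f x\<bar> * (usum x * usum x) * exp (lincomb u \<theta> x + c / 2 * usum x) * p x"
  define K where "K = integral\<^sup>L M ?w"
  have intw: "integrable M ?w"
    using integrable_moderate[OF moderate_mult[OF moderate_abs[OF f]
          moderate_mult[OF moderate_usum moderate_usum]] intc, of "c / 2"] c by simp
  have bound: "\<bar>moment f (\<theta> + h) - moment f \<theta> - (\<Sum>k\<in>UNIV. h $ k * moment (\<lambda>x. u k x * f x) \<theta>)\<bar>
      \<le> (norm h)\<^sup>2 * K" if h: "norm h < c / 2" for h
  proof -
    have \<theta>h: "\<theta> + h \<in> moment_domain"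
      using moment_domain_neighborhood[OF intc, of h] h c by linarith
    have i1: "integrable M (\<lambda>x. f x * exp (lincomb u (\<theta> + h) x) * p x)"
      "integrable M (\<lambda>x. f x * exp (lincomb u \<theta> x) * p x)"
      using integrable_moment[OF f] \<theta> \<theta>h by auto
    have i2: "integrable M (\<lambda>x. h $ k * (u k x * f x * exp (lincomb u \<theta> x) * p x))" for k
      using integrable_moment[OF moderate_mult[OF moderate_u f] \<theta>] by simp
    let ?r = "\<lambda>x. f x * exp (lincomb u (\<theta> + h) x) * p x - f x * exp (lincomb u \<theta> x) * p x
        - (\<Sum>k\<in>UNIV. h $ k * (u k x * f x * exp (lincomb u \<theta> x) * p x))"
    have eq: "moment f (\<theta> + h) - moment f \<theta> - (\<Sum>k\<in>UNIV. h $ k * moment (\<lambda>x. u k x * f x) \<theta>)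
        = integral\<^sup>L M ?r"
      using i1 i2 by (simp add: moment_def)
    have "\<bar>integral\<^sup>L M ?r\<bar> \<le> (\<integral>x. \<bar>?r x\<bar> \<partial>M)" by (rule integral_abs_bound)
    also have "\<dots> \<le> (\<integral>x. (norm h)\<^sup>2 * ?w x \<partial>M)"
    proof (rule integral_mono_AE[OF integrable_abs integrable_mult_right[OF intw]])
      show "integrable M ?r"
        by (rule Bochner_Integration.integrable_diff[OF Bochner_Integration.integrable_diff[OF i1]
              Bochner_Integration.integrable_sum[OF i2]])
      show "AE x in M. \<bar>?r x\<bar> \<le> (norm h)\<^sup>2 * ?w x"
        using p_pos
      proof eventually_elim
        case (elim x)
        define y where "y = lincomb u h x"
        define N where "N = usum x"
        have N: "0 \<le> N" by (simp add: N_def usum_nonneg)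
        have y: "\<bar>y\<bar> \<le> norm h * N" unfolding y_def N_def by (rule abs_lincomb_le)
        have "(\<Sum>k\<in>UNIV. h $ k * (u k x * f x * exp (lincomb u \<theta> x) * p x))
            = y * (f x * exp (lincomb u \<theta> x) * p x)"
          by (simp add: y_def lincomb_def sum_distrib_right mult.assoc)
        then have r: "?r x = f x * exp (lincomb u \<theta> x) * p x * (exp y - 1 - y)"
          unfolding lincomb_add exp_add y_def[symmetric] by (simp only:) (simp add: algebra_simps)
        have "\<bar>exp y - 1 - y\<bar> \<le> y\<^sup>2 * exp \<bar>y\<bar>" by (rule exp_second_order_bound)
        also have "\<dots> \<le> (norm h * N)\<^sup>2 * exp (c / 2 * N)"
        proof (intro mult_mono)
          show "y\<^sup>2 \<le> (norm h * N)\<^sup>2" using y by (metis abs_ge_zero power2_abs power_mono)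
          show "exp \<bar>y\<bar> \<le> exp (c / 2 * N)"
            using y mult_right_mono[OF less_imp_le[OF h] N] by simp
        qed auto
        finally have "\<bar>?r x\<bar> \<le> \<bar>f x\<bar> * exp (lincomb u \<theta> x) * p x * ((norm h * N)\<^sup>2 * exp (c / 2 * N))"
          unfolding r using elim by (simp add: abs_mult mult_left_mono)
        also have "\<dots> = (norm h)\<^sup>2 * ?w x"
          by (simp add: N_def exp_add power2_eq_square)
        finally show ?case .
      qed
    qed
    also have "\<dots> = (norm h)\<^sup>2 * K" by (simp add: K_def)
    finally show ?thesis unfolding eq .
  qed
  show ?thesis
    unfolding has_derivative_at_alt
  proof (intro conjI allI impI)
    show "bounded_linear (\<lambda>h. \<Sum>k\<in>UNIV. h $ k * moment (\<lambda>x. u k x * f x) \<theta>)"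
      by (intro bounded_linear_sum bounded_linear_mult_const bounded_linear_vec_nth)
    fix e :: real assume e: "0 < e"
    define d where "d = min (c / 2) (e / (\<bar>K\<bar> + 1))"
    have "0 < d" using c e by (simp add: d_def)
    moreover have "norm (moment f y - moment f \<theta> - (\<Sum>k\<in>UNIV. (y - \<theta>) $ k * moment (\<lambda>x. u k x * f x) \<theta>))
        \<le> e * norm (y - \<theta>)" if y: "norm (y - \<theta>) < d" for y
    proof -
      have "norm (y - \<theta>) * K \<le> norm (y - \<theta>) * (\<bar>K\<bar> + 1)" by (intro mult_left_mono) auto
      also have "\<dots> \<le> e / (\<bar>K\<bar> + 1) * (\<bar>K\<bar> + 1)"
        using y by (intro mult_right_mono) (auto simp: d_def)
      also have "\<dots> = e" by simp
      finally have "norm (y - \<theta>) * (norm (y - \<theta>) * K) \<le> norm (y - \<theta>) * e"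
        by (intro mult_left_mono) auto
      then show ?thesis
        using bound[of "y - \<theta>"] y by (simp add: d_def power2_eq_square algebra_simps)
    qed
    ultimately show "\<exists>d>0. \<forall>y. norm (y - \<theta>) < d \<longrightarrow> norm (moment f y - moment f \<theta>
        - (\<Sum>k\<in>UNIV. (y - \<theta>) $ k * moment (\<lambda>x. u k x * f x) \<theta>)) \<le> e * norm (y - \<theta>)" by blast
  qed
qed

lemma continuous_on_moment: "moderate f \<Longrightarrow> continuous_on moment_domain (moment f)"
  by (intro continuous_at_imp_continuous_on ballI has_derivative_continuous[OF moment_has_derivative])

lemma moment_one_pos:
  assumes "\<theta> \<in> moment_domain"
  shows "0 < moment (\<lambda>x. 1) \<theta>"
proof -
  have int: "integrable M (\<lambda>x. 1 * exp (lincomb u \<theta> x) * p x)"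
    by (rule integrable_moment[OF moderate_const assms])
  have nn: "AE x in M. 0 \<le> 1 * exp (lincomb u \<theta> x) * p x"
    using p_pos by eventually_elim simp
  have "moment (\<lambda>x. 1) \<theta> \<noteq> 0"
  proof
    assume "moment (\<lambda>x. 1) \<theta> = 0"
    then have "AE x in M. 1 * exp (lincomb u \<theta> x) * p x = 0"
      using integral_nonneg_eq_0_iff_AE[OF int nn] by (simp add: moment_def)
    then have "AE x in M. p x = 0" by simp
    then have "integral\<^sup>L M p = 0" by (rule integral_eq_zero_AE)
    then show False using p_integral by simp
  qed
  moreover have "0 \<le> moment (\<lambda>x. 1) \<theta>"
    unfolding moment_def by (rule integral_nonneg_AE[OF nn])
  ultimately show ?thesis by simp
qed

lemma psi_eq:
  assumes "\<theta> \<in> moment_domain"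
  shows "psi M p u \<theta> = ln (moment (\<lambda>x. 1) \<theta>)"
proof -
  have int: "integrable M (\<lambda>x. exp (lincomb u \<theta> x) * p x)"
    using integrable_moment[OF moderate_const[of 1] assms] by simp
  have "nn_expect M p (\<lambda>x. exp (lincomb u \<theta> x)) = ennreal (moment (\<lambda>x. 1) \<theta>)"
    using nn_expect_finite_iff(2)[OF _ _ int] by (simp add: moment_def)
  then show ?thesis
    using moment_one_pos[OF assms] by (simp add: psi_def K_fun_def Let_def)
qed

lemma p_family_eq:
  assumes "\<theta> \<in> moment_domain"
  shows "p_family M p u \<theta> x = exp (lincomb u \<theta> x) * p x / moment (\<lambda>x. 1) \<theta>"
  using moment_one_pos[OF assms] by (simp add: p_family_def psi_eq[OF assms] exp_diff)

lemma expect_p_family: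
  assumes "\<theta> \<in> moment_domain"
  shows "expect M (p_family M p u \<theta>) f = moment f \<theta> / moment (\<lambda>x. 1) \<theta>"
  by (simp add: expect_def p_family_eq[OF assms] moment_def mult.assoc)

abbreviation VV :: "'d option \<Rightarrow> 'd option \<Rightarrow> 'a \<Rightarrow> real" where
  "VV i j x \<equiv> V_vec u x $ i * V_vec u x $ j"

lemma moderate_V: "moderate (\<lambda>x. V_vec u x $ i)"
  by (cases i) (simp_all add: V_vec_def moderate_const moderate_u)

lemma moderate_VV: "moderate (VV i j)"
  by (intro moderate_mult moderate_V)

lemma S_mat_nth:
  assumes "\<theta> \<in> moment_domain"
  shows "S_mat M p u \<theta> $ i $ j = moment (VV i j) \<theta> / moment (\<lambda>x. 1) \<theta>"
  by (simp add: S_mat_def F_map_def expect_p_family[OF assms])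

text \<open>The quotient rule for \<open>S = E[V V\<^sup>T e\<^sup>\<theta>\<^sup>u] / E[e\<^sup>\<theta>\<^sup>u]\<close>; by \<open>partial_S_eq\<close> these are the partial derivatives.\<close>

definition dS :: "real ^ 'd \<Rightarrow> 'd \<Rightarrow> real ^ 'd option ^ 'd option" where
  "dS \<theta> k = (\<chi> i j. (moment (\<lambda>x. u k x * VV i j x) \<theta> * moment (\<lambda>x. 1) \<theta>
      - moment (VV i j) \<theta> * moment (u k) \<theta>) / (moment (\<lambda>x. 1) \<theta>)\<^sup>2)"

lemma has_derivative_matrix:
  fixes f :: "'b::real_normed_vector \<Rightarrow> real ^ 'n ^ 'm"
  assumes "\<And>i j. ((\<lambda>x. f x $ i $ j) has_derivative (\<lambda>h. f' h $ i $ j)) (at x within S)"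
  shows "(f has_derivative f') (at x within S)"
  using assms
  by (subst has_derivative_componentwise_within)
    (auto simp: Basis_vec_def inner_axis axis_eq_axis)

lemma S_mat_has_derivative:
  assumes \<theta>: "\<theta> \<in> moment_domain"
  shows "(S_mat M p u has_derivative (\<lambda>h. \<Sum>k\<in>UNIV. h $ k *\<^sub>R dS \<theta> k)) (at \<theta>)"
proof (rule has_derivative_matrix)
  fix i j
  let ?Z = "moment (\<lambda>x. 1)" and ?g = "moment (VV i j)"
  have Z: "?Z \<theta> \<noteq> 0" using moment_one_pos[OF \<theta>] by simp
  have dZ: "(?Z has_derivative (\<lambda>h. \<Sum>k\<in>UNIV. h $ k * moment (u k) \<theta>)) (at \<theta>)"
    using moment_has_derivative[OF moderate_const[of 1] \<theta>] by simp
  have quotient: "((\<lambda>\<theta>. ?g \<theta> / ?Z \<theta>) has_derivative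
      (\<lambda>h. ((\<Sum>k\<in>UNIV. h $ k * moment (\<lambda>x. u k x * VV i j x) \<theta>) * ?Z \<theta>
        - ?g \<theta> * (\<Sum>k\<in>UNIV. h $ k * moment (u k) \<theta>)) / (?Z \<theta> * ?Z \<theta>))) (at \<theta>)"
    by (rule has_derivative_divide'[OF moment_has_derivative[OF moderate_VV \<theta>] dZ Z])
  have "(\<lambda>h. ((\<Sum>k\<in>UNIV. h $ k * moment (\<lambda>x. u k x * VV i j x) \<theta>) * ?Z \<theta>
        - ?g \<theta> * (\<Sum>k\<in>UNIV. h $ k * moment (u k) \<theta>)) / (?Z \<theta> * ?Z \<theta>))
      = (\<lambda>h. (\<Sum>k\<in>UNIV. h $ k *\<^sub>R dS \<theta> k) $ i $ j)"
  proof
    fix h :: "real ^ 'd"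
    let ?A = "\<lambda>k. moment (\<lambda>x. u k x * VV i j x) \<theta>" and ?B = "\<lambda>k. moment (u k) \<theta>"
    have "(\<Sum>k\<in>UNIV. h $ k *\<^sub>R dS \<theta> k) $ i $ j
        = (\<Sum>k\<in>UNIV. h $ k * (?A k * ?Z \<theta> - ?g \<theta> * ?B k)) / (?Z \<theta> * ?Z \<theta>)"
      by (simp add: dS_def power2_eq_square sum_divide_distrib)
    moreover have "(\<Sum>k\<in>UNIV. h $ k * (?A k * ?Z \<theta> - ?g \<theta> * ?B k))
        = (\<Sum>k\<in>UNIV. h $ k * ?A k) * ?Z \<theta> - ?g \<theta> * (\<Sum>k\<in>UNIV. h $ k * ?B k)"
      unfolding sum_distrib_left sum_distrib_right sum_subtractf[symmetric]
      by (intro sum.cong refl) (simp only: right_diff_distrib mult.assoc mult.left_commute)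
    ultimately show "((\<Sum>k\<in>UNIV. h $ k * ?A k) * ?Z \<theta> - ?g \<theta> * (\<Sum>k\<in>UNIV. h $ k * ?B k))
        / (?Z \<theta> * ?Z \<theta>) = (\<Sum>k\<in>UNIV. h $ k *\<^sub>R dS \<theta> k) $ i $ j" by (simp only:)
  qed
  from quotient[unfolded this] show "((\<lambda>\<theta>. S_mat M p u \<theta> $ i $ j) has_derivative
      (\<lambda>h. (\<Sum>k\<in>UNIV. h $ k *\<^sub>R dS \<theta> k) $ i $ j)) (at \<theta>)"
    by (rule has_derivative_transform_within_open[OF _ open_moment_domain \<theta>]) (simp add: S_mat_nth)
qed

lemma continuous_on_dS: "continuous_on moment_domain (\<lambda>\<theta>. dS \<theta> k)"
proof -
  have c: "continuous_on moment_domain (moment (\<lambda>x. u k x * VV i j x))"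
    "continuous_on moment_domain (moment (VV i j))"
    "continuous_on moment_domain (moment (u k))"
    "continuous_on moment_domain (moment (\<lambda>x. 1))" for i j
    using continuous_on_moment[OF moderate_mult[OF moderate_u moderate_VV]]
      continuous_on_moment[OF moderate_VV] continuous_on_moment[OF moderate_u]
      continuous_on_moment[OF moderate_const] by simp_all
  have "\<forall>\<theta>\<in>moment_domain. (moment (\<lambda>x. 1) \<theta>)\<^sup>2 \<noteq> 0" using moment_one_pos by force
  then show ?thesis
    unfolding dS_def
    by (intro continuous_on_vec_lambda continuous_on_divide continuous_on_diff continuous_on_mult
        continuous_on_power c)
qed

lemma partial_S_eq:
  assumes \<theta>: "\<theta> \<in> moment_domain"
  shows "partial_S M p u k \<theta> = dS \<theta> k"
proof -
  have "((\<lambda>t. \<theta> + t *\<^sub>R axis k 1) has_vector_derivative axis k 1) (at 0)"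
    by (auto intro!: derivative_eq_intros)
  moreover have "(S_mat M p u has_derivative (\<lambda>h. \<Sum>k\<in>UNIV. h $ k *\<^sub>R dS \<theta> k))
      (at (\<theta> + 0 *\<^sub>R axis k 1) within range (\<lambda>t. \<theta> + t *\<^sub>R axis k 1))"
    using S_mat_has_derivative[OF \<theta>] by (simp add: has_derivative_at_withinI)
  ultimately have deriv: "((S_mat M p u \<circ> (\<lambda>t. \<theta> + t *\<^sub>R axis k 1)) has_vector_derivative
      (\<Sum>j\<in>UNIV. axis k 1 $ j *\<^sub>R dS \<theta> j)) (at 0)"
    by (intro vector_derivative_diff_chain_within) (auto intro: has_derivative_at_withinI)
  have "(\<Sum>j\<in>UNIV. axis k 1 $ j *\<^sub>R dS \<theta> j) = dS \<theta> k"
    by (simp add: axis_def if_distrib[of "\<lambda>x. x *\<^sub>R _"] cong: if_cong)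
  from vector_derivative_at[OF deriv[unfolded this]] show ?thesis
    by (simp add: partial_S_def o_def)
qed

end

section \<open>Independent generators: positive definiteness and identifiability\<close>

locale independent_orlicz_family = orlicz_family M p u
  for M :: "'a measure" and p :: "'a \<Rightarrow> real" and u :: "'d::finite \<Rightarrow> 'a \<Rightarrow> real" +
  assumes indep: "lin_indep_L2 M p u"
begin

text \<open>The \<open>u\<^sub>j\<close> are centred, so that independence extends to \<open>u\<^sub>1, \<dots>, u\<^sub>d, 1\<close>: the constant is the expectation
  of the combination, hence zero.\<close>

lemma lincomb_AE_const:
  assumes "AE x in M. lincomb u c x = k"
  shows "c = 0" "k = 0"
proof -
  have "expect M p (lincomb u c) = (\<integral>x. k * p x \<partial>M)"
    unfolding expect_def by (rule integral_cong_AE) (use assms in auto)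
  then show k: "k = 0"
    using lincomb_in_B_space[of c] p_integral by (simp add: B_space_def)
  have "AE x in density M (\<lambda>x. ennreal (p x)). lincomb u c x = 0"
    using assms k by (auto simp: AE_density elim: eventually_mono)
  then show "c = 0" using indep by (simp add: lin_indep_L2_def)
qed

lemma V_inner: "v \<bullet> V_vec u x = v $ None + lincomb u (\<chi> j. v $ Some j) x"
  by (simp add: inner_vec_def V_vec_def lincomb_def UNIV_option_conv sum.reindex)

text \<open>The quadratic form of \<open>S\<close> at \<open>v\<close> is the second moment of \<open>v \<bullet> V\<close>.\<close>

lemma S_mat_spd:
  assumes \<theta>: "\<theta> \<in> moment_domain"
  shows "spd (S_mat M p u \<theta>)"
  unfolding spd_def
proof (intro conjI allI impI)
  show "transpose (S_mat M p u \<theta>) = S_mat M p u \<theta>"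
    by (simp add: vec_eq_iff transpose_def S_mat_nth[OF \<theta>] mult.commute)
next
  fix v :: "real ^ 'd option" assume v: "v \<noteq> 0"
  let ?q = "\<lambda>x. (v \<bullet> V_vec u x)\<^sup>2" and ?Z = "moment (\<lambda>x. 1) \<theta>"
  have q: "?q x * e = (\<Sum>i\<in>UNIV. \<Sum>j\<in>UNIV. v $ i * v $ j * (VV i j x * e))" for x e
  proof -
    have "?q x * e = (\<Sum>i\<in>UNIV. v $ i * V_vec u x $ i) * (\<Sum>j\<in>UNIV. v $ j * V_vec u x $ j) * e"
      by (simp add: power2_eq_square inner_vec_def)
    also have "\<dots> = (\<Sum>i\<in>UNIV. \<Sum>j\<in>UNIV. (v $ i * V_vec u x $ i) * (v $ j * V_vec u x $ j) * e)"
      unfolding sum_product by (simp only: sum_distrib_right)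
    also have "\<dots> = (\<Sum>i\<in>UNIV. \<Sum>j\<in>UNIV. v $ i * v $ j * (VV i j x * e))"
      by (intro sum.cong refl) (simp only: mult.assoc mult.left_commute)
    finally show ?thesis .
  qed
  have int: "integrable M (\<lambda>x. v $ i * v $ j * (VV i j x * (exp (lincomb u \<theta> x) * p x)))" for i j
    using integrable_moment[OF moderate_VV \<theta>, of i j] by (simp add: mult.assoc)
  have intq: "integrable M (\<lambda>x. ?q x * (exp (lincomb u \<theta> x) * p x))"
    unfolding q by (intro Bochner_Integration.integrable_sum int)
  have eq: "v \<bullet> (S_mat M p u \<theta> *v v) = (\<integral>x. ?q x * (exp (lincomb u \<theta> x) * p x) \<partial>M) / ?Z"
  proof -
    have "(\<integral>x. ?q x * (exp (lincomb u \<theta> x) * p x) \<partial>M)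
        = (\<Sum>i\<in>UNIV. \<Sum>j\<in>UNIV. v $ i * v $ j * moment (VV i j) \<theta>)"
      unfolding q moment_def using int
      by (simp add: Bochner_Integration.integral_sum Bochner_Integration.integrable_sum mult.assoc)
    then show ?thesis
      by (simp add: quadratic_form_sum S_mat_nth[OF \<theta>] sum_divide_distrib algebra_simps)
  qed
  have nn: "AE x in M. 0 \<le> ?q x * (exp (lincomb u \<theta> x) * p x)"
    using p_pos by eventually_elim simp
  have "(\<integral>x. ?q x * (exp (lincomb u \<theta> x) * p x) \<partial>M) \<noteq> 0"
  proof
    assume "(\<integral>x. ?q x * (exp (lincomb u \<theta> x) * p x) \<partial>M) = 0"
    then have "AE x in M. ?q x * (exp (lincomb u \<theta> x) * p x) = 0"
      using integral_nonneg_eq_0_iff_AE[OF intq nn] by simp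
    then have "AE x in M. lincomb u (\<chi> j. v $ Some j) x = - v $ None"
      using p_pos by eventually_elim (auto simp: V_inner)
    from lincomb_AE_const[OF this] have "v $ i = 0" for i
      by (cases i) (auto simp: vec_eq_iff)
    then show False using v by (simp add: vec_eq_iff)
  qed
  moreover have "0 \<le> (\<integral>x. ?q x * (exp (lincomb u \<theta> x) * p x) \<partial>M)"
    by (rule integral_nonneg_AE[OF nn])
  ultimately show "0 < v \<bullet> (S_mat M p u \<theta> *v v)"
    unfolding eq using moment_one_pos[OF \<theta>] by simp
qed

text \<open>With \<open>w = (\<eta> - \<theta>) \<bullet> u\<close> the density \<open>q\<^sub>\<eta>\<close> is \<open>e\<^sup>w\<^sup>-\<^sup>k q\<^sub>\<theta>\<close>.  Equal expectations give
  \<open>\<integral> (w - k) (q\<^sub>\<eta> - q\<^sub>\<theta>) = 0\<close>, but the integrand \<open>(w - k) (e\<^sup>w\<^sup>-\<^sup>k - 1) q\<^sub>\<theta>\<close> is nonnegative.\<close>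

lemma expectation_injective:
  assumes \<theta>: "\<theta> \<in> moment_domain" and \<eta>: "\<eta> \<in> moment_domain"
    and eq: "\<And>j. moment (u j) \<theta> / moment (\<lambda>x. 1) \<theta> = moment (u j) \<eta> / moment (\<lambda>x. 1) \<eta>"
  shows "\<theta> = \<eta>"
proof -
  define q where "q \<zeta> x = exp (lincomb u \<zeta> x) * p x / moment (\<lambda>x. 1) \<zeta>" for \<zeta> x
  define k where "k = ln (moment (\<lambda>x. 1) \<eta> / moment (\<lambda>x. 1) \<theta>)"
  define w where "w = lincomb u (\<eta> - \<theta>)"
  have Z: "0 < moment (\<lambda>x. 1) \<theta>" "0 < moment (\<lambda>x. 1) \<eta>" using moment_one_pos \<theta> \<eta> by auto
  have wx: "lincomb u \<eta> x = lincomb u \<theta> x + w x" for x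
    using lincomb_add[of \<theta> "\<eta> - \<theta>" x] by (simp add: w_def)
  have q\<eta>: "q \<eta> x = exp (w x - k) * q \<theta> x" for x
    using Z by (simp add: q_def wx k_def exp_add exp_diff)
  have q1: "has_bochner_integral M (q \<zeta>) 1" if "\<zeta> \<in> moment_domain" for \<zeta>
    using integrable_moment[OF moderate_const[of 1] that] moment_one_pos[OF that]
    by (simp add: has_bochner_integral_iff q_def[abs_def] moment_def)
  have qu: "has_bochner_integral M (\<lambda>x. u j x * q \<zeta> x) (moment (u j) \<zeta> / moment (\<lambda>x. 1) \<zeta>)"
    if "\<zeta> \<in> moment_domain" for \<zeta> j
    using integrable_moment[OF moderate_u that, of j]
    by (simp add: has_bochner_integral_iff q_def[abs_def] moment_def mult.assoc)
  have qw: "has_bochner_integral M (\<lambda>x. w x * q \<zeta> x)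
      (\<Sum>j\<in>UNIV. (\<eta> - \<theta>) $ j * (moment (u j) \<zeta> / moment (\<lambda>x. 1) \<zeta>))" if "\<zeta> \<in> moment_domain" for \<zeta>
    unfolding w_def lincomb_def sum_distrib_right mult.assoc
    by (intro has_bochner_integral_sum has_bochner_integral_mult_right qu that)
  \<comment> \<open>the relative entropy of the two densities, symmetrised, vanishes\<close>
  have "has_bochner_integral M (\<lambda>x. (w x * q \<eta> x - w x * q \<theta> x) - k * (q \<eta> x - q \<theta> x)) 0"
  proof -
    have "has_bochner_integral M (\<lambda>x. w x * q \<eta> x - w x * q \<theta> x) 0"
      using has_bochner_integral_diff[OF qw[OF \<eta>] qw[OF \<theta>]] eq by simp
    moreover have "has_bochner_integral M (\<lambda>x. k * (q \<eta> x - q \<theta> x)) 0"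
      using has_bochner_integral_mult_right[OF has_bochner_integral_diff[OF q1[OF \<eta>] q1[OF \<theta>]], of k]
      by simp
    ultimately show ?thesis using has_bochner_integral_diff by fastforce
  qed
  moreover have "(w x * q \<eta> x - w x * q \<theta> x) - k * (q \<eta> x - q \<theta> x)
      = (w x - k) * (exp (w x - k) - 1) * q \<theta> x" for x
    by (simp add: q\<eta> algebra_simps)
  ultimately have I: "has_bochner_integral M (\<lambda>x. (w x - k) * (exp (w x - k) - 1) * q \<theta> x) 0" by simp
  have sgn: "0 \<le> y * (exp y - 1)" for y :: real
    by (cases "0 \<le> y") (simp_all add: mult_nonpos_nonpos)
  have qpos: "AE x in M. 0 < q \<theta> x" using p_pos by eventually_elim (simp add: q_def Z)
  then have nn: "AE x in M. 0 \<le> (w x - k) * (exp (w x - k) - 1) * q \<theta> x"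
    by eventually_elim (simp add: sgn)
  have "AE x in M. (w x - k) * (exp (w x - k) - 1) * q \<theta> x = 0"
    using integral_nonneg_eq_0_iff_AE[OF _ nn] I unfolding has_bochner_integral_iff by blast
  with qpos have "AE x in M. w x = k" by eventually_elim auto
  then have "\<eta> - \<theta> = 0" unfolding w_def by (rule lincomb_AE_const)
  then show ?thesis by simp
qed

section \<open>Lengths of paths in the family\<close>

text \<open>The pulled-back speed of a path of parameters is the speed of its image in the positive definite
  matrices.\<close>

lemma smooth_path_image:
  assumes \<gamma>: "smooth_path \<gamma>" and dom: "\<gamma> ` {0..1} \<subseteq> moment_domain"
  shows "\<exists>c'. (\<forall>t\<in>{0..1}. ((\<lambda>t. S_mat M p u (\<gamma> t)) has_vector_derivative c' t) (at t within {0..1}))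
    \<and> continuous_on {0..1} (\<lambda>t. airm (S_mat M p u (\<gamma> t)) (c' t) (c' t))
    \<and> (\<forall>t\<in>{0..1}. speed_F M p u \<gamma> t = sqrt (airm (S_mat M p u (\<gamma> t)) (c' t) (c' t)))
    \<and> (\<forall>t. transpose (c' t) = c' t)"
proof -
  obtain D where D: "D 0 = \<gamma>"
    "\<And>n t. t \<in> {0..1} \<Longrightarrow> (D n has_vector_derivative D (Suc n) t) (at t within {0..1})"
    using \<gamma> unfolding smooth_path_def by blast
  define v where "v = D 1"
  have v: "(\<gamma> has_vector_derivative v t) (at t within {0..1})" if "t \<in> {0..1}" for t
    using D(2)[OF that, of 0] by (simp add: D(1) v_def)
  have \<gamma>t: "\<gamma> t \<in> moment_domain" if "t \<in> {0..1}" for t using that dom by auto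
  define c' where "c' t = (\<Sum>k\<in>UNIV. v t $ k *\<^sub>R dS (\<gamma> t) k)" for t
  have d: "((\<lambda>t. S_mat M p u (\<gamma> t)) has_vector_derivative c' t) (at t within {0..1})"
    if t: "t \<in> {0..1}" for t
    using vector_derivative_diff_chain_within[OF v[OF t]
        has_derivative_at_withinI[OF S_mat_has_derivative[OF \<gamma>t[OF t]]]]
    by (simp add: o_def c'_def)
  have cont\<gamma>: "continuous_on {0..1} \<gamma>" and contv: "continuous_on {0..1} v"
    using continuous_on_vector_derivative[OF v] continuous_on_vector_derivative[OF D(2)[of _ 1]]
    by (simp_all add: v_def)
  have contc': "continuous_on {0..1} c'"
    unfolding c'_def
    by (intro continuous_on_sum continuous_on_scaleR continuous_on_component contv
        continuous_on_compose2[OF continuous_on_dS cont\<gamma> dom])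
  have contc: "continuous_on {0..1} (\<lambda>t. S_mat M p u (\<gamma> t))"
    by (rule continuous_on_vector_derivative[OF d])
  have speed: "speed_F M p u \<gamma> t = sqrt (airm (S_mat M p u (\<gamma> t)) (c' t) (c' t))" if t: "t \<in> {0..1}" for t
  proof -
    have "vector_derivative \<gamma> (at t within {0..1}) = v t"
      using v[OF t] t by (intro vector_derivative_within_closed_interval) auto
    then show ?thesis
      by (simp add: speed_F_def Let_def g_F_def partial_S_eq[OF \<gamma>t[OF t]] c'_def airm_sum)
  qed
  have sym: "transpose (c' t) = c' t" for t
    by (simp add: c'_def vec_eq_iff transpose_def dS_def mult.commute)
  show ?thesis
    by (intro exI[of _ c'] conjI ballI allI d speed sym continuous_on_airm[OF contc contc'] S_mat_spd \<gamma>t)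
qed

definition connecting_lengths :: "real ^ 'd \<Rightarrow> real ^ 'd \<Rightarrow> real set" where
  "connecting_lengths \<theta> \<eta> = {integral {0..1} (speed_F M p u \<gamma>) | \<gamma>.
      smooth_path \<gamma> \<and> \<gamma> ` {0..1} \<subseteq> Theta M p u \<and> \<gamma> 0 = \<theta> \<and> \<gamma> 1 = \<eta>}"

lemma smooth_path_segment: "smooth_path (\<lambda>t. \<theta> + t *\<^sub>R h)"
proof -
  define D where "D n t = (if n = 0 then \<theta> + t *\<^sub>R h else if n = 1 then h else 0)" for n :: nat and t
  have "D 0 = (\<lambda>t. \<theta> + t *\<^sub>R h)" by (simp add: D_def fun_eq_iff)
  moreover have "(D n has_vector_derivative D (Suc n) t) (at t within {0..1})" for n t
    unfolding D_def by (cases "n = 0"; cases "n = 1") (auto intro!: derivative_eq_intros)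
  ultimately show ?thesis unfolding smooth_path_def by blast
qed

lemma connecting_lengths_nonempty:
  assumes "\<theta> \<in> Theta M p u" "\<eta> \<in> Theta M p u"
  shows "connecting_lengths \<theta> \<eta> \<noteq> {}"
proof -
  have "\<theta> + t *\<^sub>R (\<eta> - \<theta>) \<in> Theta M p u" if "t \<in> {0..1}" for t
    using convexD_alt[OF convex_Theta assms, of t] that by (simp add: algebra_simps)
  then have "integral {0..1} (speed_F M p u (\<lambda>t. \<theta> + t *\<^sub>R (\<eta> - \<theta>))) \<in> connecting_lengths \<theta> \<eta>"
    unfolding connecting_lengths_def
    by (intro CollectI exI[of _ "\<lambda>t. \<theta> + t *\<^sub>R (\<eta> - \<theta>)"]) (auto simp: smooth_path_segment)
  then show ?thesis by blast
qed

lemma d_F_eq: "d_F M p u \<theta> \<eta> = Inf (connecting_lengths \<theta> \<eta>)"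
  by (simp add: d_F_def connecting_lengths_def)

lemma d_F_refl:
  assumes "\<theta> \<in> Theta M p u"
  shows "d_F M p u \<theta> \<theta> = 0"
  unfolding d_F_eq
proof (rule cInf_eq_minimum)
  have "vector_derivative (\<lambda>t. \<theta>) (at t within {0..1}) = 0" if "t \<in> {0..1}" for t :: real
    using that has_vector_derivative_const by (intro vector_derivative_within_closed_interval) auto
  then have "integral {0..1} (speed_F M p u (\<lambda>t. \<theta> + t *\<^sub>R 0)) = integral {0..1 :: real} (\<lambda>t. 0)"
    by (intro Henstock_Kurzweil_Integration.integral_cong) (simp add: speed_F_def Let_def)
  then show "0 \<in> connecting_lengths \<theta> \<theta>"
    unfolding connecting_lengths_def using assms smooth_path_segment[of \<theta> 0]
    by (intro CollectI exI[of _ "\<lambda>t. \<theta> + t *\<^sub>R 0"]) auto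
next
  fix x assume "x \<in> connecting_lengths \<theta> \<theta>"
  then obtain \<gamma> where x: "x = integral {0..1} (speed_F M p u \<gamma>)" and \<gamma>: "smooth_path \<gamma>"
    "\<gamma> ` {0..1} \<subseteq> moment_domain"
    using Theta_subset_moment_domain by (auto simp: connecting_lengths_def)
  obtain c' where c': "\<forall>t\<in>{0..1}. speed_F M p u \<gamma> t = sqrt (airm (S_mat M p u (\<gamma> t)) (c' t) (c' t))"
    "\<forall>t. transpose (c' t) = c' t"
    using smooth_path_image[OF \<gamma>] by blast
  have "0 \<le> speed_F M p u \<gamma> t" if "t \<in> {0..1}" for t
  proof -
    have "\<gamma> t \<in> moment_domain" using \<gamma>(2) that by auto
    then show ?thesis using c' that airm_nonneg[OF S_mat_spd] by simp
  qed
  then show "0 \<le> x"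
    unfolding x by (cases "speed_F M p u \<gamma> integrable_on {0..1}")
      (auto intro: Henstock_Kurzweil_Integration.integral_nonneg simp: not_integrable_integral)
qed

lemma S_mat_None: "\<theta> \<in> moment_domain \<Longrightarrow> S_mat M p u \<theta> $ None $ None = 1"
  using moment_one_pos[of \<theta>] by (simp add: S_mat_nth V_vec_def)

lemma S_mat_Some: "\<theta> \<in> moment_domain \<Longrightarrow>
    S_mat M p u \<theta> $ Some j $ None = moment (u j) \<theta> / moment (\<lambda>x. 1) \<theta>"
  by (simp add: S_mat_nth V_vec_def)

section \<open>Comparison of the two distances\<close>

lemma F_image_None:
  assumes "A \<in> F_map M u ` N_family M p u"
  shows "A $ None $ None = 1"
  using assms S_mat_None Theta_subset_moment_domain
  by (auto simp: N_family_def S_mat_def[symmetric])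

lemma airm_rigidity_refl:
  assumes \<theta>: "\<theta> \<in> Theta M p u"
  shows "d_AIRM (S_mat M p u \<theta>) (S_mat M p u \<theta>) = d_F M p u \<theta> \<theta>"
    and "airm_geodesic (S_mat M p u \<theta>) (S_mat M p u \<theta>) t \<in> F_map M u ` N_family M p u"
proof -
  let ?S = "S_mat M p u \<theta>"
  have spd: "spd ?S" using S_mat_spd \<theta> Theta_subset_moment_domain by auto
  obtain L :: "real ^ 'd option ^ 'd option" and \<kappa> where L: "invertible L" "?S = L ** transpose L"
    "?S = L ** diag_mat (\<chi> i. exp (\<kappa> $ i)) ** transpose L"
    and dist: "d_AIRM ?S ?S = norm \<kappa> / sqrt 2"
    and geo: "\<And>t. airm_geodesic ?S ?S t = L ** diag_mat (\<chi> i. exp (t * \<kappa> $ i)) ** transpose L"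
    using airm_normal_form[OF spd spd] by blast
  define J where "J = matrix_inv L"
  have J: "J ** L = mat 1" "L ** J = mat 1" using L(1) by (auto simp: J_def)
  have tJ: "transpose L ** transpose J = mat 1"
    using J by (metis matrix_transpose_mul transpose_mat)
  have "J ** (L ** D ** transpose L) ** transpose J = (J ** L) ** D ** (transpose L ** transpose J)" for D
    by (simp only: matrix_mul_assoc)
  then have cancel: "J ** (L ** D ** transpose L) ** transpose J = D" for D by (simp add: J tJ)
  have "diag_mat (\<chi> i. exp (\<kappa> $ i)) = mat 1"
    using cancel[of "diag_mat (\<chi> i. exp (\<kappa> $ i))"] cancel[of "mat 1"] L(2,3) by simp
  then have "exp (\<kappa> $ i) = 1" for i
    using diag_mat_nth[of "\<chi> i. exp (\<kappa> $ i)" i i] by (simp add: mat_def)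
  then have \<kappa>: "\<kappa> = 0" by (simp add: vec_eq_iff)
  show "d_AIRM ?S ?S = d_F M p u \<theta> \<theta>" by (simp add: dist \<kappa> d_F_refl[OF \<theta>])
  have "diag_mat (\<chi> i. exp (t * \<kappa> $ i)) = mat 1" by (simp add: \<kappa> diag_mat_one)
  then have "airm_geodesic ?S ?S t = ?S" by (simp only: geo matrix_mul_rid L(2)[symmetric])
  then show "airm_geodesic ?S ?S t \<in> F_map M u ` N_family M p u"
    using \<theta> by (auto simp: S_mat_def N_family_def)
qed

text \<open>Distinct parameters have distinct last columns, so \<open>\<kappa>\<close> does not vanish on the support of \<open>l\<close>.  The
  midpoint of the geodesic then leaves the slice: its last diagonal entry is \<open>1\<close> only if
  \<open>\<Sum> l\<^sub>i\<^sup>2 (1 - exp(\<kappa>\<^sub>i / 2))\<^sup>2 = 0\<close>.  And the gain \<open>\<delta>\<close> in the length of paths is positive.\<close>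

lemma airm_rigidity_distinct:
  assumes \<theta>: "\<theta> \<in> Theta M p u" and \<eta>: "\<eta> \<in> Theta M p u" and ne: "\<theta> \<noteq> \<eta>"
  shows "d_AIRM (S_mat M p u \<theta>) (S_mat M p u \<eta>) < d_F M p u \<theta> \<eta>"
    and "airm_geodesic (S_mat M p u \<theta>) (S_mat M p u \<eta>) (1 / 2) \<notin> F_map M u ` N_family M p u"
proof -
  let ?S0 = "S_mat M p u \<theta>" and ?S1 = "S_mat M p u \<eta>"
  have dom: "\<theta> \<in> moment_domain" "\<eta> \<in> moment_domain"
    using \<theta> \<eta> Theta_subset_moment_domain by auto
  obtain L :: "real ^ 'd option ^ 'd option" and \<kappa> where L: "invertible L" "?S0 = L ** transpose L"
    "?S1 = L ** diag_mat (\<chi> i. exp (\<kappa> $ i)) ** transpose L"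
    and dist: "d_AIRM ?S0 ?S1 = norm \<kappa> / sqrt 2"
    and geo: "\<And>t. airm_geodesic ?S0 ?S1 t = L ** diag_mat (\<chi> i. exp (t * \<kappa> $ i)) ** transpose L"
    using airm_normal_form[OF S_mat_spd S_mat_spd, OF dom] by blast
  define l where "l i = L $ None $ i" for i
  have geo_nth: "airm_geodesic ?S0 ?S1 t $ a $ None = (\<Sum>i\<in>UNIV. L $ a $ i * exp (t * \<kappa> $ i) * l i)" for t a
    unfolding geo congruence_diag_nth by (simp add: l_def)
  have S0_nth: "?S0 $ a $ None = (\<Sum>i\<in>UNIV. L $ a $ i * l i)" for a
    unfolding L(2) by (simp add: matrix_mult_nth transpose_def l_def)
  have S1_nth: "?S1 $ a $ None = (\<Sum>i\<in>UNIV. L $ a $ i * exp (\<kappa> $ i) * l i)" for a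
    unfolding L(3) congruence_diag_nth by (simp add: l_def)
  have l0: "(\<Sum>i\<in>UNIV. (l i)\<^sup>2) = 1"
    using S0_nth[of None] S_mat_None[OF dom(1)] by (simp add: l_def power2_eq_square)
  have l1: "(\<Sum>i\<in>UNIV. exp (\<kappa> $ i) * (l i)\<^sup>2) = 1"
    using S1_nth[of None] S_mat_None[OF dom(2)] by (simp add: l_def power2_eq_square mult.assoc mult.left_commute)
  have "\<exists>i. \<kappa> $ i \<noteq> 0 \<and> l i \<noteq> 0"
  proof (rule ccontr)
    assume "\<not> (\<exists>i. \<kappa> $ i \<noteq> 0 \<and> l i \<noteq> 0)"
    then have "L $ a $ i * exp (\<kappa> $ i) * l i = L $ a $ i * l i" for a i by auto
    then have "?S0 $ a $ None = ?S1 $ a $ None" for a unfolding S0_nth S1_nth by (simp only:)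
    then have "\<theta> = \<eta>"
      by (intro expectation_injective dom) (simp add: S_mat_Some[symmetric] dom)
    then show False using ne by simp
  qed
  then obtain i where i: "\<kappa> $ i \<noteq> 0" "l i \<noteq> 0" by blast
  then have \<kappa>: "\<kappa> \<noteq> 0" by auto
  show "airm_geodesic ?S0 ?S1 (1 / 2) \<notin> F_map M u ` N_family M p u"
  proof
    assume "airm_geodesic ?S0 ?S1 (1 / 2) \<in> F_map M u ` N_family M p u"
    from F_image_None[OF this] have half: "(\<Sum>i\<in>UNIV. exp (\<kappa> $ i / 2) * (l i)\<^sup>2) = 1"
      unfolding geo_nth by (simp add: l_def power2_eq_square mult.assoc mult.left_commute)
    have "(l j)\<^sup>2 * (1 - exp (\<kappa> $ j / 2))\<^sup>2
        = (l j)\<^sup>2 + exp (\<kappa> $ j) * (l j)\<^sup>2 - 2 * (exp (\<kappa> $ j / 2) * (l j)\<^sup>2)" for j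
    proof -
      have "exp (\<kappa> $ j) = (exp (\<kappa> $ j / 2))\<^sup>2" by (simp add: power2_eq_square exp_add[symmetric])
      then show ?thesis by (simp add: power2_eq_square algebra_simps)
    qed
    then have "(\<Sum>j\<in>UNIV. (l j)\<^sup>2 * (1 - exp (\<kappa> $ j / 2))\<^sup>2) = 0"
      by (simp add: sum.distrib sum_subtractf sum_distrib_left[symmetric] l0 l1 half)
    then have "(l i)\<^sup>2 * (1 - exp (\<kappa> $ i / 2))\<^sup>2 = 0"
      by (subst (asm) sum_nonneg_eq_0_iff) auto
    then show False using i by simp
  qed
  define \<delta> where "\<delta> = ((\<Sum>i\<in>UNIV. \<kappa> $ i * exp (\<kappa> $ i) * (L $ None $ i)\<^sup>2) ^ 3
      - (\<Sum>i\<in>UNIV. \<kappa> $ i * (L $ None $ i)\<^sup>2) ^ 3) / (12 * norm \<kappa> ^ 3)"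
  have "0 < \<delta>"
  proof -
    have "(\<Sum>i\<in>UNIV. \<kappa> $ i * (l i)\<^sup>2) < 0" "0 < (\<Sum>i\<in>UNIV. \<kappa> $ i * exp (\<kappa> $ i) * (l i)\<^sup>2)"
      using endpoint_slopes[where \<kappa> = "\<lambda>i. \<kappa> $ i" and l = l, OF l0 l1 i] by auto
    then have "(\<Sum>i\<in>UNIV. \<kappa> $ i * (l i)\<^sup>2) ^ 3 < 0"
      "0 < (\<Sum>i\<in>UNIV. \<kappa> $ i * exp (\<kappa> $ i) * (l i)\<^sup>2) ^ 3"
      by (auto simp: power_less_zero_eq)
    then have "0 < (\<Sum>i\<in>UNIV. \<kappa> $ i * exp (\<kappa> $ i) * (l i)\<^sup>2) ^ 3
        - (\<Sum>i\<in>UNIV. \<kappa> $ i * (l i)\<^sup>2) ^ 3" by linarith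
    then show ?thesis
      unfolding \<delta>_def l_def[symmetric] by (rule divide_pos_pos) (simp add: \<kappa>)
  qed
  have "(norm \<kappa> + \<delta>) / sqrt 2 \<le> x" if length: "x \<in> connecting_lengths \<theta> \<eta>" for x
  proof -
    obtain \<gamma> where x: "x = integral {0..1} (speed_F M p u \<gamma>)" and \<gamma>: "smooth_path \<gamma>"
      "\<gamma> ` {0..1} \<subseteq> moment_domain" "\<gamma> 0 = \<theta>" "\<gamma> 1 = \<eta>"
      using length Theta_subset_moment_domain by (auto simp: connecting_lengths_def)
    have \<gamma>t: "\<gamma> t \<in> moment_domain" if "t \<in> {0..1}" for t using that \<gamma>(2) by auto
    obtain c' where
      c': "\<forall>t\<in>{0..1}. ((\<lambda>t. S_mat M p u (\<gamma> t)) has_vector_derivative c' t) (at t within {0..1})"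
      "continuous_on {0..1} (\<lambda>t. airm (S_mat M p u (\<gamma> t)) (c' t) (c' t))"
      "\<forall>t\<in>{0..1}. speed_F M p u \<gamma> t = sqrt (airm (S_mat M p u (\<gamma> t)) (c' t) (c' t))"
      using smooth_path_image[OF \<gamma>(1,2)] by blast
    have "x = integral {0..1} (\<lambda>t. sqrt (airm (S_mat M p u (\<gamma> t)) (c' t) (c' t)))"
      unfolding x by (intro Henstock_Kurzweil_Integration.integral_cong bspec[OF c'(3)])
    moreover have "(norm \<kappa> + \<delta>) / sqrt 2
        \<le> integral {0..1} (\<lambda>t. sqrt (airm (S_mat M p u (\<gamma> t)) (c' t) (c' t)))"
      unfolding \<delta>_def
      by (rule airm_length_ge_calibration[OF bspec[OF c'(1)] S_mat_spd[OF \<gamma>t] S_mat_None[OF \<gamma>t] c'(2) L(1) _ _ \<kappa>])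
        (use \<gamma>(3,4) L in auto)
    ultimately show ?thesis by simp
  qed
  then have "(norm \<kappa> + \<delta>) / sqrt 2 \<le> d_F M p u \<theta> \<eta>"
    unfolding d_F_eq by (intro cInf_greatest connecting_lengths_nonempty \<theta> \<eta>)
  moreover have "norm \<kappa> / sqrt 2 < (norm \<kappa> + \<delta>) / sqrt 2"
    using \<open>0 < \<delta>\<close> by (intro divide_strict_right_mono) auto
  ultimately show "d_AIRM ?S0 ?S1 < d_F M p u \<theta> \<eta>" unfolding dist by linarith
qed

end

theorem theorem5p12:
  fixes M :: "'a measure" and p :: "'a \<Rightarrow> real"
    and u :: "'d::finite \<Rightarrow> 'a \<Rightarrow> real" and \<theta>1 \<theta>2 :: "real ^ 'd"
  assumes "sigma_finite_measure M"
    and "p \<in> densities M"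
    and "\<And>j. u j \<in> B_space M p"
    and "lin_indep_L2 M p u"
    and "\<theta>1 \<in> Theta M p u" and "\<theta>2 \<in> Theta M p u"
  shows "d_AIRM (F_map M u (p_family M p u \<theta>1)) (F_map M u (p_family M p u \<theta>2))
          \<le> d_F M p u \<theta>1 \<theta>2
    \<and> (d_AIRM (F_map M u (p_family M p u \<theta>1)) (F_map M u (p_family M p u \<theta>2))
          = d_F M p u \<theta>1 \<theta>2
        \<longleftrightarrow> (\<forall>t\<in>{0..1}.
              airm_geodesic (F_map M u (p_family M p u \<theta>1)) (F_map M u (p_family M p u \<theta>2)) t
                \<in> F_map M u ` N_family M p u))"
proof -
  interpret independent_orlicz_family M p u
    by unfold_locales (fact assms)+
  show ?thesis
    unfolding S_mat_def[symmetric]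
  proof (cases "\<theta>1 = \<theta>2")
    case True
    then show "d_AIRM (S_mat M p u \<theta>1) (S_mat M p u \<theta>2) \<le> d_F M p u \<theta>1 \<theta>2
      \<and> (d_AIRM (S_mat M p u \<theta>1) (S_mat M p u \<theta>2) = d_F M p u \<theta>1 \<theta>2
        \<longleftrightarrow> (\<forall>t\<in>{0..1}. airm_geodesic (S_mat M p u \<theta>1) (S_mat M p u \<theta>2) t
              \<in> F_map M u ` N_family M p u))"
      using airm_rigidity_refl assms(5) by auto
  next
    case False
    have "(1 / 2 :: real) \<in> {0..1}" by simp
    then show "d_AIRM (S_mat M p u \<theta>1) (S_mat M p u \<theta>2) \<le> d_F M p u \<theta>1 \<theta>2
      \<and> (d_AIRM (S_mat M p u \<theta>1) (S_mat M p u \<theta>2) = d_F M p u \<theta>1 \<theta>2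
        \<longleftrightarrow> (\<forall>t\<in>{0..1}. airm_geodesic (S_mat M p u \<theta>1) (S_mat M p u \<theta>2) t
              \<in> F_map M u ` N_family M p u))"
      using airm_rigidity_distinct[OF assms(5,6) False] by (metis less_imp_le less_irrefl)
  qed
qed

end
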